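(* Let $C$ be a coalgebra with counit over a field $\mathbb{K}$ which is both left and right semiperfect. Then $C$ is left coreflexive, i.e. the map $\phi_l: C\to (Rat({}_{C^*}C^* ))^0$, $\phi_l(c)(c^* )=c^*(c)$, is bijective. Moreover, $\phi_l$ is an isomorphism of counital coalgebras.
   Context: Work over a field $\mathbb{K}$. Algebras are associative but not necessarily unital; coalgebras are coassociative; here $C$ has a counit. Dual algebra: $C^*$ is the algebra with convolution product $(c^*d^* )(c)=\sum c^*(c_1)d^*(c_2)$. A left $C^*$-module $M$ has rational part $Rat(M)$, the set of $m\in M$ for which there are finitely many $m_i\in M$, $c_i\in C$ with $c^*m=\sum_i c^*(c_i)m_i$ for all $c^*\in C^*$. $Rat({}_{C^*}C^* )$ denotes the rational part of $C^*$ as a left module over itself; it is a two-sided ideal of $C^*$ and is regarded as a (not necessarily unital) algebra. Finite dual: for a not necessarily unital algebra $A$, $A^0$ is the set of $f\in A^*$ such that $\ker f$ contains a two-sided ideal of $A$ of finite codimension. It is a (not necessarily counital) coalgebra with comultiplication $f\mapsto\sum_j g_j\otimes h_j$, where $g_j,h_j\in A^0$ satisfy $f(ab)=\sum_j g_j(a)h_j(b)$ for all $a,b\in A$. For every $c\in C$, $\phi_l(c)$ lies in $(Rat({}_{C^*}C^* ))^0$, and $\phi_l$ is a morphism of coalgebras. $C$ is right (respectively left) semiperfect if the injective hull of every simple left (respectively right) $C$-comodule, in the category of counital left (respectively right) $C$-comodules, is finite dimensional. *)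

theory Defs
  imports Complex_Main "HOL-Library.Function_Algebras"
begin

section \<open>Vector spaces and tensor products\<close>

text \<open>A vector space is a subspace of an ambient vector space, whose addition is the
  one of the ambient type. Function types carry the pointwise operations.\<close>

record ('k, 'a) vspc =
  carrier :: "'a set"
  scale :: "'k \<Rightarrow> 'a \<Rightarrow> 'a"

definition vspace :: "('k::field, 'a::ab_group_add, 'z) vspc_scheme \<Rightarrow> bool" where
  "vspace V \<longleftrightarrow> vector_space (scale V) \<and> module.subspace (scale V) (carrier V)"

definition ground :: "('k::field, 'k) vspc" where
  "ground = \<lparr>carrier = UNIV, scale = (*)\<rparr>"

definition fscale :: "'k::field \<Rightarrow> ('a \<Rightarrow> 'k) \<Rightarrow> 'a \<Rightarrow> 'k" where
  "fscale a f = (\<lambda>x. a * f x)"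

definition finite_dim :: "('k::field, 'a::ab_group_add, 'z) vspc_scheme \<Rightarrow> bool" where
  "finite_dim V \<longleftrightarrow> (\<exists>B. finite B \<and> B \<subseteq> carrier V \<and> carrier V = module.span (scale V) B)"

definition finite_codim :: "('k::field, 'a::ab_group_add, 'z) vspc_scheme \<Rightarrow> 'a set \<Rightarrow> bool" where
  "finite_codim V I \<longleftrightarrow>
    (\<exists>B. finite B \<and> B \<subseteq> carrier V \<and> carrier V = module.span (scale V) (I \<union> B))"

definition linear_map ::
  "('k::field, 'a::ab_group_add, 'y) vspc_scheme \<Rightarrow> ('k, 'b::ab_group_add, 'z) vspc_scheme
    \<Rightarrow> ('a \<Rightarrow> 'b) \<Rightarrow> bool" where
  "linear_map V W f \<longleftrightarrow>
    (\<forall>x\<in>carrier V. f x \<in> carrier W) \<and>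
    (\<forall>x\<in>carrier V. \<forall>y\<in>carrier V. f (x + y) = f x + f y) \<and>
    (\<forall>a. \<forall>x\<in>carrier V. f (scale V a x) = scale W a (f x))"

definition bilinear_map ::
  "('k::field, 'a::ab_group_add, 'x) vspc_scheme \<Rightarrow> ('k, 'b::ab_group_add, 'y) vspc_scheme
    \<Rightarrow> ('k, 'c::ab_group_add, 'z) vspc_scheme \<Rightarrow> ('a \<Rightarrow> 'b \<Rightarrow> 'c) \<Rightarrow> bool" where
  "bilinear_map V W X b \<longleftrightarrow>
    (\<forall>x\<in>carrier V. linear_map W X (b x)) \<and> (\<forall>y\<in>carrier W. linear_map V X (\<lambda>x. b x y))"

definition trilinear_form ::
  "('k::field, 'a::ab_group_add, 'x) vspc_scheme \<Rightarrow> ('k, 'b::ab_group_add, 'y) vspc_scheme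
    \<Rightarrow> ('k, 'c::ab_group_add, 'z) vspc_scheme \<Rightarrow> ('a \<Rightarrow> 'b \<Rightarrow> 'c \<Rightarrow> 'k) \<Rightarrow> bool" where
  "trilinear_form U V W \<tau> \<longleftrightarrow>
    (\<forall>x\<in>carrier U. bilinear_map V W ground (\<tau> x)) \<and>
    (\<forall>y\<in>carrier V. bilinear_map U W ground (\<lambda>x. \<tau> x y)) \<and>
    (\<forall>z\<in>carrier W. bilinear_map U V ground (\<lambda>x y. \<tau> x y z))"

text \<open>The algebraic tensor product over a field is modelled inside the dual of the space of
  bilinear forms: the pure tensor of \<open>x\<close> and \<open>y\<close> is evaluation at \<open>(x, y)\<close>, and the
  tensor product consists of the finite sums of pure tensors. The universal property
  (every bilinear map into any vector space factors) is lemma \<open>tensor_universal\<close> below.\<close>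

type_synonym ('k, 'a, 'b) tensor = "('a \<Rightarrow> 'b \<Rightarrow> 'k) \<Rightarrow> 'k"
type_synonym ('k, 'a, 'b, 'c) tensor3 = "('a \<Rightarrow> 'b \<Rightarrow> 'c \<Rightarrow> 'k) \<Rightarrow> 'k"

definition pure_tensor ::
  "('k::field, 'a::ab_group_add, 'x) vspc_scheme \<Rightarrow> ('k, 'b::ab_group_add, 'y) vspc_scheme
    \<Rightarrow> 'a \<Rightarrow> 'b \<Rightarrow> ('k, 'a, 'b) tensor" where
  "pure_tensor V W x y = (\<lambda>\<beta>. if bilinear_map V W ground \<beta> then \<beta> x y else 0)"

definition tensor_sum ::
  "('k::field, 'a::ab_group_add, 'x) vspc_scheme \<Rightarrow> ('k, 'b::ab_group_add, 'y) vspc_scheme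
    \<Rightarrow> ('a \<times> 'b) list \<Rightarrow> ('k, 'a, 'b) tensor" where
  "tensor_sum V W xs = (\<Sum>(x, y)\<leftarrow>xs. pure_tensor V W x y)"

definition tensor ::
  "('k::field, 'a::ab_group_add, 'x) vspc_scheme \<Rightarrow> ('k, 'b::ab_group_add, 'y) vspc_scheme
    \<Rightarrow> ('k, ('k, 'a, 'b) tensor) vspc" where
  "tensor V W =
    \<lparr>carrier = {tensor_sum V W xs |xs. set xs \<subseteq> carrier V \<times> carrier W}, scale = fscale\<rparr>"

text \<open>For linear \<open>f\<close> and \<open>g\<close> with values in \<open>V'\<close> and \<open>W'\<close>, this is \<open>f \<otimes> g\<close>; it sends the
  pure tensor of \<open>x\<close> and \<open>y\<close> to that of \<open>f x\<close> and \<open>g y\<close>.\<close>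

definition tensor_map ::
  "('k::field, 'a2::ab_group_add, 'x) vspc_scheme \<Rightarrow> ('k, 'b2::ab_group_add, 'y) vspc_scheme
    \<Rightarrow> ('a \<Rightarrow> 'a2) \<Rightarrow> ('b \<Rightarrow> 'b2) \<Rightarrow> ('k, 'a, 'b) tensor \<Rightarrow> ('k, 'a2, 'b2) tensor" where
  "tensor_map V' W' f g t =
    (\<lambda>\<beta>. if bilinear_map V' W' ground \<beta> then t (\<lambda>x y. \<beta> (f x) (g y)) else 0)"

text \<open>For linear \<open>D : X \<rightarrow> U \<otimes> V\<close>, \<open>expand_left U V W D\<close> is \<open>D \<otimes> id : X \<otimes> W \<rightarrow> U \<otimes> V \<otimes> W\<close>, and for
  linear \<open>D : X \<rightarrow> V \<otimes> W\<close>, \<open>expand_right U V W D\<close> is \<open>id \<otimes> D : U \<otimes> X \<rightarrow> U \<otimes> V \<otimes> W\<close>. The threefold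
  tensor product is modelled inside the dual of the space of trilinear forms.\<close>

definition expand_left ::
  "('k::field, 'a::ab_group_add, 'x) vspc_scheme \<Rightarrow> ('k, 'b::ab_group_add, 'y) vspc_scheme
    \<Rightarrow> ('k, 'c::ab_group_add, 'z) vspc_scheme \<Rightarrow> ('d \<Rightarrow> ('k, 'a, 'b) tensor)
    \<Rightarrow> ('k, 'd, 'c) tensor \<Rightarrow> ('k, 'a, 'b, 'c) tensor3" where
  "expand_left U V W D t =
    (\<lambda>\<tau>. if trilinear_form U V W \<tau> then t (\<lambda>x w. D x (\<lambda>u v. \<tau> u v w)) else 0)"

definition expand_right ::
  "('k::field, 'a::ab_group_add, 'x) vspc_scheme \<Rightarrow> ('k, 'b::ab_group_add, 'y) vspc_scheme
    \<Rightarrow> ('k, 'c::ab_group_add, 'z) vspc_scheme \<Rightarrow> ('d \<Rightarrow> ('k, 'b, 'c) tensor)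
    \<Rightarrow> ('k, 'a, 'd) tensor \<Rightarrow> ('k, 'a, 'b, 'c) tensor3" where
  "expand_right U V W D t =
    (\<lambda>\<tau>. if trilinear_form U V W \<tau> then t (\<lambda>u x. D x (\<lambda>v w. \<tau> u v w)) else 0)"

section \<open>Coalgebras\<close>

record ('k, 'c) coalg = "('k, 'c) vspc" +
  comult :: "'c \<Rightarrow> ('k, 'c, 'c) tensor"
  counit :: "'c \<Rightarrow> 'k"

definition coalgebra :: "('k::field, 'c::ab_group_add) coalg \<Rightarrow> bool" where
  "coalgebra C \<longleftrightarrow>
    vspace C \<and>
    linear_map C (tensor C C) (comult C) \<and>
    linear_map C ground (counit C) \<and>
    (\<forall>c\<in>carrier C.
      expand_left C C C (comult C) (comult C c) = expand_right C C C (comult C) (comult C c)) \<and>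
    (\<forall>c\<in>carrier C. \<exists>xs. set xs \<subseteq> carrier C \<times> carrier C \<and> comult C c = tensor_sum C C xs \<and>
      (\<Sum>(x, y)\<leftarrow>xs. scale C (counit C x) y) = c \<and>
      (\<Sum>(x, y)\<leftarrow>xs. scale C (counit C y) x) = c)"

definition coalgebra_hom ::
  "('k::field, 'c::ab_group_add) coalg \<Rightarrow> ('k, 'd::ab_group_add) coalg \<Rightarrow> ('c \<Rightarrow> 'd) \<Rightarrow> bool" where
  "coalgebra_hom C D f \<longleftrightarrow>
    linear_map C D f \<and>
    (\<forall>c\<in>carrier C. comult D (f c) = tensor_map D D f f (comult C c)) \<and>
    (\<forall>c\<in>carrier C. counit D (f c) = counit C c)"

definition coalgebra_iso ::
  "('k::field, 'c::ab_group_add) coalg \<Rightarrow> ('k, 'd::ab_group_add) coalg \<Rightarrow> ('c \<Rightarrow> 'd) \<Rightarrow> bool" where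
  "coalgebra_iso C D f \<longleftrightarrow>
    coalgebra_hom C D f \<and> bij_betw f (carrier C) (carrier D) \<and>
    coalgebra_hom D C (inv_into (carrier C) f)"

section \<open>Comodules and semiperfect coalgebras\<close>

text \<open>The type \<open>'t\<close> is that of elements of \<open>C \<otimes> M\<close> for left comodules and of \<open>M \<otimes> C\<close> for
  right ones.\<close>

record ('k, 'm, 't) comod = "('k, 'm) vspc" +
  coact :: "'m \<Rightarrow> 't"

definition left_comodule ::
  "('k::field, 'c::ab_group_add) coalg \<Rightarrow> ('k, 'm::ab_group_add, ('k, 'c, 'm) tensor) comod
    \<Rightarrow> bool" where
  "left_comodule C M \<longleftrightarrow>
    vspace M \<and>
    linear_map M (tensor C M) (coact M) \<and>
    (\<forall>m\<in>carrier M.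
      expand_left C C M (comult C) (coact M m) = expand_right C C M (coact M) (coact M m)) \<and>
    (\<forall>m\<in>carrier M. \<exists>xs. set xs \<subseteq> carrier C \<times> carrier M \<and> coact M m = tensor_sum C M xs \<and>
      (\<Sum>(c, n)\<leftarrow>xs. scale M (counit C c) n) = m)"

definition right_comodule ::
  "('k::field, 'c::ab_group_add) coalg \<Rightarrow> ('k, 'm::ab_group_add, ('k, 'm, 'c) tensor) comod
    \<Rightarrow> bool" where
  "right_comodule C M \<longleftrightarrow>
    vspace M \<and>
    linear_map M (tensor M C) (coact M) \<and>
    (\<forall>m\<in>carrier M.
      expand_left M C C (coact M) (coact M m) = expand_right M C C (comult C) (coact M m)) \<and>
    (\<forall>m\<in>carrier M. \<exists>xs. set xs \<subseteq> carrier M \<times> carrier C \<and> coact M m = tensor_sum M C xs \<and>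
      (\<Sum>(n, c)\<leftarrow>xs. scale M (counit C c) n) = m)"

definition left_comodule_hom ::
  "('k::field, 'c::ab_group_add) coalg \<Rightarrow> ('k, 'm::ab_group_add, ('k, 'c, 'm) tensor) comod
    \<Rightarrow> ('k, 'm, ('k, 'c, 'm) tensor) comod \<Rightarrow> ('m \<Rightarrow> 'm) \<Rightarrow> bool" where
  "left_comodule_hom C M N f \<longleftrightarrow>
    linear_map M N f \<and> (\<forall>m\<in>carrier M. coact N (f m) = tensor_map C N id f (coact M m))"

definition right_comodule_hom ::
  "('k::field, 'c::ab_group_add) coalg \<Rightarrow> ('k, 'm::ab_group_add, ('k, 'm, 'c) tensor) comod
    \<Rightarrow> ('k, 'm, ('k, 'm, 'c) tensor) comod \<Rightarrow> ('m \<Rightarrow> 'm) \<Rightarrow> bool" where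
  "right_comodule_hom C M N f \<longleftrightarrow>
    linear_map M N f \<and> (\<forall>m\<in>carrier M. coact N (f m) = tensor_map N C f id (coact M m))"

definition left_subcomodule ::
  "('k::field, 'c::ab_group_add) coalg \<Rightarrow> ('k, 'm::ab_group_add, ('k, 'c, 'm) tensor) comod
    \<Rightarrow> 'm set \<Rightarrow> bool" where
  "left_subcomodule C M N \<longleftrightarrow>
    N \<subseteq> carrier M \<and> module.subspace (scale M) N \<and>
    (\<forall>n\<in>N. \<exists>xs. set xs \<subseteq> carrier C \<times> N \<and> coact M n = tensor_sum C M xs)"

definition right_subcomodule ::
  "('k::field, 'c::ab_group_add) coalg \<Rightarrow> ('k, 'm::ab_group_add, ('k, 'm, 'c) tensor) comod
    \<Rightarrow> 'm set \<Rightarrow> bool" where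
  "right_subcomodule C M N \<longleftrightarrow>
    N \<subseteq> carrier M \<and> module.subspace (scale M) N \<and>
    (\<forall>n\<in>N. \<exists>xs. set xs \<subseteq> N \<times> carrier C \<and> coact M n = tensor_sum M C xs)"

text \<open>The next three notions are used for left and for right comodules: \<open>cmd\<close>, \<open>hom\<close> and
  \<open>sub\<close> stand for the predicates defining comodules, morphisms and subcomodules.\<close>

definition simple_object ::
  "(('k, 'm::ab_group_add, 't) comod \<Rightarrow> 'm set \<Rightarrow> bool) \<Rightarrow> ('k, 'm, 't) comod \<Rightarrow> bool" where
  "simple_object sub S \<longleftrightarrow>
    carrier S \<noteq> {0} \<and> (\<forall>N. sub S N \<longrightarrow> N = {0} \<or> N = carrier S)"

definition injective_object ::
  "(('k, 'm, 't) comod \<Rightarrow> bool)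
    \<Rightarrow> (('k, 'm, 't) comod \<Rightarrow> ('k, 'm, 't) comod \<Rightarrow> ('m \<Rightarrow> 'm) \<Rightarrow> bool)
    \<Rightarrow> ('k, 'm, 't) comod \<Rightarrow> bool" where
  "injective_object cmd hom E \<longleftrightarrow>
    cmd E \<and>
    (\<forall>X Y i f. cmd X \<and> cmd Y \<and> hom X Y i \<and> inj_on i (carrier X) \<and> hom X E f \<longrightarrow>
      (\<exists>g. hom Y E g \<and> (\<forall>x\<in>carrier X. g (i x) = f x)))"

text \<open>\<open>i : S \<rightarrow> E\<close> is an essential monomorphism into an injective object.\<close>

definition injective_hull ::
  "(('k, 'm::ab_group_add, 't) comod \<Rightarrow> bool)
    \<Rightarrow> (('k, 'm, 't) comod \<Rightarrow> ('k, 'm, 't) comod \<Rightarrow> ('m \<Rightarrow> 'm) \<Rightarrow> bool)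
    \<Rightarrow> (('k, 'm, 't) comod \<Rightarrow> 'm set \<Rightarrow> bool)
    \<Rightarrow> ('k, 'm, 't) comod \<Rightarrow> ('k, 'm, 't) comod \<Rightarrow> ('m \<Rightarrow> 'm) \<Rightarrow> bool" where
  "injective_hull cmd hom sub S E i \<longleftrightarrow>
    injective_object cmd hom E \<and> hom S E i \<and> inj_on i (carrier S) \<and>
    (\<forall>N. sub E N \<and> N \<noteq> {0} \<longrightarrow> N \<inter> i ` carrier S \<noteq> {0})"

text \<open>HOL cannot quantify over all types, so comodules range over those with underlying
  group in a universe \<open>'m\<close>. The universe is adequate when it contains a copy of the vector
  space \<open>C\<close>: simple comodules and their injective hulls embed into \<open>C\<close>, and a comodule
  embedded in \<open>C\<close> is injective as soon as it is a direct summand of \<open>C\<close>. Hence over an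
  adequate universe the two predicates below do not depend on \<open>'m\<close>. Injective hulls
  being unique up to isomorphism, "the" injective hull is expressed by existence.\<close>

definition adequate_universe ::
  "'m::ab_group_add itself \<Rightarrow> ('k::field, 'c::ab_group_add) coalg \<Rightarrow> bool" where
  "adequate_universe U C \<longleftrightarrow>
    (\<exists>(V :: ('k, 'm) vspc) j. vspace V \<and> linear_map C V j \<and> inj_on j (carrier C))"

definition right_semiperfect ::
  "'m::ab_group_add itself \<Rightarrow> ('k::field, 'c::ab_group_add) coalg \<Rightarrow> bool" where
  "right_semiperfect U C \<longleftrightarrow>
    (\<forall>S :: ('k, 'm, ('k, 'c, 'm) tensor) comod.
      left_comodule C S \<and> simple_object (left_subcomodule C) S \<longrightarrow>
      (\<exists>E i. injective_hull (left_comodule C) (left_comodule_hom C) (left_subcomodule C) S E i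
        \<and> finite_dim E))"

definition left_semiperfect ::
  "'m::ab_group_add itself \<Rightarrow> ('k::field, 'c::ab_group_add) coalg \<Rightarrow> bool" where
  "left_semiperfect U C \<longleftrightarrow>
    (\<forall>S :: ('k, 'm, ('k, 'm, 'c) tensor) comod.
      right_comodule C S \<and> simple_object (right_subcomodule C) S \<longrightarrow>
      (\<exists>E i. injective_hull (right_comodule C) (right_comodule_hom C) (right_subcomodule C) S E i
        \<and> finite_dim E))"

section \<open>The dual algebra, its rational part, and finite duals\<close>

record ('k, 'a) alg = "('k, 'a) vspc" +
  mult :: "'a \<Rightarrow> 'a \<Rightarrow> 'a"

text \<open>Functionals on \<open>V\<close> are normalised to vanish outside the carrier, so that equality of
  functionals is equality of functions.\<close>

definition dual :: "('k::field, 'a::ab_group_add, 'z) vspc_scheme \<Rightarrow> ('k, 'a \<Rightarrow> 'k) vspc" where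
  "dual V =
    \<lparr>carrier = {f. linear_map V ground f \<and> (\<forall>x. x \<notin> carrier V \<longrightarrow> f x = 0)}, scale = fscale\<rparr>"

definition convolution ::
  "('k::field, 'c::ab_group_add) coalg \<Rightarrow> ('c \<Rightarrow> 'k) \<Rightarrow> ('c \<Rightarrow> 'k) \<Rightarrow> 'c \<Rightarrow> 'k" where
  "convolution C f g = (\<lambda>c. if c \<in> carrier C then comult C c (\<lambda>x y. f x * g y) else 0)"

definition dual_algebra :: "('k::field, 'c::ab_group_add) coalg \<Rightarrow> ('k, 'c \<Rightarrow> 'k) alg" where
  "dual_algebra C =
    \<lparr>carrier = carrier (dual C), scale = scale (dual C), mult = convolution C\<rparr>"

text \<open>Rational part of a left \<open>C\<^sup>*\<close>-module \<open>M\<close> with action \<open>act\<close>.\<close>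

definition rational_part ::
  "('k::field, 'c::ab_group_add) coalg \<Rightarrow> ('k, 'm::ab_group_add, 'z) vspc_scheme
    \<Rightarrow> (('c \<Rightarrow> 'k) \<Rightarrow> 'm \<Rightarrow> 'm) \<Rightarrow> 'm set" where
  "rational_part C M act =
    {m \<in> carrier M. \<exists>xs. set xs \<subseteq> carrier C \<times> carrier M \<and>
      (\<forall>f\<in>carrier (dual_algebra C). act f m = (\<Sum>(c, n)\<leftarrow>xs. scale M (f c) n))}"

definition rat_dual :: "('k::field, 'c::ab_group_add) coalg \<Rightarrow> ('k, 'c \<Rightarrow> 'k) alg" where
  "rat_dual C = (dual_algebra C)
    \<lparr>carrier := rational_part C (dual_algebra C) (mult (dual_algebra C))\<rparr>"

definition two_sided_ideal :: "('k::field, 'a::ab_group_add) alg \<Rightarrow> 'a set \<Rightarrow> bool" where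
  "two_sided_ideal A I \<longleftrightarrow>
    I \<subseteq> carrier A \<and> module.subspace (scale A) I \<and>
    (\<forall>a\<in>carrier A. \<forall>x\<in>I. mult A a x \<in> I \<and> mult A x a \<in> I)"

definition finite_dual :: "('k::field, 'a::ab_group_add) alg \<Rightarrow> ('k, 'a \<Rightarrow> 'k) vspc" where
  "finite_dual A =
    \<lparr>carrier = {f \<in> carrier (dual A).
        \<exists>I. two_sided_ideal A I \<and> finite_codim A I \<and> (\<forall>x\<in>I. f x = 0)},
     scale = fscale\<rparr>"

definition finite_dual_comult ::
  "('k::field, 'a::ab_group_add) alg \<Rightarrow> ('a \<Rightarrow> 'k) \<Rightarrow> ('k, 'a \<Rightarrow> 'k, 'a \<Rightarrow> 'k) tensor" where
  "finite_dual_comult A f =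
    (THE t. \<exists>xs. set xs \<subseteq> carrier (finite_dual A) \<times> carrier (finite_dual A) \<and>
      t = tensor_sum (finite_dual A) (finite_dual A) xs \<and>
      (\<forall>a\<in>carrier A. \<forall>b\<in>carrier A. f (mult A a b) = (\<Sum>(g, h)\<leftarrow>xs. g a * h b)))"

text \<open>For an algebra without unit the finite dual has no canonical counit, so a candidate
  is passed as \<open>e\<close>; a coalgebra has at most one counit.\<close>

definition finite_dual_coalg ::
  "('k::field, 'a::ab_group_add) alg \<Rightarrow> (('a \<Rightarrow> 'k) \<Rightarrow> 'k) \<Rightarrow> ('k, 'a \<Rightarrow> 'k) coalg" where
  "finite_dual_coalg A e =
    \<lparr>carrier = carrier (finite_dual A), scale = scale (finite_dual A),
     comult = finite_dual_comult A, counit = e\<rparr>"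

definition phi_l ::
  "('k::field, 'c::ab_group_add) coalg \<Rightarrow> 'c \<Rightarrow> ('c \<Rightarrow> 'k) \<Rightarrow> 'k" where
  "phi_l C c = (\<lambda>f. if f \<in> carrier (rat_dual C) then f c else 0)"

definition left_coreflexive :: "('k::field, 'c::ab_group_add) coalg \<Rightarrow> bool" where
  "left_coreflexive C \<longleftrightarrow>
    bij_betw (phi_l C) (carrier C) (carrier (finite_dual (rat_dual C)))"

section \<open>The universal property of the tensor product\<close>

lemma sum_list_fun_apply: "(\<Sum>x\<leftarrow>xs. f x) b = (\<Sum>x\<leftarrow>xs. f x b)"
  for f :: "'a \<Rightarrow> 'b \<Rightarrow> 'c::ab_group_add"
  by (induction xs) auto

lemma tensor_sum_apply:
  assumes "bilinear_map V W ground \<beta>"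
  shows "tensor_sum V W xs \<beta> = (\<Sum>(x, y)\<leftarrow>xs. \<beta> x y)"
  using assms by (induction xs) (auto simp: tensor_sum_def pure_tensor_def)

lemma separating_functional:
  assumes "vector_space s" and "w \<noteq> 0"
  obtains p :: "'a::ab_group_add \<Rightarrow> 'k::field"
  where "Vector_Spaces.linear s (*) p" and "p w \<noteq> 0"
proof -
  interpret vector_space s by fact
  interpret K: vector_space "(*) :: 'k \<Rightarrow> 'k \<Rightarrow> 'k"
    by unfold_locales (auto simp: algebra_simps)
  interpret P: vector_space_pair s "(*) :: 'k \<Rightarrow> 'k \<Rightarrow> 'k" ..
  have "independent {w}" using assms(2) by simp
  then obtain p where "Vector_Spaces.linear s (*) p" "p w = (1::'k)"
    using P.linear_independent_extend[of "{w}" "\<lambda>_. 1"] by auto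
  then show thesis using that by force
qed

lemma tensor_universal:
  assumes X: "vspace X" and b: "bilinear_map V W X b"
    and xs: "set xs \<subseteq> carrier V \<times> carrier W" and ys: "set ys \<subseteq> carrier V \<times> carrier W"
    and eq: "tensor_sum V W xs = tensor_sum V W ys"
  shows "(\<Sum>(x, y)\<leftarrow>xs. b x y) = (\<Sum>(x, y)\<leftarrow>ys. b x y)"
proof (rule ccontr)
  assume ne: "\<not> ?thesis"
  define w where "w = (\<Sum>(x, y)\<leftarrow>xs. b x y) - (\<Sum>(x, y)\<leftarrow>ys. b x y)"
  have "vector_space (scale X)" "w \<noteq> 0" using X ne by (auto simp: vspace_def w_def)
  then obtain p where p: "Vector_Spaces.linear (scale X) (*) p" "p w \<noteq> 0"
    using separating_functional by blast
  interpret p: Vector_Spaces.linear "scale X" "(*)" p by (rule p(1))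
  have sums: "p (\<Sum>(x, y)\<leftarrow>zs. b x y) = (\<Sum>(x, y)\<leftarrow>zs. p (b x y))" for zs
    by (induction zs) (auto simp: p.add p.zero)
  have "bilinear_map V W ground (\<lambda>x y. p (b x y))"
    using b by (auto simp: bilinear_map_def linear_map_def ground_def p.add p.scale)
  then have "p (\<Sum>(x, y)\<leftarrow>xs. b x y) = p (\<Sum>(x, y)\<leftarrow>ys. b x y)"
    using eq by (metis sums tensor_sum_apply)
  then show False using p(2) by (simp add: w_def p.diff)
qed

end

theory Submission imports Defs begin

text \<open>
  Write \<open>R\<close> for the rational part of the left module \<open>C\<^sup>*\<close>, \<open>c \<leftharpoonup> g\<close> for the sum of the
  \<open>g(c\<^sub>1) c\<^sub>2\<close> (the function \<open>hit g c\<close>), and call a subspace of \<open>C\<close> stable under all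
  \<open>\<leftharpoonup> g\<close> a left coideal. The proof avoids decomposing \<open>C\<close> into injective hulls; semiperfectness
  is used only to show that \<open>R\<close>, and symmetrically the rational part \<open>R'\<close> of the right module
  \<open>C\<^sup>*\<close>, separates the points of \<open>C\<close>.

  For this, let \<open>c \<noteq> 0\<close>. The orbit of all \<open>c \<leftharpoonup> g\<close> is a finite-dimensional left coideal
  containing \<open>c\<close>, so it contains a simple one, \<open>N\<close> (lemma \<open>exists_simple_coideal\<close>). The embedding
  of \<open>N\<close> into its injective hull \<open>E\<close> extends to a comodule map \<open>h\<close> from \<open>C\<close> to \<open>E\<close>. Since \<open>E\<close>
  is finite dimensional, \<open>p \<circ> h\<close> is in \<open>R\<close> for every functional \<open>p\<close> on \<open>E\<close>
  (lemma \<open>functional_through_finite_dim_rational\<close>), and some \<open>p \<circ> h\<close> is nonzero at some \<open>c \<leftharpoonup> g\<close>,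
  which means that the element \<open>g * (p \<circ> h)\<close> of \<open>R\<close> is nonzero at \<open>c\<close> (lemma \<open>rat_separates\<close>).
  The statement for \<open>R'\<close> is the same statement for the co-opposite coalgebra.

  A separating space of functionals takes arbitrary prescribed values on a finite independent set.
  So \<open>R\<close> and \<open>R'\<close> contain functionals that agree with the counit on any given finite set, and a
  convolution product of two such functionals does this inside \<open>R \<inter> R'\<close>
  (lemma \<open>local_counit\<close>). By the definition of rationality it is then a left unit for any given
  finite subset of \<open>R\<close> (lemma \<open>local_left_unit\<close>).

  Injectivity of \<open>\<phi>\<close> is the separation of points. For surjectivity let \<open>F\<close> vanish on an ideal \<open>I\<close>
  of finite codimension in \<open>R\<close>. Take \<open>e\<close> in \<open>R \<inter> R'\<close> that is a left unit for finitely many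
  elements spanning \<open>R\<close> modulo \<open>I\<close>; then \<open>F(e * r) = F(r)\<close> for all \<open>r\<close> in \<open>R\<close>. Rationality of \<open>e\<close>
  on the right gives finitely many \<open>d\<^sub>k\<close> and \<open>h\<^sub>k\<close> such that \<open>e * r\<close> is the sum of the
  \<open>r(d\<^sub>k) h\<^sub>k\<close>, and hence \<open>F(r) = F(e * (e * r))\<close> is the sum of the \<open>r(d\<^sub>k) F(e * h\<^sub>k)\<close>, which is
  the value of \<open>r\<close> at the element \<open>\<Sum> F(e * h\<^sub>k) d\<^sub>k\<close> of \<open>C\<close> (lemma \<open>phi_l_onto\<close>).

  Finally \<open>\<phi>\<close> matches the comultiplications (lemma \<open>finite_dual_comult_phi_l\<close>), so the whole
  structure of \<open>C\<close>, counit included, is transported along this linear bijection.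
\<close>

section \<open>Subspaces and linear functionals\<close>

lemma vspace_vector_space: "vspace V \<Longrightarrow> vector_space (scale V)"
  by (simp add: vspace_def)

lemma vspace_subspace: "vspace V \<Longrightarrow> module.subspace (scale V) (carrier V)"
  by (simp add: vspace_def)

lemma vspace_module: "vspace V \<Longrightarrow> module (scale V)"
  by (simp add: vspace_def module_iff_vector_space)

lemma vspace_zero: "vspace V \<Longrightarrow> 0 \<in> carrier V"
  by (blast intro: vspace_module vspace_subspace module.subspace_0)

lemma vspace_add: "vspace V \<Longrightarrow> x \<in> carrier V \<Longrightarrow> y \<in> carrier V \<Longrightarrow> x + y \<in> carrier V"
  by (blast intro: vspace_module vspace_subspace module.subspace_add)

lemma vspace_diff: "vspace V \<Longrightarrow> x \<in> carrier V \<Longrightarrow> y \<in> carrier V \<Longrightarrow> x - y \<in> carrier V"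
  by (blast intro: vspace_module vspace_subspace module.subspace_diff)

lemma vspace_neg: "vspace V \<Longrightarrow> x \<in> carrier V \<Longrightarrow> - x \<in> carrier V"
  by (blast intro: vspace_module vspace_subspace module.subspace_neg)

lemma vspace_scale: "vspace V \<Longrightarrow> x \<in> carrier V \<Longrightarrow> scale V a x \<in> carrier V"
  by (blast intro: vspace_module vspace_subspace module.subspace_scale)

lemma vspace_sum_list:
  "vspace V \<Longrightarrow> (\<And>x y. (x, y) \<in> set xs \<Longrightarrow> f x y \<in> carrier V) \<Longrightarrow>
    (\<Sum>(x, y)\<leftarrow>xs. f x y) \<in> carrier V"
  by (induction xs) (auto intro: vspace_zero vspace_add)

lemmas vspace_closed = vspace_zero vspace_add vspace_diff vspace_neg vspace_scale

lemma linear_map_mem: "linear_map V W f \<Longrightarrow> x \<in> carrier V \<Longrightarrow> f x \<in> carrier W"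
  by (simp add: linear_map_def)

lemma linear_map_add:
  "linear_map V W f \<Longrightarrow> x \<in> carrier V \<Longrightarrow> y \<in> carrier V \<Longrightarrow> f (x + y) = f x + f y"
  by (simp add: linear_map_def)

lemma linear_map_scale:
  "linear_map V W f \<Longrightarrow> x \<in> carrier V \<Longrightarrow> f (scale V a x) = scale W a (f x)"
  by (simp add: linear_map_def)

lemma linear_map_zero: "linear_map V W f \<Longrightarrow> vspace V \<Longrightarrow> f 0 = 0"
  using linear_map_add[of V W f 0 0] vspace_zero[of V] by simp

lemma linear_map_diff:
  assumes "linear_map V W f" "vspace V" "x \<in> carrier V" "y \<in> carrier V"
  shows "f (x - y) = f x - f y"
  using linear_map_add[OF assms(1) vspace_diff[OF assms(2-4)] assms(4)] by simp

lemma linear_map_sum_list: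
  assumes "linear_map V W f" "vspace V" "\<And>x y. (x, y) \<in> set xs \<Longrightarrow> g x y \<in> carrier V"
  shows "f (\<Sum>(x, y)\<leftarrow>xs. g x y) = (\<Sum>(x, y)\<leftarrow>xs. f (g x y))"
  using assms(3)
proof (induction xs)
  case Nil
  then show ?case using linear_map_zero[OF assms(1,2)] by simp
next
  case (Cons z xs)
  obtain x y where z: "z = (x, y)" by force
  have "(\<Sum>(x, y)\<leftarrow>xs. g x y) \<in> carrier V"
    using Cons.prems by (intro vspace_sum_list[OF assms(2)]) auto
  moreover have "g x y \<in> carrier V" using Cons.prems z by simp
  ultimately show ?case
    using Cons z linear_map_add[OF assms(1)] by simp
qed

lemma linear_map_comp:
  "linear_map U V f \<Longrightarrow> linear_map V W g \<Longrightarrow> linear_map U W (\<lambda>x. g (f x))"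
  by (simp add: linear_map_def)

lemma scale_ground [simp]: "scale ground = (*)" and carrier_ground [simp]: "carrier ground = UNIV"
  by (simp_all add: ground_def)

lemma linear_map_vanish_span:
  assumes f: "linear_map V W f" and V: "vspace V" and W: "vspace W"
    and X: "X \<subseteq> carrier V" "\<And>x. x \<in> X \<Longrightarrow> f x = 0"
    and x: "x \<in> module.span (scale V) X"
  shows "f x = 0"
proof -
  interpret V: module "scale V" using V by (rule vspace_module)
  interpret W: module "scale W" using W by (rule vspace_module)
  have "x \<in> carrier V \<and> f x = 0"
    using x
  proof (induction rule: V.span_induct_alt)
    case base
    then show ?case using linear_map_zero[OF f V] vspace_zero[OF V] by simp
  next
    case (step c x y)
    then have "x \<in> carrier V" "f (scale V c x) = 0"
      using X linear_map_scale[OF f] by (auto simp: subset_iff)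
    then show ?case
      using step.IH linear_map_add[OF f] by (simp add: vspace_closed[OF V])
  qed
  then show ?thesis ..
qed

lemma vspace_ground: "vspace (ground :: ('k::field, 'k) vspc)"
proof -
  interpret K: vector_space "(*) :: 'k \<Rightarrow> 'k \<Rightarrow> 'k::field"
    by unfold_locales (auto simp: algebra_simps)
  show "vspace (ground :: ('k, 'k) vspc)"
    using K.vector_space_axioms K.subspace_UNIV by (simp add: vspace_def)
qed

global_interpretation fscale: vector_space fscale
  by unfold_locales (auto simp: fscale_def algebra_simps)

lemma fscale_apply: "fscale a f x = a * f x"
  by (simp add: fscale_def)

text \<open>The finite-dimensional duality that makes a separating space of functionals dense. In the
  induction step, subtracting \<open>p y\<close> times a functional \<open>q\<close> with \<open>q y = 1\<close> makes \<open>p\<close> vanish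
  at \<open>y\<close> and turns its value at \<open>x\<close> into its value at \<open>x - q x \<cdot> y\<close>, which lies outside the smaller span.\<close>

lemma separating_avoids_span:
  assumes V: "vspace V" and P: "fscale.subspace P" and lin: "\<And>p. p \<in> P \<Longrightarrow> linear_map V ground p"
    and sep: "\<And>x. x \<in> carrier V \<Longrightarrow> x \<noteq> 0 \<Longrightarrow> \<exists>p\<in>P. p x \<noteq> 0"
    and X: "finite X" "X \<subseteq> carrier V"
    and x: "x \<in> carrier V" "x \<notin> module.span (scale V) X"
  shows "\<exists>q\<in>P. (\<forall>y\<in>X. q y = 0) \<and> q x \<noteq> 0"
  using X x
proof (induction X arbitrary: x)
  case empty
  interpret V: vector_space "scale V" using V by (rule vspace_vector_space)
  show ?case using empty sep V.span_empty by auto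
next
  case (insert y X)
  interpret V: vector_space "scale V" using V by (rule vspace_vector_space)
  show ?case
  proof (cases "y \<in> V.span X")
    case True
    then have "x \<notin> V.span X" using insert.prems V.span_redundant by blast
    then obtain q where q: "q \<in> P" "\<forall>z\<in>X. q z = 0" "q x \<noteq> 0"
      using insert.IH[of x] insert.prems by auto
    then have "q y = 0"
      using linear_map_vanish_span[OF lin V vspace_ground _ _ True] insert.prems by auto
    then show ?thesis using q by auto
  next
    case False
    then obtain q0 where q0: "q0 \<in> P" "\<forall>z\<in>X. q0 z = 0" "q0 y \<noteq> 0"
      using insert.IH[of y] insert.prems by auto
    define q where "q = fscale (1 / q0 y) q0"
    have q: "q \<in> P" "\<forall>z\<in>X. q z = 0" "q y = 1"
      using q0 P by (auto simp: q_def fscale_apply intro: fscale.subspace_scale)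
    let ?x = "x - scale V (q x) y"
    have y: "y \<in> carrier V" and xc: "x \<in> carrier V" using insert.prems by auto
    have x': "?x \<in> carrier V" using insert.prems by (auto intro!: vspace_closed[OF V])
    have "?x \<notin> V.span X"
      using insert.prems V.span_breakdown_eq by blast
    then obtain p where p: "p \<in> P" "\<forall>z\<in>X. p z = 0" "p ?x \<noteq> 0"
      using insert.IH[of ?x] insert.prems x' by auto
    let ?r = "p - fscale (p y) q"
    have "?r \<in> P" using p q P by (auto intro: fscale.subspace_diff fscale.subspace_scale)
    moreover have "\<forall>z\<in>insert y X. ?r z = 0" using p q by (auto simp: fscale_apply)
    moreover have "p ?x = p x - q x * p y"
      using linear_map_diff[OF lin[OF p(1)] V xc vspace_scale[OF V y]]
        linear_map_scale[OF lin[OF p(1)] y] by simp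
    then have "?r x \<noteq> 0" using p(3) by (simp add: fscale_apply mult.commute)
    ultimately show ?thesis by blast
  qed
qed

text \<open>A space of functionals that separates points is dense in the dual for the finite topology.\<close>

lemma separating_interpolates:
  assumes V: "vspace V" and P: "fscale.subspace P" and lin: "\<And>p. p \<in> P \<Longrightarrow> linear_map V ground p"
    and sep: "\<And>x. x \<in> carrier V \<Longrightarrow> x \<noteq> 0 \<Longrightarrow> \<exists>p\<in>P. p x \<noteq> 0"
    and g: "linear_map V ground g"
    and X: "finite X" "X \<subseteq> carrier V"
  shows "\<exists>p\<in>P. \<forall>x\<in>X. p x = g x"
  using X
proof (induction X)
  case empty
  show ?case using fscale.subspace_0[OF P] by blast
next
  case (insert x X)
  then obtain p where p: "p \<in> P" "\<forall>y\<in>X. p y = g y" by auto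
  show ?case
  proof (cases "x \<in> module.span (scale V) X")
    case True
    have "linear_map V ground (p - g)"
      using lin[OF p(1)] g by (auto simp: linear_map_def algebra_simps)
    then have "(p - g) x = 0"
      by (rule linear_map_vanish_span[OF _ V vspace_ground _ _ True]) (use p insert.prems in auto)
    then show ?thesis using p by auto
  next
    case False
    then obtain q where q: "q \<in> P" "\<forall>y\<in>X. q y = 0" "q x \<noteq> 0"
      using separating_avoids_span[OF V P lin sep, of X x] insert.hyps insert.prems False by auto
    have "p + fscale ((g x - p x) / q x) q \<in> P"
      using p q P by (auto intro: fscale.subspace_add fscale.subspace_scale)
    moreover have "\<forall>y\<in>insert x X. (p + fscale ((g x - p x) / q x) q) y = g y"
      using p q by (auto simp: fscale_apply)
    ultimately show ?thesis by blast
  qed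
qed

text \<open>Each evaluation at a point cuts the dimension down by at most one, so the functionals in \<open>P\<close>
  that vanish on a finite set have a finite-dimensional complement.\<close>

lemma finite_conditions_finite_codim:
  assumes P: "fscale.subspace P" and Y: "finite Y"
  shows "\<exists>B. finite B \<and> B \<subseteq> P \<and> (\<forall>f\<in>P. \<exists>b\<in>fscale.span B. \<forall>y\<in>Y. f y = b y)"
  using Y
proof induction
  case empty
  have "\<forall>f\<in>P. \<exists>b\<in>fscale.span {}. \<forall>y\<in>{}. f y = b y"
    using fscale.span_zero by blast
  then show ?case by blast
next
  case (insert y Y)
  then obtain B where B: "finite B" "B \<subseteq> P" "\<forall>f\<in>P. \<exists>b\<in>fscale.span B. \<forall>y\<in>Y. f y = b y"
    by blast
  have span: "fscale.span B \<subseteq> P" using B P by (simp add: fscale.span_minimal)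
  show ?case
  proof (cases "\<forall>q\<in>P. (\<forall>z\<in>Y. q z = 0) \<longrightarrow> q y = 0")
    case True
    have "\<exists>b\<in>fscale.span B. \<forall>y\<in>insert y Y. f y = b y" if f: "f \<in> P" for f
    proof -
      obtain b where b: "b \<in> fscale.span B" "\<forall>y\<in>Y. f y = b y" using B f by blast
      then have "f - b \<in> P" using span f P by (auto intro: fscale.subspace_diff)
      then have "(f - b) y = 0" using True b by auto
      then show ?thesis using b by auto
    qed
    then show ?thesis using B by blast
  next
    case False
    then obtain q where q: "q \<in> P" "\<forall>z\<in>Y. q z = 0" "q y \<noteq> 0" by blast
    have "\<exists>b\<in>fscale.span (insert q B). \<forall>y\<in>insert y Y. f y = b y" if f: "f \<in> P" for f
    proof -
      obtain b where b: "b \<in> fscale.span B" "\<forall>y\<in>Y. f y = b y" using B f by blast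
      let ?b = "b + fscale ((f y - b y) / q y) q"
      have "?b \<in> fscale.span (insert q B)"
        using b(1) fscale.span_mono[of B "insert q B"]
        by (intro fscale.span_add fscale.span_scale) (auto intro: fscale.span_base)
      moreover have "\<forall>y\<in>insert y Y. f y = ?b y" using b q by (auto simp: fscale_apply)
      ultimately show ?thesis by blast
    qed
    moreover have "finite (insert q B)" "insert q B \<subseteq> P" using B q by auto
    ultimately show ?thesis by blast
  qed
qed

lemma subspace_projection:
  assumes "vector_space s" "module.subspace s N"
  obtains \<pi> where "Vector_Spaces.linear s s \<pi>" "\<And>x. \<pi> x \<in> N" "\<And>x. x \<in> N \<Longrightarrow> \<pi> x = x"
proof -
  interpret vector_space s by fact
  interpret P: vector_space_pair s s ..
  show thesis
    using P.linear_exists_left_inverse_on[OF linear_id assms(2)] that by (auto simp: image_subset_iff)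
qed

section \<open>Bilinear forms and tensors\<close>

lemma bilinear_map_leftD: "bilinear_map V W X b \<Longrightarrow> y \<in> carrier W \<Longrightarrow> linear_map V X (\<lambda>x. b x y)"
  by (simp add: bilinear_map_def)

lemma bilinear_map_rightD: "bilinear_map V W X b \<Longrightarrow> x \<in> carrier V \<Longrightarrow> linear_map W X (b x)"
  by (simp add: bilinear_map_def)

lemma bilinear_map_cong:
  assumes "\<And>x y. x \<in> carrier V \<Longrightarrow> y \<in> carrier W \<Longrightarrow> \<beta> x y = \<gamma> x y" "vspace V" "vspace W"
  shows "bilinear_map V W X \<beta> \<longleftrightarrow> bilinear_map V W X \<gamma>"
  using assms(1) vspace_add[OF assms(2)] vspace_add[OF assms(3)] vspace_scale[OF assms(2)]
    vspace_scale[OF assms(3)]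
  by (simp add: bilinear_map_def linear_map_def)

lemma linear_map_ident: "linear_map V V (\<lambda>x. x)"
  by (simp add: linear_map_def)

lemma bilinear_map_pullback:
  assumes \<beta>: "bilinear_map V' W' X \<beta>" and f: "linear_map V V' f" and g: "linear_map W W' g"
  shows "bilinear_map V W X (\<lambda>x y. \<beta> (f x) (g y))"
  unfolding bilinear_map_def
proof (intro conjI ballI)
  show "linear_map W X (\<lambda>y. \<beta> (f x) (g y))" if "x \<in> carrier V" for x
    using bilinear_map_rightD[OF \<beta> linear_map_mem[OF f that]] by (rule linear_map_comp[OF g])
  show "linear_map V X (\<lambda>x. \<beta> (f x) (g y))" if "y \<in> carrier W" for y
    using bilinear_map_leftD[OF \<beta> linear_map_mem[OF g that]] by (rule linear_map_comp[OF f])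
qed

lemma trilinear_form_pullback:
  assumes \<tau>: "trilinear_form U' V' W' \<tau>"
    and lin: "linear_map U U' f" "linear_map V V' g" "linear_map W W' h"
  shows "trilinear_form U V W (\<lambda>u v w. \<tau> (f u) (g v) (h w))"
  unfolding trilinear_form_def
proof (intro conjI ballI)
  fix u assume "u \<in> carrier U"
  then have "bilinear_map V' W' ground (\<tau> (f u))"
    using \<tau> linear_map_mem[OF lin(1)] by (simp add: trilinear_form_def)
  then show "bilinear_map V W ground (\<lambda>v w. \<tau> (f u) (g v) (h w))"
    by (rule bilinear_map_pullback[OF _ lin(2,3)])
next
  fix v assume "v \<in> carrier V"
  then have "bilinear_map U' W' ground (\<lambda>u. \<tau> u (g v))"
    using \<tau> linear_map_mem[OF lin(2)] by (simp add: trilinear_form_def)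
  then show "bilinear_map U W ground (\<lambda>u w. \<tau> (f u) (g v) (h w))"
    by (rule bilinear_map_pullback[OF _ lin(1,3)])
next
  fix w assume "w \<in> carrier W"
  then have "bilinear_map U' V' ground (\<lambda>u v. \<tau> u v (h w))"
    using \<tau> linear_map_mem[OF lin(3)] by (simp add: trilinear_form_def)
  then show "bilinear_map U V ground (\<lambda>u v. \<tau> (f u) (g v) (h w))"
    by (rule bilinear_map_pullback[OF _ lin(1,2)])
qed

lemma bilinear_product:
  "linear_map V ground f \<Longrightarrow> linear_map W ground g \<Longrightarrow> bilinear_map V W ground (\<lambda>x y. f x * g y)"
  by (auto simp: bilinear_map_def linear_map_def algebra_simps)

lemma tensor_carrierE:
  assumes "t \<in> carrier (tensor V W)"
  obtains xs where "set xs \<subseteq> carrier V \<times> carrier W" "t = tensor_sum V W xs"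
  using assms by (auto simp: tensor_def)

lemma tensor_carrierI:
  "set xs \<subseteq> carrier V \<times> carrier W \<Longrightarrow> tensor_sum V W xs \<in> carrier (tensor V W)"
  by (auto simp: tensor_def)

lemma scale_tensor [simp]: "scale (tensor V W) = fscale"
  by (simp add: tensor_def)

lemma tensor_sum_not_bilinear: "\<not> bilinear_map V W ground \<beta> \<Longrightarrow> tensor_sum V W xs \<beta> = 0"
  by (induction xs) (auto simp: tensor_sum_def pure_tensor_def)

lemma tensor_not_bilinear:
  "t \<in> carrier (tensor V W) \<Longrightarrow> \<not> bilinear_map V W ground \<beta> \<Longrightarrow> t \<beta> = 0"
  by (auto elim!: tensor_carrierE simp: tensor_sum_not_bilinear)

lemma tensor_cong:
  assumes t: "t \<in> carrier (tensor V W)" and V: "vspace V" and W: "vspace W"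
    and eq: "\<And>x y. x \<in> carrier V \<Longrightarrow> y \<in> carrier W \<Longrightarrow> \<beta> x y = \<gamma> x y"
  shows "t \<beta> = t \<gamma>"
proof (cases "bilinear_map V W ground \<beta>")
  case True
  then have \<gamma>: "bilinear_map V W ground \<gamma>" using bilinear_map_cong[of V W \<beta> \<gamma> ground, OF eq V W] by simp
  obtain xs where xs: "set xs \<subseteq> carrier V \<times> carrier W" "t = tensor_sum V W xs"
    using t by (rule tensor_carrierE)
  show ?thesis unfolding xs(2) tensor_sum_apply[OF True] tensor_sum_apply[OF \<gamma>]
    using xs(1) eq by (intro arg_cong[where f = sum_list] map_cong) auto
next
  case False
  then show ?thesis using bilinear_map_cong[of V W \<beta> \<gamma> ground, OF eq V W] tensor_not_bilinear[OF t] by simp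
qed

lemma tensor_sum_in_form:
  assumes "set xs \<subseteq> carrier U \<times> carrier V"
    and "\<And>u v. u \<in> carrier U \<Longrightarrow> v \<in> carrier V \<Longrightarrow> linear_map W ground (\<tau> u v)"
  shows "linear_map W ground (\<lambda>w. \<Sum>(u, v)\<leftarrow>xs. \<tau> u v w)"
  using assms(1)
proof (induction xs)
  case (Cons z xs)
  then show ?case
    using assms(2)[of "fst z" "snd z"] by (auto simp: linear_map_def algebra_simps)
qed (simp add: linear_map_def)

lemma linear_map_cong:
  assumes "\<And>x. x \<in> carrier V \<Longrightarrow> f x = g x" "vspace V"
  shows "linear_map V W f \<longleftrightarrow> linear_map V W g"
  using assms(1) vspace_add[OF assms(2)] vspace_scale[OF assms(2)] by (simp add: linear_map_def)

text \<open>The hypothesis under which the inner tensor of an expansion may be evaluated on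
  representatives; together with its mirror image it lets coassociativity be used as an equation
  between double sums.\<close>

lemma trilinear_expand_left:
  assumes \<tau>: "trilinear_form U V W \<tau>" and D: "linear_map X (tensor U V) D" and W: "vspace W"
  shows "bilinear_map X W ground (\<lambda>x w. D x (\<lambda>u v. \<tau> u v w))"
  unfolding bilinear_map_def
proof (intro conjI ballI)
  fix x assume "x \<in> carrier X"
  then obtain xs where xs: "set xs \<subseteq> carrier U \<times> carrier V" "D x = tensor_sum U V xs"
    using tensor_carrierE linear_map_mem[OF D] by metis
  have "linear_map W ground (\<lambda>w. \<Sum>(u, v)\<leftarrow>xs. \<tau> u v w)"
    using \<tau> by (intro tensor_sum_in_form[OF xs(1)]) (simp add: trilinear_form_def bilinear_map_def)
  moreover have "D x (\<lambda>u v. \<tau> u v w) = (\<Sum>(u, v)\<leftarrow>xs. \<tau> u v w)" if "w \<in> carrier W" for w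
    using \<tau> that by (simp add: xs(2) tensor_sum_apply trilinear_form_def)
  ultimately show "linear_map W ground (\<lambda>w. D x (\<lambda>u v. \<tau> u v w))"
    using linear_map_cong[OF _ W] by (smt (verit))
next
  show "linear_map X ground (\<lambda>x. D x (\<lambda>u v. \<tau> u v w))" for w
    using D by (auto simp: linear_map_def fscale_apply)
qed

lemma trilinear_expand_right:
  assumes \<tau>: "trilinear_form U V W \<tau>" and D: "linear_map X (tensor V W) D" and U: "vspace U"
  shows "bilinear_map U X ground (\<lambda>u x. D x (\<lambda>v w. \<tau> u v w))"
  unfolding bilinear_map_def
proof (intro conjI ballI)
  fix x assume "x \<in> carrier X"
  then obtain xs where xs: "set xs \<subseteq> carrier V \<times> carrier W" "D x = tensor_sum V W xs"
    using tensor_carrierE linear_map_mem[OF D] by metis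
  have "linear_map U ground (\<lambda>u. \<Sum>(v, w)\<leftarrow>xs. \<tau> u v w)"
    using \<tau> by (intro tensor_sum_in_form[OF xs(1)]) (simp add: trilinear_form_def bilinear_map_def)
  moreover have "D x (\<lambda>v w. \<tau> u v w) = (\<Sum>(v, w)\<leftarrow>xs. \<tau> u v w)" if "u \<in> carrier U" for u
    using \<tau> that by (simp add: xs(2) tensor_sum_apply trilinear_form_def)
  ultimately show "linear_map U ground (\<lambda>u. D x (\<lambda>v w. \<tau> u v w))"
    using linear_map_cong[OF _ U] by (smt (verit))
next
  show "linear_map X ground (\<lambda>x. D x (\<lambda>v w. \<tau> u v w))" for u
    using D by (auto simp: linear_map_def fscale_apply)
qed

text \<open>Shortening a sum of pure tensors: if \<open>y\<close> depends on the second components of \<open>xs\<close>,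
  then \<open>x \<otimes> y\<close> can be absorbed into their first components.\<close>

lemma absorb_dependent_term:
  assumes V: "vspace V" and W: "vspace W" and xs: "set xs \<subseteq> carrier V \<times> carrier W"
    and x: "x \<in> carrier V" and y: "y \<in> module.span (scale W) (snd ` set xs)"
  shows "\<exists>ys. set ys \<subseteq> carrier V \<times> carrier W \<and> length ys = length xs \<and>
    (\<forall>\<beta>. bilinear_map V W ground \<beta> \<longrightarrow>
      (\<Sum>(u, v)\<leftarrow>ys. \<beta> u v) = \<beta> x y + (\<Sum>(u, v)\<leftarrow>xs. \<beta> u v))"
  using xs y
proof (induction xs arbitrary: y)
  case Nil
  interpret W: module "scale W" using W by (rule vspace_module)
  have "y = 0" using Nil by simp
  then have "\<beta> x y = 0" if "bilinear_map V W ground \<beta>" for \<beta>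
    using linear_map_zero[OF bilinear_map_rightD[OF that x] W] by simp
  then show ?case by (intro exI[of _ "[]"]) auto
next
  case (Cons z xs)
  interpret W: module "scale W" using W by (rule vspace_module)
  obtain u v where z: "z = (u, v)" by force
  have uv: "u \<in> carrier V" "v \<in> carrier W" using Cons.prems z by auto
  obtain k where k: "y - scale W k v \<in> W.span (snd ` set xs)"
    using Cons.prems z W.span_breakdown_eq[of y v "snd ` set xs"] by auto
  let ?y = "y - scale W k v"
  have "W.span (snd ` set xs) \<subseteq> carrier W"
    using Cons.prems by (intro W.span_minimal vspace_subspace[OF W]) auto
  then have yc: "?y \<in> carrier W" using k by auto
  obtain ys where ys: "set ys \<subseteq> carrier V \<times> carrier W" "length ys = length xs"
    "\<And>\<beta>. bilinear_map V W ground \<beta> \<Longrightarrow>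
      (\<Sum>(u, v)\<leftarrow>ys. \<beta> u v) = \<beta> x ?y + (\<Sum>(u, v)\<leftarrow>xs. \<beta> u v)"
    using Cons.IH[OF _ k] Cons.prems by auto
  have "(\<Sum>(u, v)\<leftarrow>(u + scale V k x, v) # ys. \<beta> u v) = \<beta> x y + (\<Sum>(u, v)\<leftarrow>z # xs. \<beta> u v)"
    if \<beta>: "bilinear_map V W ground \<beta>" for \<beta>
  proof -
    have "\<beta> x y = \<beta> x ?y + k * \<beta> x v"
      using linear_map_add[OF bilinear_map_rightD[OF \<beta> x] yc vspace_scale[OF W uv(2), of k]]
        linear_map_scale[OF bilinear_map_rightD[OF \<beta> x] uv(2)] by simp
    moreover have "\<beta> (u + scale V k x) v = \<beta> u v + k * \<beta> x v"
      using linear_map_add[OF bilinear_map_leftD[OF \<beta> uv(2)] uv(1) vspace_scale[OF V x]]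
        linear_map_scale[OF bilinear_map_leftD[OF \<beta> uv(2)] x] by simp
    ultimately show ?thesis using ys(3)[OF \<beta>] by (simp add: z)
  qed
  moreover have "u + scale V k x \<in> carrier V" using uv x by (intro vspace_closed[OF V])
  ultimately show ?case
    using ys(1,2) uv by (intro exI[of _ "(u + scale V k x, v) # ys"]) auto
qed

text \<open>If the functionals in \<open>P\<close> separate points, then the induced maps \<open>V \<otimes> W \<rightarrow> W\<close> jointly
  detect zero. One shortens the sum: a term whose right factor depends on the others is absorbed
  into them, and a term whose right factor is independent of the others has a left factor killed
  by all of \<open>P\<close>, which is therefore zero.\<close>

lemma separated_tensor_vanishes:
  assumes V: "vspace V" and W: "vspace W"
    and lin: "\<And>p. p \<in> P \<Longrightarrow> linear_map V ground p"
    and sep: "\<And>x. x \<in> carrier V \<Longrightarrow> x \<noteq> 0 \<Longrightarrow> \<exists>p\<in>P. p x \<noteq> 0"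
    and \<beta>: "bilinear_map V W ground \<beta>"
    and xs: "set xs \<subseteq> carrier V \<times> carrier W"
    and zero: "\<And>p. p \<in> P \<Longrightarrow> (\<Sum>(x, y)\<leftarrow>xs. scale W (p x) y) = 0"
  shows "(\<Sum>(x, y)\<leftarrow>xs. \<beta> x y) = 0"
  using xs zero
proof (induction "length xs" arbitrary: xs)
  case (Suc n)
  interpret W: vector_space "scale W" using W by (rule vspace_vector_space)
  obtain x y ys where xs: "xs = (x, y) # ys" and n: "length ys = n"
    using Suc.hyps(2) by (cases xs) auto
  have mem: "x \<in> carrier V" "y \<in> carrier W" "set ys \<subseteq> carrier V \<times> carrier W"
    using Suc.prems xs by auto
  show ?case
  proof (cases "y \<in> W.span (snd ` set ys)")
    case True
    obtain zs where zs: "set zs \<subseteq> carrier V \<times> carrier W" "length zs = length ys"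
      "\<And>\<gamma>. bilinear_map V W ground \<gamma> \<Longrightarrow>
        (\<Sum>(u, v)\<leftarrow>zs. \<gamma> u v) = \<gamma> x y + (\<Sum>(u, v)\<leftarrow>ys. \<gamma> u v)"
      using absorb_dependent_term[OF V W mem(3,1) True] by blast
    have eq: "tensor_sum V W zs = tensor_sum V W xs"
    proof
      fix \<gamma> show "tensor_sum V W zs \<gamma> = tensor_sum V W xs \<gamma>"
        using zs(3)[of \<gamma>] xs
        by (cases "bilinear_map V W ground \<gamma>") (auto simp: tensor_sum_apply tensor_sum_not_bilinear)
    qed
    have "(\<Sum>(x, y)\<leftarrow>zs. scale W (p x) y) = 0" if p: "p \<in> P" for p
    proof -
      have "bilinear_map V W W (\<lambda>x y. scale W (p x) y)"
        using lin[OF p] by (auto simp: bilinear_map_def linear_map_def vspace_closed[OF W] 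
            W.scale_left_distrib W.scale_right_distrib mult.commute)
      then show ?thesis
        using tensor_universal[OF W _ zs(1) Suc.prems(1) eq] Suc.prems(2)[OF p] by simp
    qed
    then have "(\<Sum>(u, v)\<leftarrow>zs. \<beta> u v) = 0" using Suc.hyps(1)[of zs] zs n by auto
    then show ?thesis using zs(3)[OF \<beta>] xs by simp
  next
    case False
    have span: "(\<Sum>(x, y)\<leftarrow>ys. scale W (p x) y) \<in> W.span (snd ` set ys)" for p
    proof (induction ys)
      case (Cons z ys)
      have "W.span (snd ` set ys) \<subseteq> W.span (snd ` set (z # ys))" by (intro W.span_mono) auto
      moreover have "scale W (p (fst z)) (snd z) \<in> W.span (snd ` set (z # ys))"
        by (intro W.span_scale W.span_base) simp
      ultimately show ?case using Cons W.span_add by (auto simp: case_prod_beta)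
    qed (simp add: W.span_zero)
    have "p x = 0" if p: "p \<in> P" for p
    proof (rule ccontr)
      assume ne: "p x \<noteq> 0"
      have "scale W (p x) y = - (\<Sum>(x, y)\<leftarrow>ys. scale W (p x) y)"
        using Suc.prems(2)[OF p] xs by (simp add: eq_neg_iff_add_eq_0)
      then have "scale W (p x) y \<in> W.span (snd ` set ys)" using span W.span_neg by metis
      then have "scale W (1 / p x) (scale W (p x) y) \<in> W.span (snd ` set ys)" by (rule W.span_scale)
      then show False using ne False by simp
    qed
    then have "x = 0" using sep mem(1) by blast
    then have "\<beta> x y = 0" using linear_map_zero[OF bilinear_map_leftD[OF \<beta> mem(2)] V] by simp
    moreover have "(\<Sum>(x, y)\<leftarrow>ys. scale W (p x) y) = 0" if "p \<in> P" for p
      using Suc.prems(2)[OF that] \<open>x = 0\<close> linear_map_zero[OF lin[OF that] V] xs by simp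
    ultimately show ?thesis using Suc.hyps(1)[of ys] n mem(3) xs by simp
  qed
qed simp

section \<open>The convolution algebra and its rational part\<close>

locale counital_coalgebra =
  fixes C :: "('k::field, 'c::ab_group_add) coalg"
  assumes coalgebra: "coalgebra C"
begin

abbreviation star :: "('c \<Rightarrow> 'k) set" where
  "star \<equiv> carrier (dual C)"

lemma vspace_C: "vspace C"
  using coalgebra by (simp add: coalgebra_def)

sublocale C: vector_space "scale C"
  using vspace_C by (rule vspace_vector_space)

lemma comult_linear: "linear_map C (tensor C C) (comult C)"
  and counit_linear: "linear_map C ground (counit C)"
  using coalgebra by (auto simp: coalgebra_def)

lemma comult_mem: "c \<in> carrier C \<Longrightarrow> comult C c \<in> carrier (tensor C C)"
  using comult_linear by (rule linear_map_mem)

text \<open>A chosen representative of \<open>c\<^sub>1 \<otimes> c\<^sub>2\<close>.\<close>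

definition sweedler :: "'c \<Rightarrow> ('c \<times> 'c) list" where
  "sweedler c = (SOME xs. set xs \<subseteq> carrier C \<times> carrier C \<and> comult C c = tensor_sum C C xs \<and>
      (\<Sum>(x, y)\<leftarrow>xs. scale C (counit C x) y) = c \<and>
      (\<Sum>(x, y)\<leftarrow>xs. scale C (counit C y) x) = c)"

lemma sweedler:
  assumes "c \<in> carrier C"
  shows "set (sweedler c) \<subseteq> carrier C \<times> carrier C"
    and "comult C c = tensor_sum C C (sweedler c)"
    and "(\<Sum>(x, y)\<leftarrow>sweedler c. scale C (counit C x) y) = c"
    and "(\<Sum>(x, y)\<leftarrow>sweedler c. scale C (counit C y) x) = c"
proof -
  have "\<exists>xs. set xs \<subseteq> carrier C \<times> carrier C \<and> comult C c = tensor_sum C C xs \<and>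
      (\<Sum>(x, y)\<leftarrow>xs. scale C (counit C x) y) = c \<and>
      (\<Sum>(x, y)\<leftarrow>xs. scale C (counit C y) x) = c"
    using coalgebra assms by (auto simp: coalgebra_def)
  from someI_ex[OF this] show "set (sweedler c) \<subseteq> carrier C \<times> carrier C"
    "comult C c = tensor_sum C C (sweedler c)"
    "(\<Sum>(x, y)\<leftarrow>sweedler c. scale C (counit C x) y) = c"
    "(\<Sum>(x, y)\<leftarrow>sweedler c. scale C (counit C y) x) = c"
    unfolding sweedler_def by auto
qed

lemma comult_apply:
  "c \<in> carrier C \<Longrightarrow> bilinear_map C C ground \<beta> \<Longrightarrow> comult C c \<beta> = (\<Sum>(x, y)\<leftarrow>sweedler c. \<beta> x y)"
  using sweedler(2) by (simp add: tensor_sum_apply)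

lemma star_iff: "f \<in> star \<longleftrightarrow> linear_map C ground f \<and> (\<forall>x. x \<notin> carrier C \<longrightarrow> f x = 0)"
  by (simp add: dual_def)

lemma star_linear: "f \<in> star \<Longrightarrow> linear_map C ground f"
  by (simp add: star_iff)

lemma star_eqI: "f \<in> star \<Longrightarrow> g \<in> star \<Longrightarrow> (\<And>c. c \<in> carrier C \<Longrightarrow> f c = g c) \<Longrightarrow> f = g"
  by (rule ext) (metis star_iff)

lemma subspace_star: "fscale.subspace star"
  by (rule fscale.subspaceI) (auto simp: star_iff linear_map_def fscale_apply algebra_simps)

text \<open>Elements of the dual vanish outside the carrier, so functionals given by formulas are cut off.\<close>

lemma restrict_star:
  "linear_map C ground p \<Longrightarrow> (\<lambda>c. if c \<in> carrier C then p c else 0) \<in> star"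
  by (auto simp: star_iff linear_map_def vspace_closed[OF vspace_C])

lemma star_separates:
  assumes "c \<in> carrier C" "c \<noteq> 0"
  shows "\<exists>p\<in>star. p c \<noteq> 0"
proof -
  obtain p where p: "Vector_Spaces.linear (scale C) (*) p" "p c \<noteq> 0"
    using separating_functional[OF C.vector_space_axioms assms(2)] by blast
  interpret p: Vector_Spaces.linear "scale C" "(*)" p by (rule p(1))
  have "linear_map C ground p" by (simp add: linear_map_def p.add p.scale)
  from restrict_star[OF this] show ?thesis using p(2) assms(1) by (intro bexI) auto
qed

lemma eq_by_functionals:
  assumes "c \<in> carrier C" "d \<in> carrier C" "\<And>q. q \<in> star \<Longrightarrow> q c = q d"
  shows "c = d"
proof (rule ccontr)
  assume "c \<noteq> d"
  then obtain q where q: "q \<in> star" "q (c - d) \<noteq> 0"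
    using star_separates[of "c - d"] assms(1,2) vspace_diff[OF vspace_C] by auto
  then show False using linear_map_diff[OF star_linear[OF q(1)] vspace_C assms(1,2)] assms(3)[OF q(1)]
    by simp
qed

definition eps :: "'c \<Rightarrow> 'k" where
  "eps = (\<lambda>c. if c \<in> carrier C then counit C c else 0)"

lemma eps_star: "eps \<in> star"
  unfolding eps_def using counit_linear by (rule restrict_star)

text \<open>The two module actions of the dual algebra on \<open>C\<close>: \<open>hit g c\<close> is \<open>c \<leftharpoonup> g\<close> and \<open>hit_left g c\<close> is
  \<open>g \<rightharpoonup> c\<close>. They are the transposes of convolution by \<open>g\<close>, which is how their properties are
  obtained: functionals separate points, so identities in \<open>C\<close> are checked in the dual.\<close>

definition hit :: "('c \<Rightarrow> 'k) \<Rightarrow> 'c \<Rightarrow> 'c" where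
  "hit g c = (\<Sum>(x, y)\<leftarrow>sweedler c. scale C (g x) y)"

definition hit_left :: "('c \<Rightarrow> 'k) \<Rightarrow> 'c \<Rightarrow> 'c" where
  "hit_left g c = (\<Sum>(x, y)\<leftarrow>sweedler c. scale C (g y) x)"

lemma hit_mem: "c \<in> carrier C \<Longrightarrow> hit g c \<in> carrier C"
  and hit_left_mem: "c \<in> carrier C \<Longrightarrow> hit_left g c \<in> carrier C"
  unfolding hit_def hit_left_def using sweedler(1)
  by (fastforce intro!: vspace_sum_list[OF vspace_C] vspace_scale[OF vspace_C])+

lemma bilinear_star: "f \<in> star \<Longrightarrow> g \<in> star \<Longrightarrow> bilinear_map C C ground (\<lambda>x y. f x * g y)"
  by (simp add: bilinear_product star_linear)

lemma convolution_eq: "c \<in> carrier C \<Longrightarrow> convolution C f g c = comult C c (\<lambda>x y. f x * g y)"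
  by (simp add: convolution_def)

lemma apply_hit:
  assumes "c \<in> carrier C" "g \<in> star" "q \<in> star"
  shows "q (hit g c) = convolution C g q c"
proof -
  have mem: "\<And>x y. (x, y) \<in> set (sweedler c) \<Longrightarrow> y \<in> carrier C"
    using sweedler(1)[OF assms(1)] by auto
  have "q (hit g c) = (\<Sum>(x, y)\<leftarrow>sweedler c. q (scale C (g x) y))"
    unfolding hit_def
    using mem by (intro linear_map_sum_list[OF star_linear[OF assms(3)] vspace_C])
      (auto intro: vspace_scale[OF vspace_C])
  also have "\<dots> = (\<Sum>(x, y)\<leftarrow>sweedler c. g x * q y)"
    using mem linear_map_scale[OF star_linear[OF assms(3)]]
    by (intro arg_cong[where f = sum_list] map_cong) auto
  finally show ?thesis
    using comult_apply[OF assms(1) bilinear_star] assms by (simp add: convolution_eq)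
qed

lemma apply_hit_left:
  assumes "c \<in> carrier C" "g \<in> star" "q \<in> star"
  shows "q (hit_left g c) = convolution C q g c"
proof -
  have mem: "\<And>x y. (x, y) \<in> set (sweedler c) \<Longrightarrow> x \<in> carrier C"
    using sweedler(1)[OF assms(1)] by auto
  have "q (hit_left g c) = (\<Sum>(x, y)\<leftarrow>sweedler c. q (scale C (g y) x))"
    unfolding hit_left_def
    using mem by (intro linear_map_sum_list[OF star_linear[OF assms(3)] vspace_C])
      (auto intro: vspace_scale[OF vspace_C])
  also have "\<dots> = (\<Sum>(x, y)\<leftarrow>sweedler c. q x * g y)"
    using mem linear_map_scale[OF star_linear[OF assms(3)]]
    by (intro arg_cong[where f = sum_list] map_cong) (auto simp: mult.commute)
  finally show ?thesis
    using comult_apply[OF assms(1) bilinear_star] assms by (simp add: convolution_eq)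
qed

lemma convolution_star:
  assumes "f \<in> star" "g \<in> star"
  shows "convolution C f g \<in> star"
proof -
  have "linear_map C ground (\<lambda>c. comult C c (\<lambda>x y. f x * g y))"
    using comult_linear by (auto simp: linear_map_def fscale_apply)
  from restrict_star[OF this] show ?thesis by (simp add: convolution_def)
qed

lemma eps_convolution:
  assumes "f \<in> star"
  shows "convolution C eps f = f" and "convolution C f eps = f"
proof -
  have "hit eps c = c" "hit_left eps c = c" if c: "c \<in> carrier C" for c
  proof -
    have "hit eps c = (\<Sum>(x, y)\<leftarrow>sweedler c. scale C (counit C x) y)"
      "hit_left eps c = (\<Sum>(x, y)\<leftarrow>sweedler c. scale C (counit C y) x)"
      unfolding hit_def hit_left_def using sweedler(1)[OF c]
      by (intro arg_cong[where f = sum_list] map_cong; auto simp: eps_def)+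
    then show "hit eps c = c" "hit_left eps c = c" using sweedler(3,4)[OF c] by auto
  qed
  then show "convolution C eps f = f" and "convolution C f eps = f"
    using apply_hit[OF _ eps_star assms] apply_hit_left[OF _ eps_star assms]
    by (auto intro!: star_eqI convolution_star assms eps_star)
qed

lemma convolution_assoc:
  assumes f: "f \<in> star" and g: "g \<in> star" and h: "h \<in> star"
  shows "convolution C (convolution C f g) h = convolution C f (convolution C g h)"
proof (rule star_eqI)
  show "convolution C (convolution C f g) h \<in> star" "convolution C f (convolution C g h) \<in> star"
    using assms by (auto intro: convolution_star)
next
  fix c assume c: "c \<in> carrier C"
  let ?\<tau> = "\<lambda>u v w. f u * g v * h w"
  have \<tau>: "trilinear_form C C C ?\<tau>"
    using assms[THEN star_linear]
    by (auto simp: trilinear_form_def bilinear_map_def linear_map_def algebra_simps)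
  have l: "comult C x (\<lambda>u v. ?\<tau> u v w) = convolution C f g x * h w" if x: "x \<in> carrier C" for x w
  proof -
    have "bilinear_map C C ground (\<lambda>u v. ?\<tau> u v w)"
      using assms[THEN star_linear] by (auto simp: bilinear_map_def linear_map_def algebra_simps)
    then show ?thesis
      using comult_apply[OF x bilinear_star[OF f g]] comult_apply[OF x]
      by (simp add: convolution_eq[OF x] sum_list_mult_const case_prod_unfold)
  qed
  have r: "comult C x (\<lambda>v w. ?\<tau> u v w) = f u * convolution C g h x" if x: "x \<in> carrier C" for x u
  proof -
    have "bilinear_map C C ground (\<lambda>v w. ?\<tau> u v w)"
      using assms[THEN star_linear] by (auto simp: bilinear_map_def linear_map_def algebra_simps)
    then show ?thesis
      using comult_apply[OF x bilinear_star[OF g h]] comult_apply[OF x]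
      by (simp add: convolution_eq[OF x] sum_list_const_mult case_prod_unfold mult.assoc)
  qed
  have "expand_left C C C (comult C) (comult C c) ?\<tau> = expand_right C C C (comult C) (comult C c) ?\<tau>"
    using coalgebra c by (simp add: coalgebra_def)
  then have "comult C c (\<lambda>x w. comult C x (\<lambda>u v. ?\<tau> u v w)) =
      comult C c (\<lambda>u x. comult C x (\<lambda>v w. ?\<tau> u v w))"
    using \<tau> by (simp add: expand_left_def expand_right_def)
  moreover have "comult C c (\<lambda>x w. comult C x (\<lambda>u v. ?\<tau> u v w)) =
      comult C c (\<lambda>x w. convolution C f g x * h w)"
    by (rule tensor_cong[OF comult_mem[OF c] vspace_C vspace_C]) (simp add: l)
  moreover have "comult C c (\<lambda>u x. comult C x (\<lambda>v w. ?\<tau> u v w)) =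
      comult C c (\<lambda>u x. f u * convolution C g h x)"
    by (rule tensor_cong[OF comult_mem[OF c] vspace_C vspace_C]) (simp add: r)
  ultimately show "convolution C (convolution C f g) h c = convolution C f (convolution C g h) c"
    by (simp add: convolution_eq[OF c])
qed

lemma convolution_add_right:
  assumes "f \<in> star" "g \<in> star" "h \<in> star"
  shows "convolution C f (g + h) = convolution C f g + convolution C f h"
proof (rule ext)
  fix c
  show "convolution C f (g + h) c = (convolution C f g + convolution C f h) c"
  proof (cases "c \<in> carrier C")
    case True
    then show ?thesis
      using apply_hit[OF True assms(1)] assms fscale.subspace_add[OF subspace_star assms(2,3)]
      by (simp add: fscale_apply flip: apply_hit)
  qed (simp add: convolution_def fscale_apply)
qed

lemma convolution_scale_right:
  assumes "f \<in> star" "g \<in> star"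
  shows "convolution C f (fscale a g) = fscale a (convolution C f g)"
proof (rule ext)
  fix c
  show "convolution C f (fscale a g) c = fscale a (convolution C f g) c"
  proof (cases "c \<in> carrier C")
    case True
    then show ?thesis
      using apply_hit[OF True assms(1)] assms fscale.subspace_scale[OF subspace_star assms(2)]
      by (simp add: fscale_apply flip: apply_hit)
  qed (simp add: convolution_def fscale_apply)
qed

lemma convolution_add_left:
  assumes "f \<in> star" "g \<in> star" "h \<in> star"
  shows "convolution C (f + g) h = convolution C f h + convolution C g h"
proof (rule ext)
  fix c
  show "convolution C (f + g) h c = (convolution C f h + convolution C g h) c"
  proof (cases "c \<in> carrier C")
    case True
    then show ?thesis
      using assms fscale.subspace_add[OF subspace_star assms(1,2)]
      by (simp add: fscale_apply flip: apply_hit_left)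
  qed (simp add: convolution_def fscale_apply)
qed

lemma convolution_scale_left:
  assumes "f \<in> star" "g \<in> star"
  shows "convolution C (fscale a f) g = fscale a (convolution C f g)"
proof (rule ext)
  fix c
  show "convolution C (fscale a f) g c = fscale a (convolution C f g) c"
  proof (cases "c \<in> carrier C")
    case True
    then show ?thesis
      using assms fscale.subspace_scale[OF subspace_star assms(1)]
      by (simp add: fscale_apply flip: apply_hit_left)
  qed (simp add: convolution_def fscale_apply)
qed

abbreviation rat :: "('c \<Rightarrow> 'k) set" where
  "rat \<equiv> carrier (rat_dual C)"

lemma rat_iff:
  "f \<in> rat \<longleftrightarrow> f \<in> star \<and> (\<exists>xs. set xs \<subseteq> carrier C \<times> star \<and>
    (\<forall>g\<in>star. convolution C g f = (\<Sum>(c, n)\<leftarrow>xs. fscale (g c) n)))"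
  by (simp add: rat_dual_def rational_part_def dual_algebra_def dual_def)

lemma rat_star: "f \<in> rat \<Longrightarrow> f \<in> star"
  by (simp add: rat_iff)

lemma subspace_rat: "fscale.subspace rat"
proof (rule fscale.subspaceI)
  show "0 \<in> rat"
    unfolding rat_iff
  proof (intro conjI exI[of _ "[]"] ballI)
    show "0 \<in> star" by (rule fscale.subspace_0[OF subspace_star])
    then show "convolution C g 0 = (\<Sum>(c, n)\<leftarrow>[]. fscale (g c) n)" if "g \<in> star" for g
      using convolution_scale_right[OF that, of 0 0] by (simp add: fscale.scale_zero_left)
  qed simp
next
  fix f f' assume "f \<in> rat" "f' \<in> rat"
  then obtain xs ys where *: "f \<in> star" "f' \<in> star"
    "set xs \<subseteq> carrier C \<times> star" "set ys \<subseteq> carrier C \<times> star"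
    "\<forall>g\<in>star. convolution C g f = (\<Sum>(c, n)\<leftarrow>xs. fscale (g c) n)"
    "\<forall>g\<in>star. convolution C g f' = (\<Sum>(c, n)\<leftarrow>ys. fscale (g c) n)"
    unfolding rat_iff by blast
  then show "f + f' \<in> rat"
    unfolding rat_iff using fscale.subspace_add[OF subspace_star]
    by (intro conjI exI[of _ "xs @ ys"]) (auto simp: convolution_add_right)
next
  fix a f assume "f \<in> rat"
  then obtain xs where *: "f \<in> star" "set xs \<subseteq> carrier C \<times> star"
    "\<forall>g\<in>star. convolution C g f = (\<Sum>(c, n)\<leftarrow>xs. fscale (g c) n)"
    unfolding rat_iff by blast
  have "fscale a (\<Sum>(c, n)\<leftarrow>xs. fscale (g c) n) =
      (\<Sum>(c, n)\<leftarrow>map (\<lambda>(c, n). (c, fscale a n)) xs. fscale (g c) n)" for g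
    by (induction xs) (auto simp: fscale.scale_right_distrib mult.commute
        simp del: zero_fun_apply plus_fun_apply)
  moreover have "set (map (\<lambda>(c, n). (c, fscale a n)) xs) \<subseteq> carrier C \<times> star"
    using *(2) fscale.subspace_scale[OF subspace_star] by auto
  ultimately show "fscale a f \<in> rat"
    unfolding rat_iff using * fscale.subspace_scale[OF subspace_star]
    by (intro conjI exI[of _ "map (\<lambda>(c, n). (c, fscale a n)) xs"])
      (simp_all add: convolution_scale_right)
qed

text \<open>If \<open>h * f\<close> is the sum of the \<open>h(c) n\<close>, then \<open>h * (g * f) = (h * g) * f\<close> is the sum of the
  \<open>(h * g)(c) n\<close>, and \<open>(h * g)(c) = h(g \<rightharpoonup> c)\<close>.\<close>

lemma rat_left_ideal:
  assumes g: "g \<in> star" and f: "f \<in> rat"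
  shows "convolution C g f \<in> rat"
proof -
  obtain xs where xs: "f \<in> star" "set xs \<subseteq> carrier C \<times> star"
    "\<forall>g\<in>star. convolution C g f = (\<Sum>(c, n)\<leftarrow>xs. fscale (g c) n)"
    using f unfolding rat_iff by blast
  let ?ys = "map (\<lambda>(c, n). (hit_left g c, n)) xs"
  have "convolution C h (convolution C g f) = (\<Sum>(c, n)\<leftarrow>?ys. fscale (h c) n)"
    if h: "h \<in> star" for h
  proof -
    have "convolution C h (convolution C g f) = (\<Sum>(c, n)\<leftarrow>xs. fscale (convolution C h g c) n)"
      using convolution_assoc[OF h g xs(1)] xs(3) convolution_star[OF h g] by metis
    also have "\<dots> = (\<Sum>(c, n)\<leftarrow>xs. fscale (h (hit_left g c)) n)"
      using xs(2) apply_hit_left[OF _ g h]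
      by (intro arg_cong[where f = sum_list] map_cong) auto
    finally show ?thesis by (simp add: case_prod_unfold comp_def)
  qed
  moreover have "set ?ys \<subseteq> carrier C \<times> star" using xs(2) hit_left_mem by auto
  ultimately show ?thesis unfolding rat_iff using convolution_star[OF g xs(1)] by blast
qed

lemma rat_right_ideal:
  assumes f: "f \<in> rat" and g: "g \<in> star"
  shows "convolution C f g \<in> rat"
proof -
  obtain xs where xs: "f \<in> star" "set xs \<subseteq> carrier C \<times> star"
    "\<forall>g\<in>star. convolution C g f = (\<Sum>(c, n)\<leftarrow>xs. fscale (g c) n)"
    using f unfolding rat_iff by blast
  let ?ys = "map (\<lambda>(c, n). (c, convolution C n g)) xs"
  have mem: "(\<Sum>(c, n)\<leftarrow>ys. fscale (h c) n) \<in> star" if "set ys \<subseteq> carrier C \<times> star" for ys h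
    using that
    by (induction ys) (auto intro!: fscale.subspace_0[OF subspace_star]
        fscale.subspace_add[OF subspace_star] fscale.subspace_scale[OF subspace_star])
  have "convolution C (\<Sum>(c, n)\<leftarrow>ys. fscale (h c) n) g =
      (\<Sum>(c, n)\<leftarrow>map (\<lambda>(c, n). (c, convolution C n g)) ys. fscale (h c) n)"
    if "set ys \<subseteq> carrier C \<times> star" for ys h
    using that
  proof (induction ys)
    case Nil
    show ?case
      using convolution_scale_left[OF fscale.subspace_0[OF subspace_star] g, of 0]
      by (simp del: zero_fun_apply)
  next
    case (Cons z ys)
    obtain c n where z: "z = (c, n)" by force
    have "fscale (h c) n \<in> star" "n \<in> star"
      using Cons.prems z fscale.subspace_scale[OF subspace_star] by auto
    then show ?case
      using Cons z mem[of ys h] g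
      by (simp add: convolution_add_left convolution_scale_left del: plus_fun_apply)
  qed
  then have "convolution C h (convolution C f g) = (\<Sum>(c, n)\<leftarrow>?ys. fscale (h c) n)"
    if h: "h \<in> star" for h
    using convolution_assoc[OF h xs(1) g] xs(2,3) h by metis
  moreover have "set ?ys \<subseteq> carrier C \<times> star" using xs(2) convolution_star[OF _ g] by auto
  ultimately show ?thesis unfolding rat_iff using convolution_star[OF xs(1) g] by blast
qed

section \<open>Left coideals\<close>

lemma hit_hit:
  assumes "c \<in> carrier C" "g \<in> star" "h \<in> star"
  shows "hit h (hit g c) = hit (convolution C g h) c"
proof (rule eq_by_functionals)
  fix q assume q: "q \<in> star"
  show "q (hit h (hit g c)) = q (hit (convolution C g h) c)"
    using assms q by (simp add: apply_hit hit_mem convolution_star convolution_assoc)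
qed (use assms hit_mem in auto)

lemma hit_eps: "c \<in> carrier C \<Longrightarrow> hit eps c = c"
  by (rule eq_by_functionals) (auto simp: hit_mem apply_hit eps_star eps_convolution)

lemma hit_add: "hit (g + h) c = hit g c + hit h c"
  by (simp add: hit_def C.scale_left_distrib sum_list_addf case_prod_unfold)

lemma hit_fscale: "hit (fscale a g) c = scale C a (hit g c)"
proof -
  have "(\<Sum>(x, y)\<leftarrow>zs. scale C (fscale a g x) y) = scale C a (\<Sum>(x, y)\<leftarrow>zs. scale C (g x) y)" for zs
    by (induction zs) (auto simp: fscale_apply C.scale_right_distrib)
  then show ?thesis by (simp add: hit_def)
qed

definition left_coideal :: "'c set \<Rightarrow> bool" where
  "left_coideal N \<longleftrightarrow> N \<subseteq> carrier C \<and> C.subspace N \<and> (\<forall>n\<in>N. \<forall>g\<in>star. hit g n \<in> N)"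

definition orbit :: "'c \<Rightarrow> 'c set" where
  "orbit c = (\<lambda>g. hit g c) ` star"

lemma left_coideal_carrier: "left_coideal (carrier C)"
  by (auto simp: left_coideal_def vspace_subspace vspace_C hit_mem)

lemma left_coideal_orbit:
  assumes c: "c \<in> carrier C"
  shows "left_coideal (orbit c)"
proof -
  have "C.subspace (orbit c)"
  proof (rule C.subspaceI)
    show "0 \<in> orbit c"
      unfolding orbit_def
      by (rule image_eqI[of _ _ 0])
        (use hit_fscale[of 0 0 c] fscale.subspace_0[OF subspace_star] in simp_all)
  next
    fix x y assume "x \<in> orbit c" "y \<in> orbit c"
    then show "x + y \<in> orbit c"
      unfolding orbit_def using hit_add fscale.subspace_add[OF subspace_star]
      by (auto simp: image_iff) metis
  next
    fix a x assume "x \<in> orbit c"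
    then show "scale C a x \<in> orbit c"
      unfolding orbit_def using hit_fscale[of a] fscale.subspace_scale[OF subspace_star]
      by (auto simp: image_iff) metis
  qed
  then show ?thesis
    using c hit_mem hit_hit convolution_star by (auto simp: left_coideal_def orbit_def)
qed

text \<open>Stability under the dual forces \<open>\<Delta>(N)\<close> into \<open>C \<otimes> N\<close>: for a linear projection \<open>\<pi>\<close> onto \<open>N\<close>, the
  tensor of the \<open>n\<^sub>1 \<otimes> (n\<^sub>2 - \<pi> n\<^sub>2)\<close> is sent by each functional \<open>g\<close> to
  \<open>n \<leftharpoonup> g - \<pi> (n \<leftharpoonup> g) = 0\<close>, hence it vanishes.\<close>

lemma left_coideal_comult:
  assumes N: "left_coideal N" and n: "n \<in> N"
  shows "\<exists>xs. set xs \<subseteq> carrier C \<times> N \<and> comult C n = tensor_sum C C xs"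
proof -
  have sub: "C.subspace N" "N \<subseteq> carrier C" using N by (auto simp: left_coideal_def)
  obtain \<pi> where \<pi>: "Vector_Spaces.linear (scale C) (scale C) \<pi>" "\<And>x. \<pi> x \<in> N"
    "\<And>x. x \<in> N \<Longrightarrow> \<pi> x = x"
    using subspace_projection[OF C.vector_space_axioms sub(1)] by blast
  interpret \<pi>: Vector_Spaces.linear "scale C" "scale C" \<pi> by (rule \<pi>(1))
  have nC: "n \<in> carrier C" using n sub by auto
  let ?xs = "map (\<lambda>(x, y). (x, \<pi> y)) (sweedler n)"
  let ?ds = "map (\<lambda>(x, y). (x, y - \<pi> y)) (sweedler n)"
  have set: "set (sweedler n) \<subseteq> carrier C \<times> carrier C" by (rule sweedler(1)[OF nC])
  have ds: "set ?ds \<subseteq> carrier C \<times> carrier C"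
    using set \<pi>(2) sub(2) by (auto intro!: vspace_diff[OF vspace_C])
  have zero: "(\<Sum>(x, y)\<leftarrow>?ds. scale C (g x) y) = 0" if "g \<in> star" for g
  proof -
    have "(\<Sum>(x, y)\<leftarrow>map (\<lambda>(x, y). (x, y - \<pi> y)) zs. scale C (g x) y) =
        (\<Sum>(x, y)\<leftarrow>zs. scale C (g x) y) - \<pi> (\<Sum>(x, y)\<leftarrow>zs. scale C (g x) y)" for zs
      by (induction zs) (auto simp: C.scale_right_diff_distrib \<pi>.add \<pi>.scale \<pi>.zero)
    then have "(\<Sum>(x, y)\<leftarrow>?ds. scale C (g x) y) = hit g n - \<pi> (hit g n)" by (simp add: hit_def)
    then show ?thesis using N n that \<pi>(3) by (simp add: left_coideal_def)
  qed
  have "comult C n \<beta> = tensor_sum C C ?xs \<beta>" for \<beta>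
  proof (cases "bilinear_map C C ground \<beta>")
    case True
    have "(\<Sum>(x, y)\<leftarrow>?ds. \<beta> x y) = 0"
      by (rule separated_tensor_vanishes[where P = star, OF vspace_C vspace_C star_linear star_separates True ds zero])
    moreover have "(\<Sum>(x, y)\<leftarrow>map (\<lambda>(x, y). (x, y - \<pi> y)) zs. \<beta> x y) =
        (\<Sum>(x, y)\<leftarrow>zs. \<beta> x y) - (\<Sum>(x, y)\<leftarrow>map (\<lambda>(x, y). (x, \<pi> y)) zs. \<beta> x y)"
      if "set zs \<subseteq> carrier C \<times> carrier C" for zs
      using that
    proof (induction zs)
      case (Cons z zs)
      obtain x y where z: "z = (x, y)" by force
      have "\<beta> x (y - \<pi> y) = \<beta> x y - \<beta> x (\<pi> y)"
        using linear_map_diff[OF bilinear_map_rightD[OF True] vspace_C] Cons.prems z \<pi>(2) sub(2)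
        by (simp add: subset_iff)
      then show ?case using Cons z by simp
    qed simp
    ultimately show ?thesis
      using comult_apply[OF nC True] set by (simp add: tensor_sum_apply[OF True])
  next
    case False
    then show ?thesis using tensor_not_bilinear[OF comult_mem[OF nC]] by (simp add: tensor_sum_not_bilinear)
  qed
  moreover have "set ?xs \<subseteq> carrier C \<times> N" using set \<pi>(2) by auto
  ultimately show ?thesis by blast
qed

lemma left_coidealI:
  assumes "N \<subseteq> carrier C" "C.subspace N"
    and rep: "\<And>n. n \<in> N \<Longrightarrow> \<exists>xs. set xs \<subseteq> carrier C \<times> N \<and> comult C n = tensor_sum C C xs"
  shows "left_coideal N"
  unfolding left_coideal_def
proof (intro conjI ballI)
  fix n g assume n: "n \<in> N" and g: "g \<in> star"
  have nC: "n \<in> carrier C" using n assms(1) by auto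
  obtain xs where xs: "set xs \<subseteq> carrier C \<times> N" "comult C n = tensor_sum C C xs" using rep[OF n] by auto
  have "bilinear_map C C C (\<lambda>x y. scale C (g x) y)"
    using star_linear[OF g] by (auto simp: bilinear_map_def linear_map_def vspace_closed[OF vspace_C]
        C.scale_left_distrib C.scale_right_distrib mult.commute)
  then have "hit g n = (\<Sum>(x, y)\<leftarrow>xs. scale C (g x) y)"
    unfolding hit_def
    using tensor_universal[OF vspace_C _ sweedler(1)[OF nC], of "\<lambda>x y. scale C (g x) y" xs]
      xs assms(1) sweedler(2)[OF nC] by auto
  moreover have "(\<Sum>(x, y)\<leftarrow>ys. scale C (g x) y) \<in> N" if "set ys \<subseteq> carrier C \<times> N" for ys
    using that by (induction ys)
      (auto intro!: C.subspace_0 C.subspace_add C.subspace_scale assms(2))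
  ultimately show "hit g n \<in> N" using xs by simp
qed (use assms in auto)

definition simple_coideal :: "'c set \<Rightarrow> bool" where
  "simple_coideal N \<longleftrightarrow> left_coideal N \<and> N \<noteq> {0} \<and>
    (\<forall>K. left_coideal K \<and> K \<subseteq> N \<longrightarrow> K = {0} \<or> K = N)"

text \<open>The orbit of \<open>c\<close> is spanned by the finitely many right factors of \<open>\<Delta>(c)\<close>; a nonzero left coideal of
  least dimension inside it is simple.\<close>

lemma exists_simple_coideal:
  assumes c: "c \<in> carrier C" "c \<noteq> 0"
  shows "\<exists>N. simple_coideal N \<and> N \<subseteq> orbit c"
proof -
  let ?Y = "snd ` set (sweedler c)"
  let ?Q = "\<lambda>N B. left_coideal N \<and> N \<noteq> {0} \<and> N \<subseteq> orbit c \<and> B \<subseteq> N \<and> C.independent B \<and> N = C.span B"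
  have orbit: "orbit c \<subseteq> C.span ?Y"
  proof -
    have "(\<Sum>(x, y)\<leftarrow>zs. scale C (g x) y) \<in> C.span (snd ` set zs)" for g :: "'c \<Rightarrow> 'k" and zs
    proof (induction zs)
      case (Cons z zs)
      have "C.span (snd ` set zs) \<subseteq> C.span (snd ` set (z # zs))" by (intro C.span_mono) auto
      moreover have "scale C (g (fst z)) (snd z) \<in> C.span (snd ` set (z # zs))"
        by (intro C.span_scale C.span_base) simp
      ultimately show ?case using Cons C.span_add by (auto simp: case_prod_unfold)
    qed (simp add: C.span_zero)
    then show ?thesis by (auto simp: orbit_def hit_def)
  qed
  have fin: "finite B \<and> card B \<le> card ?Y" if "?Q N B" for N B
    using C.independent_span_bound[of ?Y B] that orbit by auto
  have basis: "\<exists>B. ?Q N B" if "left_coideal N" "N \<noteq> {0}" "N \<subseteq> orbit c" for N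
  proof -
    obtain B where B: "B \<subseteq> N" "C.independent B" "N \<subseteq> C.span B"
      using C.maximal_independent_subset by blast
    moreover have "C.span B \<subseteq> N"
      using B that by (intro C.span_minimal) (auto simp: left_coideal_def)
    ultimately show ?thesis using that by blast
  qed
  have "\<exists>k N B. ?Q N B \<and> card B = k"
  proof -
    have "c \<in> orbit c" unfolding orbit_def
      using hit_eps[OF c(1)] eps_star by (intro image_eqI[of _ _ eps]) auto
    then show ?thesis using basis[of "orbit c"] left_coideal_orbit[OF c(1)] c(2) by blast
  qed
  then obtain k where k: "\<exists>N B. ?Q N B \<and> card B = k"
    and least: "\<And>m. m < k \<Longrightarrow> \<not> (\<exists>N B. ?Q N B \<and> card B = m)"
    using exists_least_iff[of "\<lambda>k. \<exists>N B. ?Q N B \<and> card B = k"] by blast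
  then obtain N B where NB: "?Q N B" "card B = k" by blast
  have "K = {0} \<or> K = N" if K: "left_coideal K" "K \<subseteq> N" for K
  proof (rule ccontr)
    assume ne: "\<not> ?thesis"
    then obtain A where A: "?Q K A" using basis[of K] K NB by blast
    obtain n where n: "n \<in> N" "n \<notin> K" using ne K by blast
    then have "n \<notin> C.span A" using A by blast
    then have "C.independent (insert n A)" using A by (simp add: C.independent_insertI)
    moreover have "insert n A \<subseteq> C.span B" using n A NB K by blast
    ultimately have "card (insert n A) \<le> card B"
      using C.independent_span_bound[of B "insert n A"] fin NB by blast
    moreover have "n \<notin> A" using n A by blast
    ultimately have "card A < k" using NB(2) fin[OF A] by simp
    then show False using least A by blast
  qed
  then have "simple_coideal N" using NB by (auto simp: simple_coideal_def)
  then show ?thesis using NB by blast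
qed

end

section \<open>Separating points by rational functionals\<close>

text \<open>A dual basis, in the form of a list of pairs of vectors and coordinate functionals.\<close>

lemma finite_dim_coordinates:
  assumes E: "vspace E" and fin: "finite_dim E"
  shows "\<exists>bs. (\<forall>(b, \<phi>)\<in>set bs. b \<in> carrier E \<and> linear_map E ground \<phi>) \<and>
    (\<forall>v\<in>carrier E. v = (\<Sum>(b, \<phi>)\<leftarrow>bs. scale E (\<phi> v) b))"
proof -
  interpret E: vector_space "scale E" using E by (rule vspace_vector_space)
  obtain A where A: "finite A" "carrier E = E.span A" using fin by (auto simp: finite_dim_def)
  obtain B where B: "B \<subseteq> A" "E.independent B" "A \<subseteq> E.span B"
    using E.maximal_independent_subset by blast
  have span: "carrier E = E.span B"
    using A(2) B E.span_mono[OF B(1)] E.span_minimal[OF B(3) E.subspace_span] by auto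
  have "finite B" using A(1) B(1) finite_subset by auto
  then obtain l where l: "set l = B" "distinct l" using finite_distinct_list by blast
  let ?bs = "map (\<lambda>b. (b, \<lambda>v. E.representation B v b)) l"
  have "linear_map E ground (\<lambda>v. E.representation B v b)" for b
    using B(2) span by (simp add: linear_map_def E.representation_add E.representation_scale)
  moreover have "b \<in> carrier E" if "b \<in> B" for b using that span E.span_base by auto
  moreover have "v = (\<Sum>(b, \<phi>)\<leftarrow>?bs. scale E (\<phi> v) b)" if "v \<in> carrier E" for v
  proof -
    have "v = (\<Sum>b\<in>B. scale E (E.representation B v b) b)"
      using E.sum_representation_eq[OF B(2) _ \<open>finite B\<close> order_refl] that span by simp
    also have "\<dots> = (\<Sum>b\<leftarrow>l. scale E (E.representation B v b) b)"
      using l by (simp add: sum_list_distinct_conv_sum_set)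
    finally show ?thesis by (simp add: comp_def)
  qed
  ultimately show ?thesis using l(1) by (intro exI[of _ ?bs]) auto
qed

lemma sum_list_zeroI: "(\<And>x y. (x, y) \<in> set xs \<Longrightarrow> f x y = 0) \<Longrightarrow> (\<Sum>(x, y)\<leftarrow>xs. f x y) = 0"
  for f :: "'a \<Rightarrow> 'b \<Rightarrow> 'c::comm_monoid_add"
  by (induction xs) auto

lemma sum_list_map_concat: "sum_list (map f (concat xss)) = (\<Sum>xs\<leftarrow>xss. sum_list (map f xs))"
  by (induction xss) auto

context counital_coalgebra
begin

text \<open>Expand \<open>h c\<close> in a basis \<open>b\<close> of \<open>E\<close> with coordinates \<open>\<phi>\<^sub>b\<close>. As \<open>h\<close> is colinear, \<open>(g * (p \<circ> h))(c)\<close>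
  is the sum over \<open>b\<close> of \<open>\<phi>\<^sub>b(h c)\<close> times the sum of the \<open>g(x) p(w)\<close>, where \<open>x \<otimes> w\<close> runs through
  the coaction of \<open>b\<close>. The finitely many \<open>x\<close> and \<open>p(w) (\<phi>\<^sub>b \<circ> h)\<close> witness rationality.\<close>

lemma functional_through_finite_dim_rational:
  fixes E :: "('k, 'm::ab_group_add, ('k, 'c, 'm) tensor) comod"
  assumes E: "vspace E" and fin: "finite_dim E" and \<rho>: "linear_map E (tensor C E) (coact E)"
    and h: "linear_map C E h"
    and colinear: "\<And>c \<beta>. c \<in> carrier C \<Longrightarrow> bilinear_map C E ground \<beta> \<Longrightarrow>
      coact E (h c) \<beta> = comult C c (\<lambda>x y. \<beta> x (h y))"
    and p: "linear_map E ground p"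
  shows "(\<lambda>c. if c \<in> carrier C then p (h c) else 0) \<in> rat"
proof -
  let ?r = "\<lambda>q c. if c \<in> carrier C then q (h c) else 0"
  have r_star: "?r q \<in> star" if "linear_map E ground q" for q
    by (rule restrict_star[OF linear_map_comp[OF h that]])
  obtain bs where bs: "\<forall>(b, \<phi>)\<in>set bs. b \<in> carrier E \<and> linear_map E ground \<phi>"
    "\<And>v. v \<in> carrier E \<Longrightarrow> v = (\<Sum>(b, \<phi>)\<leftarrow>bs. scale E (\<phi> v) b)"
    using finite_dim_coordinates[OF E fin] by blast
  have "\<exists>xs. set xs \<subseteq> carrier C \<times> carrier E \<and> coact E b = tensor_sum C E xs"
    if "b \<in> carrier E" for b
    using linear_map_mem[OF \<rho> that] tensor_carrierE by metis
  then obtain T where T: "\<And>b. b \<in> carrier E \<Longrightarrow> set (T b) \<subseteq> carrier C \<times> carrier E"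
    "\<And>b. b \<in> carrier E \<Longrightarrow> coact E b = tensor_sum C E (T b)"
    by metis
  \<comment> \<open>one entry for each basis vector \<open>b\<close> and each term \<open>x \<otimes> w\<close> of its coaction\<close>
  let ?xs = "concat (map (\<lambda>(b, \<phi>). map (\<lambda>(x, w). (x, fscale (p w) (?r \<phi>))) (T b)) bs)"
  have mem: "set ?xs \<subseteq> carrier C \<times> star"
    using bs(1) T(1) fscale.subspace_scale[OF subspace_star r_star] by fastforce
  have "convolution C g (?r p) = (\<Sum>(c, n)\<leftarrow>?xs. fscale (g c) n)" if g: "g \<in> star" for g
  proof
    fix c
    show "convolution C g (?r p) c = (\<Sum>(c, n)\<leftarrow>?xs. fscale (g c) n) c"
    proof (cases "c \<in> carrier C")
      case True
      have hc: "h c \<in> carrier E" by (rule linear_map_mem[OF h True])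
      let ?\<beta> = "\<lambda>x w. g x * p w"
      have \<beta>: "bilinear_map C E ground ?\<beta>" by (rule bilinear_product[OF star_linear[OF g] p])
      have \<theta>: "linear_map E ground (\<lambda>v. coact E v ?\<beta>)"
        using \<rho> by (auto simp: linear_map_def fscale_apply)
      have "convolution C g (?r p) c = coact E (h c) ?\<beta>"
        unfolding convolution_eq[OF True] colinear[OF True \<beta>]
        by (rule tensor_cong[OF comult_mem[OF True] vspace_C vspace_C]) simp
      also have "\<dots> = coact E (\<Sum>(b, \<phi>)\<leftarrow>bs. scale E (\<phi> (h c)) b) ?\<beta>"
        using bs(2)[OF hc] by simp
      also have "\<dots> = (\<Sum>(b, \<phi>)\<leftarrow>bs. coact E (scale E (\<phi> (h c)) b) ?\<beta>)"
        using bs(1) by (intro linear_map_sum_list[OF \<theta> E]) (auto intro: vspace_scale[OF E])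
      also have "\<dots> = (\<Sum>(b, \<phi>)\<leftarrow>bs. (\<Sum>(x, w)\<leftarrow>T b. fscale (g x) (fscale (p w) (?r \<phi>)) c))"
      proof (intro arg_cong[where f = sum_list] map_cong refl, clarify)
        fix b \<phi> assume "(b, \<phi>) \<in> set bs"
        then have b: "b \<in> carrier E" using bs(1) by auto
        have "coact E (scale E (\<phi> (h c)) b) ?\<beta> = \<phi> (h c) * (\<Sum>(x, w)\<leftarrow>T b. ?\<beta> x w)"
          using linear_map_scale[OF \<theta> b] T(2)[OF b] by (simp add: tensor_sum_apply[OF \<beta>])
        also have "\<dots> = (\<Sum>(x, w)\<leftarrow>T b. fscale (g x) (fscale (p w) (?r \<phi>)) c)"
          using True by (simp add: fscale_apply sum_list_const_mult[symmetric] case_prod_unfold ac_simps)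
        finally show "coact E (scale E (\<phi> (h c)) b) ?\<beta> =
            (\<Sum>(x, w)\<leftarrow>T b. fscale (g x) (fscale (p w) (?r \<phi>)) c)" .
      qed
      also have "\<dots> = (\<Sum>(c, n)\<leftarrow>?xs. fscale (g c) n) c"
        by (simp add: sum_list_fun_apply sum_list_map_concat comp_def case_prod_unfold)
      finally show ?thesis .
    next
      case False
      have "(\<Sum>(x, n)\<leftarrow>?xs. fscale (g x) n c) = 0"
      proof (rule sum_list_zeroI)
        fix x n assume "(x, n) \<in> set ?xs"
        then have "n \<in> star" using mem by blast
        then have "n c = 0" using False by (simp add: star_iff)
        then show "fscale (g x) n c = 0" by (simp add: fscale_apply)
      qed
      then show ?thesis using False by (simp add: convolution_def sum_list_fun_apply case_prod_unfold)
    qed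
  qed
  then show ?thesis unfolding rat_iff using r_star[OF p] mem by blast
qed

end

text \<open>Semiperfectness speaks of comodules with underlying group in a given type, so \<open>C\<close> and its left coideals
  have to be copied into that type along a linear injection \<open>j\<close>.\<close>

locale embedded_coalgebra = counital_coalgebra C
  for C :: "('k::field, 'c::ab_group_add) coalg" +
  fixes V :: "('k, 'm::ab_group_add) vspc" and j :: "'c \<Rightarrow> 'm"
  assumes vspace_V: "vspace V" and j_linear: "linear_map C V j" and j_inj: "inj_on j (carrier C)"
begin

definition projection :: "'c set \<Rightarrow> 'c \<Rightarrow> 'c" where
  "projection N = (SOME \<pi>. Vector_Spaces.linear (scale C) (scale C) \<pi> \<and> (\<forall>x. \<pi> x \<in> N) \<and>
    (\<forall>x\<in>N. \<pi> x = x))"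

lemma projection:
  assumes "C.subspace N"
  shows "Vector_Spaces.linear (scale C) (scale C) (projection N)"
    and "projection N x \<in> N" and "x \<in> N \<Longrightarrow> projection N x = x"
proof -
  have "\<exists>\<pi>. Vector_Spaces.linear (scale C) (scale C) \<pi> \<and> (\<forall>x. \<pi> x \<in> N) \<and> (\<forall>x\<in>N. \<pi> x = x)"
    using subspace_projection[OF C.vector_space_axioms assms] by metis
  from someI_ex[OF this] show "Vector_Spaces.linear (scale C) (scale C) (projection N)"
    "projection N x \<in> N" "x \<in> N \<Longrightarrow> projection N x = x"
    unfolding projection_def by auto
qed

text \<open>The left coideal \<open>N\<close>, moved along \<open>j\<close>. Its coaction must be a functional on forms that are bilinear
  only on \<open>C\<close> and \<open>j ` N\<close>; precomposing with a linear projection of \<open>C\<close> onto \<open>N\<close> turns such a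
  form into one on \<open>C\<close> and \<open>C\<close>, without a choice of representatives.\<close>

definition copy :: "'c set \<Rightarrow> ('k, 'm, ('k, 'c, 'm) tensor) comod" where
  "copy N = \<lparr>carrier = j ` N, scale = scale V,
    coact = (\<lambda>m \<beta>. if bilinear_map C \<lparr>carrier = j ` N, scale = scale V\<rparr> ground \<beta>
      then comult C (inv_into N j m) (\<lambda>x y. \<beta> x (j (projection N y))) else 0)\<rparr>"

lemma carrier_copy [simp]: "carrier (copy N) = j ` N" and scale_copy [simp]: "scale (copy N) = scale V"
  by (simp_all add: copy_def)

lemma coact_copy_apply:
  "coact (copy N) m \<beta> = (if bilinear_map C (copy N) ground \<beta>
    then comult C (inv_into N j m) (\<lambda>x y. \<beta> x (j (projection N y))) else 0)"
  by (simp add: copy_def bilinear_map_def linear_map_def)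

context
  fixes N assumes N: "left_coideal N"
begin

lemma sub_N: "N \<subseteq> carrier C" and subspace_N: "C.subspace N"
  using N by (auto simp: left_coideal_def)

lemma inj_N: "inj_on j N"
  using j_inj sub_N by (rule inj_on_subset)

lemma j_add: "x \<in> N \<Longrightarrow> y \<in> N \<Longrightarrow> j (x + y) = j x + j y"
  and j_scale: "x \<in> N \<Longrightarrow> j (scale C a x) = scale V a (j x)"
  using linear_map_add[OF j_linear] linear_map_scale[OF j_linear] sub_N by (simp_all add: subset_iff)

lemma j_projection_linear: "linear_map C (copy N) (\<lambda>w. j (projection N w))"
proof -
  interpret \<pi>: Vector_Spaces.linear "scale C" "scale C" "projection N"
    by (rule projection(1)[OF subspace_N])
  have "projection N y \<in> N" for y by (rule projection(2)[OF subspace_N])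
  then show ?thesis by (simp add: linear_map_def \<pi>.add \<pi>.scale j_add j_scale)
qed

lemma bilinear_pullback:
  assumes \<beta>: "bilinear_map C (copy N) ground \<beta>"
  shows "bilinear_map C C ground (\<lambda>x y. \<beta> x (j (projection N y)))"
proof -
  show ?thesis by (rule bilinear_map_pullback[OF \<beta> linear_map_ident j_projection_linear])
qed

lemma coact_copy:
  assumes n: "n \<in> N" and xs: "set xs \<subseteq> carrier C \<times> N" "comult C n = tensor_sum C C xs"
  shows "coact (copy N) (j n) = tensor_sum C (copy N) (map (\<lambda>(x, y). (x, j y)) xs)"
proof
  fix \<beta>
  show "coact (copy N) (j n) \<beta> = tensor_sum C (copy N) (map (\<lambda>(x, y). (x, j y)) xs) \<beta>"
  proof (cases "bilinear_map C (copy N) ground \<beta>")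
    case True
    then have "coact (copy N) (j n) \<beta> = comult C n (\<lambda>x y. \<beta> x (j (projection N y)))"
      by (simp add: coact_copy_apply inv_into_f_f[OF inj_N n])
    also have "\<dots> = (\<Sum>(x, y)\<leftarrow>xs. \<beta> x (j (projection N y)))"
      by (simp add: xs(2) tensor_sum_apply[OF bilinear_pullback[OF True]])
    also have "\<dots> = (\<Sum>(x, y)\<leftarrow>xs. \<beta> x (j y))"
      using xs(1) projection(3)[OF subspace_N]
      by (intro arg_cong[where f = sum_list] map_cong) auto
    finally show ?thesis by (simp add: tensor_sum_apply[OF True] comp_def case_prod_unfold)
  next
    case False
    then show ?thesis by (simp add: tensor_sum_not_bilinear coact_copy_apply)
  qed
qed

lemma coact_copyE:
  assumes "n \<in> N"
  obtains xs where "set xs \<subseteq> carrier C \<times> N" "comult C n = tensor_sum C C xs"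
    "coact (copy N) (j n) = tensor_sum C (copy N) (map (\<lambda>(x, y). (x, j y)) xs)"
    "\<And>\<beta>. bilinear_map C (copy N) ground \<beta> \<Longrightarrow> coact (copy N) (j n) \<beta> = (\<Sum>(x, y)\<leftarrow>xs. \<beta> x (j y))"
proof -
  obtain xs where xs: "set xs \<subseteq> carrier C \<times> N" "comult C n = tensor_sum C C xs"
    using left_coideal_comult[OF N assms] by blast
  show thesis
    using that[OF xs coact_copy[OF assms xs]]
    by (simp add: coact_copy[OF assms xs] tensor_sum_apply comp_def case_prod_unfold)
qed

lemma vspace_copy: "vspace (copy N)"
proof -
  interpret V: vector_space "scale V" by (rule vspace_vector_space[OF vspace_V])
  have "V.subspace (j ` N)"
  proof (rule V.subspaceI)
    show "0 \<in> j ` N"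
      using linear_map_zero[OF j_linear vspace_C] C.subspace_0[OF subspace_N] by (metis imageI)
  next
    fix x y assume "x \<in> j ` N" "y \<in> j ` N"
    then show "x + y \<in> j ` N"
      using linear_map_add[OF j_linear] sub_N C.subspace_add[OF subspace_N]
      by (auto simp: subset_iff image_iff) metis
  next
    fix a x assume "x \<in> j ` N"
    then show "scale V a x \<in> j ` N"
      using linear_map_scale[OF j_linear] sub_N C.subspace_scale[OF subspace_N]
      by (auto simp: subset_iff image_iff) metis
  qed
  then show ?thesis by (simp add: vspace_def V.vector_space_axioms)
qed

lemma left_comodule_copy: "left_comodule C (copy N)"
  unfolding left_comodule_def
proof (intro conjI ballI)
  show "vspace (copy N)" by (rule vspace_copy)
  show coact_linear: "linear_map (copy N) (tensor C (copy N)) (coact (copy N))"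
    unfolding linear_map_def
  proof (intro conjI ballI allI)
    fix m assume "m \<in> carrier (copy N)"
    then obtain n where n: "m = j n" "n \<in> N" by auto
    obtain xs where xs: "set xs \<subseteq> carrier C \<times> N"
      "coact (copy N) m = tensor_sum C (copy N) (map (\<lambda>(x, y). (x, j y)) xs)"
      using coact_copyE[OF n(2)] n(1) by metis
    then show "coact (copy N) m \<in> carrier (tensor C (copy N))"
      using xs(1) unfolding xs(2) by (intro tensor_carrierI) auto
  next
    fix m m' assume "m \<in> carrier (copy N)" "m' \<in> carrier (copy N)"
    then obtain n n' where n: "m = j n" "n \<in> N" "m' = j n'" "n' \<in> N" by auto
    have sum: "m + m' = j (n + n')" "n + n' \<in> N"
      using n(1,3) j_add[OF n(2,4)] C.subspace_add[OF subspace_N n(2,4)] by simp_all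
    have "comult C (n + n') = comult C n + comult C n'"
      using n sub_N linear_map_add[OF comult_linear] by blast
    then show "coact (copy N) (m + m') = coact (copy N) m + coact (copy N) m'"
      unfolding sum(1) unfolding n(1,3)
      by (intro ext) (simp add: coact_copy_apply inv_into_f_f[OF inj_N] sum(2) n(2,4))
  next
    fix a m assume "m \<in> carrier (copy N)"
    then obtain n where n: "m = j n" "n \<in> N" by auto
    have scaled: "scale V a m = j (scale C a n)" "scale C a n \<in> N"
      using n(1) j_scale[OF n(2)] C.subspace_scale[OF subspace_N n(2)] by simp_all
    have "comult C (scale C a n) = fscale a (comult C n)"
      using n sub_N linear_map_scale[OF comult_linear, of n a] by auto
    then show "coact (copy N) (scale (copy N) a m) = scale (tensor C (copy N)) a (coact (copy N) m)"
      unfolding scale_copy scale_tensor scaled(1) unfolding n(1)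
      by (intro ext) (simp add: coact_copy_apply inv_into_f_f[OF inj_N] scaled(2) n(2) fscale_apply)
  qed
  fix m assume "m \<in> carrier (copy N)"
  then obtain n where n: "m = j n" "n \<in> N" by auto
  have nC: "n \<in> carrier C" using n sub_N by auto
  obtain xs where xs: "set xs \<subseteq> carrier C \<times> N" "comult C n = tensor_sum C C xs"
    and co: "coact (copy N) m = tensor_sum C (copy N) (map (\<lambda>(x, y). (x, j y)) xs)"
    "\<And>\<beta>. bilinear_map C (copy N) ground \<beta> \<Longrightarrow> coact (copy N) m \<beta> = (\<Sum>(x, y)\<leftarrow>xs. \<beta> x (j y))"
    using coact_copyE[OF n(2)] n(1) by metis
  show "expand_left C C (copy N) (comult C) (coact (copy N) m) =
      expand_right C C (copy N) (coact (copy N)) (coact (copy N) m)"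
  proof
    fix \<tau>
    show "expand_left C C (copy N) (comult C) (coact (copy N) m) \<tau> =
      expand_right C C (copy N) (coact (copy N)) (coact (copy N) m) \<tau>"
    proof (cases "trilinear_form C C (copy N) \<tau>")
      case \<tau>: True
      let ?\<tau> = "\<lambda>u v w. \<tau> u v (j (projection N w))"
      have \<pi>: "projection N y = y" if "y \<in> N" for y
        using projection(3)[OF subspace_N that] .
      have \<tau>': "trilinear_form C C C ?\<tau>"
        by (rule trilinear_form_pullback[OF \<tau> linear_map_ident linear_map_ident j_projection_linear])
      have "expand_left C C (copy N) (comult C) (coact (copy N) m) \<tau> =
          (\<Sum>(x, y)\<leftarrow>xs. comult C x (\<lambda>u v. \<tau> u v (j y)))"
        using \<tau> co(2)[OF trilinear_expand_left[OF \<tau> comult_linear vspace_copy]]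
        by (simp add: expand_left_def)
      also have "\<dots> = (\<Sum>(x, y)\<leftarrow>xs. comult C x (\<lambda>u v. ?\<tau> u v y))"
        using xs(1) \<pi> by (intro arg_cong[where f = sum_list] map_cong) auto
      also have "\<dots> = expand_left C C C (comult C) (comult C n) ?\<tau>"
        using \<tau>' tensor_sum_apply[OF trilinear_expand_left[OF \<tau>' comult_linear vspace_C]] xs(2)
        by (simp add: expand_left_def)
      also have "\<dots> = expand_right C C C (comult C) (comult C n) ?\<tau>"
        using coalgebra nC by (simp add: coalgebra_def)
      also have "\<dots> = (\<Sum>(x, y)\<leftarrow>xs. comult C y (\<lambda>v w. ?\<tau> x v w))"
        using \<tau>' tensor_sum_apply[OF trilinear_expand_right[OF \<tau>' comult_linear vspace_C]] xs(2)
        by (simp add: expand_right_def)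
      also have "\<dots> = (\<Sum>(x, y)\<leftarrow>xs. coact (copy N) (j y) (\<lambda>v w. \<tau> x v w))"
      proof (intro arg_cong[where f = sum_list] map_cong refl, clarify)
        fix x y assume "(x, y) \<in> set xs"
        then have xy: "x \<in> carrier C" "y \<in> N" using xs(1) by auto
        then have "bilinear_map C (copy N) ground (\<tau> x)" using \<tau> by (simp add: trilinear_form_def)
        then show "comult C y (\<lambda>v w. ?\<tau> x v w) = coact (copy N) (j y) (\<tau> x)"
          by (simp add: coact_copy_apply inv_into_f_f[OF inj_N xy(2)])
      qed
      also have "\<dots> = expand_right C C (copy N) (coact (copy N)) (coact (copy N) m) \<tau>"
        using \<tau> co(2)[OF trilinear_expand_right[OF \<tau> coact_linear vspace_C]]
        by (simp add: expand_right_def)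
      finally show ?thesis .
    qed (simp add: expand_left_def expand_right_def)
  qed
  have "bilinear_map C C C (\<lambda>x y. scale C (counit C x) y)"
    using counit_linear by (auto simp: bilinear_map_def linear_map_def vspace_closed[OF vspace_C]
        C.scale_left_distrib C.scale_right_distrib mult.commute)
  moreover have "set xs \<subseteq> carrier C \<times> carrier C" using xs(1) sub_N by auto
  ultimately have n_eq: "n = (\<Sum>(x, y)\<leftarrow>xs. scale C (counit C x) y)"
    using tensor_universal[OF vspace_C _ sweedler(1)[OF nC], of "\<lambda>x y. scale C (counit C x) y" xs]
      sweedler(2,3)[OF nC] xs(2) by auto
  have "j (\<Sum>(x, y)\<leftarrow>xs. scale C (counit C x) y) = (\<Sum>(x, y)\<leftarrow>xs. j (scale C (counit C x) y))"
    using xs(1) sub_N by (intro linear_map_sum_list[OF j_linear vspace_C])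
      (auto intro!: vspace_scale[OF vspace_C])
  also have "\<dots> = (\<Sum>(x, y)\<leftarrow>xs. scale V (counit C x) (j y))"
    using xs(1) sub_N linear_map_scale[OF j_linear]
    by (intro arg_cong[where f = sum_list] map_cong) auto
  finally have "(\<Sum>(c, y)\<leftarrow>map (\<lambda>(x, y). (x, j y)) xs. scale (copy N) (counit C c) y) = m"
    using n_eq n(1) by (simp add: comp_def case_prod_unfold)
  then show "\<exists>ys. set ys \<subseteq> carrier C \<times> carrier (copy N) \<and> coact (copy N) m = tensor_sum C (copy N) ys \<and>
      (\<Sum>(c, y)\<leftarrow>ys. scale (copy N) (counit C c) y) = m"
    using co(1) xs(1) by (intro exI[of _ "map (\<lambda>(x, y). (x, j y)) xs"]) auto
qed

lemma simple_copy:
  assumes simple: "\<And>K. left_coideal K \<Longrightarrow> K \<subseteq> N \<Longrightarrow> K = {0} \<or> K = N" and ne: "N \<noteq> {0}"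
  shows "simple_object (left_subcomodule C) (copy N)"
  unfolding simple_object_def
proof (intro conjI allI impI)
  have 0: "0 \<in> N" "j 0 = 0"
    using C.subspace_0[OF subspace_N] linear_map_zero[OF j_linear vspace_C] by auto
  obtain n where "n \<in> N" "n \<noteq> 0" using ne 0 by auto
  then have "j n \<noteq> 0" using inj_N 0 by (metis inj_onD)
  then show "carrier (copy N) \<noteq> {0}" using \<open>n \<in> N\<close> by auto
  fix K assume K: "left_subcomodule C (copy N) K"
  \<comment> \<open>pull the subcomodule \<open>K\<close> back to a left coideal inside \<open>N\<close>\<close>
  define L where "L = {n \<in> N. j n \<in> K}"
  have KL: "K = j ` L" using K by (auto simp: left_subcomodule_def L_def)
  interpret V: vector_space "scale V" by (rule vspace_vector_space[OF vspace_V])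
  have subK: "V.subspace K" using K by (simp add: left_subcomodule_def)
  have "left_coideal L"
  proof (rule left_coidealI)
    show "L \<subseteq> carrier C" using sub_N by (auto simp: L_def)
    show "C.subspace L"
    proof (rule C.subspaceI)
      show "0 \<in> L" using 0 V.subspace_0[OF subK] by (simp add: L_def)
      show "x + y \<in> L" if "x \<in> L" "y \<in> L" for x y
        using that by (simp add: L_def j_add C.subspace_add[OF subspace_N] V.subspace_add[OF subK])
      show "scale C a x \<in> L" if "x \<in> L" for a x
        using that by (simp add: L_def j_scale C.subspace_scale[OF subspace_N] V.subspace_scale[OF subK])
    qed
    fix n assume "n \<in> L"
    then have n: "n \<in> N" "j n \<in> K" "n \<in> carrier C" using sub_N by (auto simp: L_def)
    obtain ys where ys: "set ys \<subseteq> carrier C \<times> K" "coact (copy N) (j n) = tensor_sum C (copy N) ys"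
      using K n by (auto simp: left_subcomodule_def)
    obtain xs where xs: "set xs \<subseteq> carrier C \<times> N" "comult C n = tensor_sum C C xs"
      and co: "\<And>\<beta>. bilinear_map C (copy N) ground \<beta> \<Longrightarrow>
        coact (copy N) (j n) \<beta> = (\<Sum>(x, y)\<leftarrow>xs. \<beta> x (j y))"
      using coact_copyE[OF n(1)] by metis
    let ?zs = "map (\<lambda>(x, k). (x, inv_into N j k)) ys"
    have "tensor_sum C C xs \<beta> = tensor_sum C C ?zs \<beta>" for \<beta>
    proof (cases "bilinear_map C C ground \<beta>")
      case True
      have inv: "inv_into N j (j y) = y" if "y \<in> N" for y
        using inv_into_f_f[OF inj_N that] .
      have lin: "linear_map (copy N) C (inv_into N j)"
        unfolding linear_map_def
      proof (intro conjI ballI allI)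
        fix v w assume "v \<in> carrier (copy N)" "w \<in> carrier (copy N)"
        then obtain x y where xy: "v = j x" "x \<in> N" "w = j y" "y \<in> N" by auto
        have "v + w = j (x + y)" "x + y \<in> N"
          using xy(1,3) j_add[OF xy(2,4)] C.subspace_add[OF subspace_N xy(2,4)] by simp_all
        then show "inv_into N j (v + w) = inv_into N j v + inv_into N j w"
          using xy inv by simp
      next
        fix v a assume "v \<in> carrier (copy N)"
        then obtain x where xy: "v = j x" "x \<in> N" by auto
        have "scale V a v = j (scale C a x)" "scale C a x \<in> N"
          using xy(1) j_scale[OF xy(2)] C.subspace_scale[OF subspace_N xy(2)] by simp_all
        then show "inv_into N j (scale (copy N) a v) = scale C a (inv_into N j v)"
          using xy inv by simp
      qed (use inv sub_N in auto)
      have "bilinear_map C (copy N) ground (\<lambda>x k. \<beta> x (inv_into N j k))"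
        using True lin by (simp add: bilinear_map_def linear_map_def)
      from co[OF this] tensor_sum_apply[OF this, of ys] ys(2)
      have "(\<Sum>(x, y)\<leftarrow>xs. \<beta> x (inv_into N j (j y))) = (\<Sum>(x, k)\<leftarrow>ys. \<beta> x (inv_into N j k))"
        by simp
      moreover have "(\<Sum>(x, y)\<leftarrow>xs. \<beta> x (inv_into N j (j y))) = (\<Sum>(x, y)\<leftarrow>xs. \<beta> x y)"
      proof (intro arg_cong[where f = sum_list] map_cong refl, clarify)
        fix x y assume "(x, y) \<in> set xs"
        then have "y \<in> N" using xs(1) by blast
        then show "\<beta> x (inv_into N j (j y)) = \<beta> x y" by (simp only: inv)
      qed
      ultimately show ?thesis by (simp add: tensor_sum_apply[OF True] comp_def case_prod_unfold)
    qed (simp add: tensor_sum_not_bilinear)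
    then have "comult C n = tensor_sum C C ?zs" unfolding xs(2) by (rule ext)
    moreover have "set ?zs \<subseteq> carrier C \<times> L"
    proof -
      have "inv_into N j k \<in> L" if k: "k \<in> K" for k
      proof -
        obtain l where "l \<in> L" "k = j l" using k unfolding KL by blast
        then show ?thesis using inv_into_f_f[OF inj_N, of l] by (simp add: L_def)
      qed
      then show ?thesis using ys(1) by auto
    qed
    ultimately show "\<exists>xs. set xs \<subseteq> carrier C \<times> L \<and> comult C n = tensor_sum C C xs" by blast
  qed
  then have "L = {0} \<or> L = N" using simple[of L] by (auto simp: L_def)
  then show "K = {0} \<or> K = carrier (copy N)" using KL 0 by auto
qed

end

lemma inclusion_hom:
  assumes N: "left_coideal N"
  shows "left_comodule_hom C (copy N) (copy (carrier C)) id"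
  unfolding left_comodule_hom_def
proof (intro conjI ballI)
  show "linear_map (copy N) (copy (carrier C)) id" using sub_N[OF N] by (auto simp: linear_map_def)
  fix m assume "m \<in> carrier (copy N)"
  then obtain n where n: "m = j n" "n \<in> N" by auto
  obtain xs where xs: "set xs \<subseteq> carrier C \<times> N" "comult C n = tensor_sum C C xs"
    and co: "coact (copy N) m = tensor_sum C (copy N) (map (\<lambda>(x, y). (x, j y)) xs)"
    using coact_copyE[OF N n(2)] n(1) by metis
  have xsC: "set xs \<subseteq> carrier C \<times> carrier C" using xs(1) sub_N[OF N] by auto
  have coC: "coact (copy (carrier C)) m = tensor_sum C (copy (carrier C)) (map (\<lambda>(x, y). (x, j y)) xs)"
    unfolding n(1) using coact_copy[OF left_coideal_carrier _ xsC xs(2)] n(2) sub_N[OF N] by auto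
  show "coact (copy (carrier C)) (id m) = tensor_map C (copy (carrier C)) id id (coact (copy N) m)"
  proof
    fix \<beta>
    show "coact (copy (carrier C)) (id m) \<beta> =
        tensor_map C (copy (carrier C)) id id (coact (copy N) m) \<beta>"
    proof (cases "bilinear_map C (copy (carrier C)) ground \<beta>")
      case True
      moreover have "bilinear_map C (copy N) ground \<beta>"
        using True sub_N[OF N] by (auto simp: bilinear_map_def linear_map_def subset_iff)
      ultimately show ?thesis unfolding coC co id_apply
        by (simp add: tensor_map_def tensor_sum_apply)
    qed (simp add: tensor_map_def coact_copy_apply)
  qed
qed

lemma copy_hom_comult:
  fixes E :: "('k, 'm, ('k, 'c, 'm) tensor) comod"
  assumes g: "left_comodule_hom C (copy (carrier C)) E g"
    and c: "c \<in> carrier C" and \<beta>: "bilinear_map C E ground \<beta>"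
  shows "coact E (g (j c)) \<beta> = comult C c (\<lambda>x y. \<beta> x (g (j y)))"
proof -
  have lin: "linear_map (copy (carrier C)) E g" using g by (simp add: left_comodule_hom_def)
  obtain xs where xs: "set xs \<subseteq> carrier C \<times> carrier C" "comult C c = tensor_sum C C xs"
    and co: "\<And>\<gamma>. bilinear_map C (copy (carrier C)) ground \<gamma> \<Longrightarrow>
      coact (copy (carrier C)) (j c) \<gamma> = (\<Sum>(x, y)\<leftarrow>xs. \<gamma> x (j y))"
    using coact_copyE[OF left_coideal_carrier c] by metis
  have b: "bilinear_map C (copy (carrier C)) ground (\<lambda>x m. \<beta> x (g m))"
    using \<beta> lin by (simp add: bilinear_map_def linear_map_def)
  moreover have "linear_map C E (\<lambda>y. g (j y))"
    using lin j_linear by (simp add: linear_map_def)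
  then have b': "bilinear_map C C ground (\<lambda>x y. \<beta> x (g (j y)))"
    using \<beta> by (simp add: bilinear_map_def linear_map_def)
  have "coact E (g (j c)) \<beta> = coact (copy (carrier C)) (j c) (\<lambda>x m. \<beta> x (g m))"
    using g c \<beta> by (simp add: left_comodule_hom_def tensor_map_def)
  then show ?thesis using co[OF b] xs(2) by (simp add: tensor_sum_apply[OF b'])
qed

text \<open>The only place where an injective hull is used: the embedding of the copy of a simple left coideal \<open>N\<close>
  into its hull \<open>E\<close> extends along the inclusion of \<open>N\<close> into \<open>C\<close>.\<close>

lemma rat_separates:
  assumes semi: "right_semiperfect TYPE('m) C" and c: "c \<in> carrier C" "c \<noteq> 0"
  shows "\<exists>f\<in>rat. f c \<noteq> 0"
proof -
  obtain N where simple: "simple_coideal N" and orb: "N \<subseteq> orbit c"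
    using exists_simple_coideal[OF c] by blast
  have N: "left_coideal N" "N \<noteq> {0}" using simple by (auto simp: simple_coideal_def)
  have sub: "N \<subseteq> carrier C" "C.subspace N" using N by (auto simp: left_coideal_def)
  have "simple_object (left_subcomodule C) (copy N)"
    using simple by (intro simple_copy[OF N(1)]) (auto simp: simple_coideal_def)
  then obtain E i where
    hull: "injective_hull (left_comodule C) (left_comodule_hom C) (left_subcomodule C) (copy N) E i"
    and fin: "finite_dim E"
    using semi left_comodule_copy[OF N(1)] unfolding right_semiperfect_def by blast
  have E: "left_comodule C E" "left_comodule_hom C (copy N) E i" "inj_on i (carrier (copy N))"
    and inj: "\<And>X Y u f. left_comodule C X \<and> left_comodule C Y \<and> left_comodule_hom C X Y u \<and>
      inj_on u (carrier X) \<and> left_comodule_hom C X E f \<Longrightarrow>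
      \<exists>g. left_comodule_hom C Y E g \<and> (\<forall>x\<in>carrier X. g (u x) = f x)"
    using hull unfolding injective_hull_def injective_object_def by auto
  obtain g where g: "left_comodule_hom C (copy (carrier C)) E g" "\<And>m. m \<in> j ` N \<Longrightarrow> g m = i m"
    using inj[of "copy N" "copy (carrier C)" id i] E(2) left_comodule_copy[OF N(1)]
      left_comodule_copy[OF left_coideal_carrier] inclusion_hom[OF N(1)] by auto
  have vE: "vspace E" and \<rho>: "linear_map E (tensor C E) (coact E)"
    using E(1) by (auto simp: left_comodule_def)
  interpret E: vector_space "scale E" by (rule vspace_vector_space[OF vE])
  have i: "linear_map (copy N) E i" using E(2) by (simp add: left_comodule_hom_def)
  have h: "linear_map C E (\<lambda>c. g (j c))"
    using g(1) j_linear by (simp add: left_comodule_hom_def linear_map_def)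
  obtain n where n: "n \<in> N" "n \<noteq> 0" using N(2) C.subspace_0[OF sub(2)] by blast
  have "i (j n) \<noteq> 0"
  proof
    assume "i (j n) = 0"
    moreover have "i (j 0) = 0" "j 0 = 0"
      using linear_map_zero[OF j_linear vspace_C] linear_map_zero[OF i vspace_copy[OF N(1)]] by auto
    moreover have "0 \<in> N" using C.subspace_0[OF sub(2)] .
    ultimately have "j n = j 0" using E(3) n(1) unfolding carrier_copy by (metis imageI inj_onD)
    then show False using inj_N[OF N(1)] n \<open>0 \<in> N\<close> by (metis inj_onD)
  qed
  then have "g (j n) \<noteq> 0" using g(2) n(1) by simp
  then obtain p where p: "Vector_Spaces.linear (scale E) (*) p" "p (g (j n)) \<noteq> 0"
    using separating_functional[OF E.vector_space_axioms] by blast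
  interpret p: Vector_Spaces.linear "scale E" "(*)" p by (rule p(1))
  have "linear_map E ground p" by (simp add: linear_map_def p.add p.scale)
  let ?f = "\<lambda>c. if c \<in> carrier C then p (g (j c)) else 0"
  have f: "?f \<in> rat"
    using copy_hom_comult[OF g(1)] \<open>linear_map E ground p\<close>
    by (rule functional_through_finite_dim_rational[OF vE fin \<rho> h])
  have "?f n \<noteq> 0" using p(2) n(1) sub(1) by auto
  obtain u where u: "u \<in> star" "n = hit u c" using orb n(1) by (auto simp: orbit_def)
  have "convolution C u ?f c \<noteq> 0"
    unfolding apply_hit[OF c(1) u(1) rat_star[OF f], symmetric] u(2)[symmetric] by fact
  then show ?thesis using rat_left_ideal[OF u(1) f] by blast
qed

end

section \<open>The co-opposite coalgebra\<close>

definition flip :: "('k::field, 'a, 'b) tensor \<Rightarrow> ('k, 'b, 'a) tensor" where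
  "flip t = (\<lambda>\<beta>. t (\<lambda>x y. \<beta> y x))"

text \<open>Reversing the tensor factors turns right comodules into left ones, so everything about the right
  rational part is the preceding theory applied to the co-opposite coalgebra.\<close>

definition cop :: "('k::field, 'c::ab_group_add) coalg \<Rightarrow> ('k, 'c) coalg" where
  "cop C = C\<lparr>comult := \<lambda>c. flip (comult C c)\<rparr>"

definition flip_comod ::
  "('k::field, 'm, ('k, 'a, 'b) tensor) comod \<Rightarrow> ('k, 'm, ('k, 'b, 'a) tensor) comod" where
  "flip_comod M = \<lparr>carrier = carrier M, scale = scale M, coact = \<lambda>m. flip (coact M m)\<rparr>"

lemma flip_flip [simp]: "flip (flip t) = t"
  by (simp add: flip_def)

lemma flip_eq_iff: "flip s = flip t \<longleftrightarrow> s = t"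
  by (metis flip_flip)

lemma flip_add: "flip (s + t) = flip s + flip t"
  by (simp add: flip_def fun_eq_iff)

lemma flip_fscale: "flip (fscale a t) = fscale a (flip t)"
  by (simp add: flip_def fscale_def)

lemma cop_simps [simp]:
  "carrier (cop C) = carrier C" "scale (cop C) = scale C" "counit (cop C) = counit C"
  "comult (cop C) = (\<lambda>c. flip (comult C c))"
  by (simp_all add: cop_def)

lemma flip_comod_simps [simp]:
  "carrier (flip_comod M) = carrier M" "scale (flip_comod M) = scale M"
  "coact (flip_comod M) = (\<lambda>m. flip (coact M m))"
  by (simp_all add: flip_comod_def)

lemma flip_comod_flip_comod [simp]: "flip_comod (flip_comod M) = M"
  by (simp add: flip_comod_def)

lemma linear_map_eqI:
  "carrier V = carrier V' \<Longrightarrow> scale V = scale V' \<Longrightarrow> carrier W = carrier W' \<Longrightarrow> scale W = scale W' \<Longrightarrow>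
    linear_map V W = linear_map V' W'"
  by (simp add: linear_map_def fun_eq_iff)

lemma bilinear_map_eqI:
  "carrier V = carrier V' \<Longrightarrow> scale V = scale V' \<Longrightarrow> carrier W = carrier W' \<Longrightarrow> scale W = scale W' \<Longrightarrow>
    bilinear_map V W X = bilinear_map V' W' X"
  by (simp add: bilinear_map_def linear_map_def fun_eq_iff)

lemma tensor_sum_eqI:
  "carrier V = carrier V' \<Longrightarrow> scale V = scale V' \<Longrightarrow> carrier W = carrier W' \<Longrightarrow> scale W = scale W' \<Longrightarrow>
    tensor_sum V W = tensor_sum V' W'"
  using bilinear_map_eqI[of V V' W W' ground]
  by (simp add: tensor_sum_def pure_tensor_def fun_eq_iff)

lemma trilinear_form_eqI:
  "carrier U = carrier U' \<Longrightarrow> scale U = scale U' \<Longrightarrow> carrier V = carrier V' \<Longrightarrow> scale V = scale V' \<Longrightarrow>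
    carrier W = carrier W' \<Longrightarrow> scale W = scale W' \<Longrightarrow>
    trilinear_form U V W = trilinear_form U' V' W'"
  using bilinear_map_eqI[of U U' V V' ground] bilinear_map_eqI[of U U' W W' ground]
    bilinear_map_eqI[of V V' W W' ground]
  by (simp add: trilinear_form_def fun_eq_iff)

lemma bilinear_map_flip: "bilinear_map V W X (\<lambda>x y. \<beta> y x) \<longleftrightarrow> bilinear_map W V X \<beta>"
  by (auto simp: bilinear_map_def)

lemma trilinear_form_flip:
  "trilinear_form W V U (\<lambda>w v u. \<tau> u v w) \<longleftrightarrow> trilinear_form U V W \<tau>"
proof -
  have "bilinear_map V U ground (\<lambda>v u. \<tau> u v w) \<longleftrightarrow> bilinear_map U V ground (\<lambda>u v. \<tau> u v w)"
    "bilinear_map W U ground (\<lambda>w u. \<tau> u v w) \<longleftrightarrow> bilinear_map U W ground (\<lambda>u w. \<tau> u v w)"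
    "bilinear_map W V ground (\<lambda>w v. \<tau> u v w) \<longleftrightarrow> bilinear_map V W ground (\<lambda>v w. \<tau> u v w)"
    for u v w
    by (rule bilinear_map_flip)+
  then show ?thesis unfolding trilinear_form_def by blast
qed

lemma tensor_sum_flip: "tensor_sum V W (map prod.swap xs) = flip (tensor_sum W V xs)"
proof -
  have "pure_tensor V W x y = flip (pure_tensor W V y x)" for x y
    using bilinear_map_flip[of W V ground] by (simp add: pure_tensor_def flip_def fun_eq_iff)
  then show ?thesis
    by (induction xs) (auto simp: tensor_sum_def flip_add simp: flip_def)
qed

text \<open>Turns an existential statement about representatives of a tensor into one about representatives of its flip.\<close>

lemma ex_map_swap: "(\<exists>xs. P xs) \<longleftrightarrow> (\<exists>xs. P (map prod.swap xs))"
proof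
  assume "\<exists>xs. P xs"
  then obtain xs where "P (map prod.swap (map prod.swap xs))" by (auto simp: comp_def)
  then show "\<exists>xs. P (map prod.swap xs)" by blast
qed blast

lemma set_map_swap: "set (map prod.swap xs) \<subseteq> A \<times> B \<longleftrightarrow> set xs \<subseteq> B \<times> A"
  by auto

lemma flip_tensor_carrier:
  assumes "carrier V = carrier V'" "scale V = scale V'" "carrier W = carrier W'" "scale W = scale W'"
  shows "flip t \<in> carrier (tensor V W) \<longleftrightarrow> t \<in> carrier (tensor W' V')"
proof -
  have "flip t \<in> carrier (tensor V W) \<longleftrightarrow>
      (\<exists>xs. flip t = tensor_sum V' W' xs \<and> set xs \<subseteq> carrier V' \<times> carrier W')"
    using tensor_sum_eqI[OF assms] assms by (simp add: tensor_def)
  also have "\<dots> \<longleftrightarrow> t \<in> carrier (tensor W' V')"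
    by (subst ex_map_swap) (simp add: tensor_sum_flip flip_eq_iff set_map_swap tensor_def
        del: set_map)
  finally show ?thesis .
qed

lemma expand_left_flip:
  assumes "carrier U = carrier U'" "scale U = scale U'" "carrier V = carrier V'" "scale V = scale V'"
    "carrier W = carrier W'" "scale W = scale W'"
  shows "expand_left U V W (\<lambda>x. flip (D x)) (flip t) =
    (\<lambda>\<tau>. expand_right W' V' U' D t (\<lambda>w v u. \<tau> u v w))"
  using trilinear_form_flip[of W' V' U'] trilinear_form_eqI[OF assms]
  by (simp add: expand_left_def expand_right_def flip_def fun_eq_iff)

lemma expand_right_flip:
  assumes "carrier U = carrier U'" "scale U = scale U'" "carrier V = carrier V'" "scale V = scale V'"
    "carrier W = carrier W'" "scale W = scale W'"
  shows "expand_right U V W (\<lambda>x. flip (D x)) (flip t) =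
    (\<lambda>\<tau>. expand_left W' V' U' D t (\<lambda>w v u. \<tau> u v w))"
  using trilinear_form_flip[of W' V' U'] trilinear_form_eqI[OF assms]
  by (simp add: expand_left_def expand_right_def flip_def fun_eq_iff)

lemma flip3_eq_iff:
  "(\<lambda>\<tau>. S (\<lambda>w v u. \<tau> u v w)) = (\<lambda>\<tau>. T (\<lambda>w v u. \<tau> u v w)) \<longleftrightarrow> S = T"
  by (auto simp: fun_eq_iff)

lemma linear_map_flip:
  assumes "carrier M = carrier M'" "scale M = scale M'"
    "carrier V = carrier V'" "scale V = scale V'" "carrier W = carrier W'" "scale W = scale W'"
  shows "linear_map M (tensor V W) (\<lambda>m. flip (D m)) \<longleftrightarrow> linear_map M' (tensor W' V') D"
  using assms flip_tensor_carrier[OF assms(3-6)]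
  by (simp add: linear_map_def flip_add[symmetric] flip_fscale[symmetric] flip_eq_iff)

lemma coalgebra_cop:
  assumes "coalgebra C"
  shows "coalgebra (cop C)"
  unfolding coalgebra_def
proof (intro conjI ballI)
  show "vspace (cop C)" using assms by (simp add: coalgebra_def vspace_def)
  show "linear_map (cop C) (tensor (cop C) (cop C)) (comult (cop C))"
    using assms linear_map_flip[of "cop C" C "cop C" C "cop C" C "comult C"]
    by (simp add: coalgebra_def)
  show "linear_map (cop C) ground (counit (cop C))"
    using assms linear_map_eqI[of "cop C" C ground ground] by (simp add: coalgebra_def)
  fix c assume "c \<in> carrier (cop C)"
  then have c: "c \<in> carrier C" by simp
  show "expand_left (cop C) (cop C) (cop C) (comult (cop C)) (comult (cop C) c) =
      expand_right (cop C) (cop C) (cop C) (comult (cop C)) (comult (cop C) c)"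
    using assms c expand_left_flip[of "cop C" C "cop C" C "cop C" C "comult C" "comult C c"]
      expand_right_flip[of "cop C" C "cop C" C "cop C" C "comult C" "comult C c"]
    by (simp add: coalgebra_def)
  obtain xs where xs: "set xs \<subseteq> carrier C \<times> carrier C" "comult C c = tensor_sum C C xs"
    "(\<Sum>(x, y)\<leftarrow>xs. scale C (counit C x) y) = c" "(\<Sum>(x, y)\<leftarrow>xs. scale C (counit C y) x) = c"
    using assms c unfolding coalgebra_def by blast
  have "comult (cop C) c = tensor_sum (cop C) (cop C) (map prod.swap xs)"
    using xs(2) tensor_sum_eqI[of "cop C" C "cop C" C] by (simp add: tensor_sum_flip)
  then show "\<exists>xs. set xs \<subseteq> carrier (cop C) \<times> carrier (cop C) \<and>
      comult (cop C) c = tensor_sum (cop C) (cop C) xs \<and>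
      (\<Sum>(x, y)\<leftarrow>xs. scale (cop C) (counit (cop C) x) y) = c \<and>
      (\<Sum>(x, y)\<leftarrow>xs. scale (cop C) (counit (cop C) y) x) = c"
    using xs by (intro exI[of _ "map prod.swap xs"]) (auto simp: comp_def case_prod_unfold)
qed

lemma right_comodule_flip: "right_comodule C (flip_comod M) \<longleftrightarrow> left_comodule (cop C) M"
proof -
  have "linear_map (flip_comod M) (tensor (flip_comod M) C) (coact (flip_comod M)) \<longleftrightarrow>
      linear_map M (tensor (cop C) M) (coact M)"
    using linear_map_flip[of "flip_comod M" M "flip_comod M" M C "cop C" "coact M"] by simp
  moreover have "expand_left (flip_comod M) C C (coact (flip_comod M)) (coact (flip_comod M) m) =
      expand_right (flip_comod M) C C (comult C) (coact (flip_comod M) m) \<longleftrightarrow>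
      expand_left (cop C) (cop C) M (comult (cop C)) (coact M m) =
      expand_right (cop C) (cop C) M (coact M) (coact M m)" for m
  proof -
    have l: "expand_left (flip_comod M) C C (coact (flip_comod M)) (coact (flip_comod M) m) =
        (\<lambda>\<tau>. expand_right (cop C) (cop C) M (coact M) (coact M m) (\<lambda>w v u. \<tau> u v w))"
      unfolding flip_comod_simps by (rule expand_left_flip) simp_all
    have r: "expand_right (flip_comod M) C C (comult C) (coact (flip_comod M) m) =
        (\<lambda>\<tau>. expand_left (cop C) (cop C) M (comult (cop C)) (coact M m) (\<lambda>w v u. \<tau> u v w))"
    proof -
      have c: "comult C = (\<lambda>c. flip (comult (cop C) c))" by simp
      show ?thesis
        unfolding flip_comod_simps by (subst c, rule expand_right_flip) simp_all
    qed
    show ?thesis unfolding l r by (subst flip3_eq_iff) (rule eq_commute)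
  qed
  moreover have "(\<exists>xs. set xs \<subseteq> carrier (flip_comod M) \<times> carrier C \<and>
      coact (flip_comod M) m = tensor_sum (flip_comod M) C xs \<and>
      (\<Sum>(n, c)\<leftarrow>xs. scale (flip_comod M) (counit C c) n) = m) \<longleftrightarrow>
    (\<exists>xs. set xs \<subseteq> carrier (cop C) \<times> carrier M \<and> coact M m = tensor_sum (cop C) M xs \<and>
      (\<Sum>(c, n)\<leftarrow>xs. scale M (counit (cop C) c) n) = m)" for m
    using tensor_sum_eqI[of "flip_comod M" M C "cop C"]
    by (subst ex_map_swap) (simp add: tensor_sum_flip flip_eq_iff set_map_swap comp_def
        case_prod_unfold del: set_map)
  moreover have "vspace (flip_comod M) \<longleftrightarrow> vspace M" by (simp add: vspace_def)
  ultimately show ?thesis by (simp only: right_comodule_def left_comodule_def flip_comod_simps)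
qed

lemma right_comodule_hom_flip:
  "right_comodule_hom C (flip_comod M) (flip_comod N) f \<longleftrightarrow> left_comodule_hom (cop C) M N f"
proof -
  have "tensor_map (flip_comod N) C f id (flip t) = flip (tensor_map (cop C) N id f t)" for t
    using bilinear_map_flip[of "cop C" N ground] bilinear_map_eqI[of "flip_comod N" N C "cop C" ground]
    by (simp add: tensor_map_def flip_def fun_eq_iff)
  moreover have "linear_map (flip_comod M) (flip_comod N) = linear_map M N"
    by (rule linear_map_eqI) simp_all
  ultimately show ?thesis
    by (simp add: right_comodule_hom_def left_comodule_hom_def flip_eq_iff)
qed

lemma right_subcomodule_flip:
  "right_subcomodule C (flip_comod M) K \<longleftrightarrow> left_subcomodule (cop C) M K"
proof -
  have "(\<exists>xs. set xs \<subseteq> K \<times> carrier C \<and> coact (flip_comod M) m = tensor_sum (flip_comod M) C xs) \<longleftrightarrow>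
    (\<exists>xs. set xs \<subseteq> carrier (cop C) \<times> K \<and> coact M m = tensor_sum (cop C) M xs)" for m
    using tensor_sum_eqI[of "flip_comod M" M C "cop C"]
    by (subst ex_map_swap) (simp add: tensor_sum_flip flip_eq_iff set_map_swap del: set_map)
  then show ?thesis
    by (simp only: right_subcomodule_def left_subcomodule_def flip_comod_simps)
qed

text \<open>Injective hulls only depend on the category, so they can be moved along a bijection between comodules that
  preserves and reflects morphisms and subobjects.\<close>

lemma injective_hull_transport:
  assumes FG: "\<And>M. F (G M) = M" and carrier: "\<And>M. carrier (F M) = carrier M"
    and cmd: "\<And>M. cmd' (F M) \<longleftrightarrow> cmd M"
    and hom: "\<And>M N f. hom' (F M) (F N) f \<longleftrightarrow> hom M N f"
    and sub: "\<And>M K. sub' (F M) K \<longleftrightarrow> sub M K"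
    and hull: "injective_hull cmd' hom' sub' (F S) E i"
  shows "injective_hull cmd hom sub S (G E) i"
proof -
  have obj: "injective_object cmd' hom' E" using hull by (simp add: injective_hull_def)
  note inj = this[unfolded injective_object_def, THEN conjunct2, rule_format]
  have "cmd' E" using obj by (simp add: injective_object_def)
  then have E_cmd: "cmd (G E)" using cmd[of "G E"] unfolding FG by blast
  have E_hom: "hom' (F X) E f \<longleftrightarrow> hom X (G E) f" for X f using hom[of X "G E"] unfolding FG .
  have E_sub: "sub' E K \<longleftrightarrow> sub (G E) K" for K using sub[of "G E"] unfolding FG .
  have "\<exists>g. hom Y (G E) g \<and> (\<forall>x\<in>carrier X. g (u x) = f x)"
    if "cmd X \<and> cmd Y \<and> hom X Y u \<and> inj_on u (carrier X) \<and> hom X (G E) f" for X Y u f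
    by (rule inj[of "F X" "F Y" u f, unfolded E_hom carrier cmd hom]) (rule that)
  then have "injective_object cmd hom (G E)"
    unfolding injective_object_def by (intro conjI allI impI E_cmd)
  moreover have "hom S (G E) i" using hull unfolding injective_hull_def E_hom by (elim conjE)
  moreover have "inj_on i (carrier S)"
    using hull unfolding injective_hull_def carrier by (elim conjE)
  moreover have "\<forall>N. sub (G E) N \<and> N \<noteq> {0} \<longrightarrow> N \<inter> i ` carrier S \<noteq> {0}"
    using hull unfolding injective_hull_def E_sub carrier by (elim conjE)
  ultimately show ?thesis unfolding injective_hull_def by (intro conjI)
qed

lemma right_semiperfect_cop:
  fixes C :: "('k::field, 'c::ab_group_add) coalg"
  assumes "left_semiperfect TYPE('m::ab_group_add) C"
  shows "right_semiperfect TYPE('m) (cop C)"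
  unfolding right_semiperfect_def
proof (intro allI impI)
  fix S :: "('k, 'm, ('k, 'c, 'm) tensor) comod"
  assume S: "left_comodule (cop C) S \<and> simple_object (left_subcomodule (cop C)) S"
  then have "right_comodule C (flip_comod S) \<and> simple_object (right_subcomodule C) (flip_comod S)"
    by (simp add: right_comodule_flip simple_object_def right_subcomodule_flip)
  then obtain E i where E: "injective_hull (right_comodule C) (right_comodule_hom C)
      (right_subcomodule C) (flip_comod S) E i" "finite_dim E"
    using assms unfolding left_semiperfect_def by blast
  have "injective_hull (left_comodule (cop C)) (left_comodule_hom (cop C))
      (left_subcomodule (cop C)) S (flip_comod E) i"
    by (rule injective_hull_transport[where F = flip_comod, OF _ _ right_comodule_flip
          right_comodule_hom_flip right_subcomodule_flip E(1)]) simp_all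
  moreover have "finite_dim (flip_comod E)" using E(2) by (simp add: finite_dim_def)
  ultimately show "\<exists>E i. injective_hull (left_comodule (cop C)) (left_comodule_hom (cop C))
      (left_subcomodule (cop C)) S E i \<and> finite_dim E" by blast
qed

lemma dual_cop: "dual (cop C) = dual C"
  using linear_map_eqI[of "cop C" C ground ground] by (simp add: dual_def)

lemma convolution_cop: "convolution (cop C) f g = convolution C g f"
  by (simp add: convolution_def flip_def mult.commute fun_eq_iff)

section \<open>Transport of a coalgebra structure along a linear bijection\<close>

lemma tensor_map_tensor_sum:
  assumes f: "linear_map V V' f" and g: "linear_map W W' g"
  shows "tensor_map V' W' f g (tensor_sum V W xs) = tensor_sum V' W' (map (\<lambda>(x, y). (f x, g y)) xs)"
proof
  fix \<beta>
  show "tensor_map V' W' f g (tensor_sum V W xs) \<beta> =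
      tensor_sum V' W' (map (\<lambda>(x, y). (f x, g y)) xs) \<beta>"
  proof (cases "bilinear_map V' W' ground \<beta>")
    case True
    then show ?thesis
      using tensor_sum_apply[OF bilinear_map_pullback[OF True f g], of xs]
      by (simp add: tensor_map_def tensor_sum_apply comp_def case_prod_unfold)
  qed (simp add: tensor_map_def tensor_sum_not_bilinear)
qed

lemma coalgebra_transport:
  fixes C :: "('k::field, 'c::ab_group_add) coalg" and D :: "('k, 'd::ab_group_add) coalg"
  assumes C: "coalgebra C" and D: "vspace D" and \<phi>: "linear_map C D \<phi>"
    and bij: "bij_betw \<phi> (carrier C) (carrier D)"
    and comult: "\<And>c. c \<in> carrier C \<Longrightarrow> comult D (\<phi> c) = tensor_map D D \<phi> \<phi> (comult C c)"
    and counit: "\<And>c. c \<in> carrier C \<Longrightarrow> counit D (\<phi> c) = counit C c"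
  shows "coalgebra D" and "coalgebra_iso C D \<phi>"
proof -
  interpret C: counital_coalgebra C by unfold_locales (rule C)
  let ?\<psi> = "inv_into (carrier C) \<phi>"
  have onto: "\<exists>c\<in>carrier C. d = \<phi> c" if "d \<in> carrier D" for d
    using that bij by (auto simp: bij_betw_def)
  have \<psi>\<phi>: "?\<psi> (\<phi> c) = c" if "c \<in> carrier C" for c
    using that bij by (auto simp: bij_betw_def)
  have \<psi>: "linear_map D C ?\<psi>"
    unfolding linear_map_def
  proof (intro conjI ballI allI)
    fix d d' a assume "d \<in> carrier D" "d' \<in> carrier D"
    then obtain c c' where c: "c \<in> carrier C" "c' \<in> carrier C" and d: "d = \<phi> c" "d' = \<phi> c'"
      using onto by blast
    have "d + d' = \<phi> (c + c')" using linear_map_add[OF \<phi> c] d by simp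
    then show "?\<psi> (d + d') = ?\<psi> d + ?\<psi> d'"
      using c d \<psi>\<phi> vspace_add[OF C.vspace_C c] by simp
  next
    fix a d assume "d \<in> carrier D"
    then obtain c where c: "c \<in> carrier C" and d: "d = \<phi> c" using onto by blast
    have "scale D a d = \<phi> (scale C a c)" using linear_map_scale[OF \<phi> c] d by simp
    then show "?\<psi> (scale D a d) = scale C a (?\<psi> d)"
      using c d \<psi>\<phi> vspace_scale[OF C.vspace_C c] by simp
  next
    fix d assume "d \<in> carrier D"
    then show "?\<psi> d \<in> carrier C" using onto \<psi>\<phi> by force
  qed
  have mem: "\<phi> c \<in> carrier D" if "c \<in> carrier C" for c using linear_map_mem[OF \<phi> that] .
  have sum: "comult D (\<phi> c) = tensor_sum D D (map (\<lambda>(x, y). (\<phi> x, \<phi> y)) (C.sweedler c))"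
    if "c \<in> carrier C" for c
    using comult[OF that] C.sweedler(2)[OF that] tensor_map_tensor_sum[OF \<phi> \<phi>] by simp
  have set: "set (map (\<lambda>(x, y). (\<phi> x, \<phi> y)) (C.sweedler c)) \<subseteq> carrier D \<times> carrier D"
    if "c \<in> carrier C" for c
    using C.sweedler(1)[OF that] mem by auto
  have eval: "comult D (\<phi> c) \<beta> = comult C c (\<lambda>x y. \<beta> (\<phi> x) (\<phi> y))"
    if "c \<in> carrier C" "bilinear_map D D ground \<beta>" for c \<beta>
    using that comult by (simp add: tensor_map_def)
  have D_linear: "linear_map D (tensor D D) (comult D)"
    unfolding linear_map_def
  proof (intro conjI ballI allI)
    fix d assume "d \<in> carrier D"
    then obtain c where c: "c \<in> carrier C" "d = \<phi> c" using onto by blast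
    show "comult D d \<in> carrier (tensor D D)"
      using tensor_carrierI[OF set[OF c(1)]] sum[OF c(1)] c(2) by simp
  next
    fix d d' assume "d \<in> carrier D" "d' \<in> carrier D"
    then obtain c c' where c: "c \<in> carrier C" "c' \<in> carrier C" and d: "d = \<phi> c" "d' = \<phi> c'"
      using onto by blast
    have s: "d + d' = \<phi> (c + c')" using linear_map_add[OF \<phi> c] d by simp
    show "comult D (d + d') = comult D d + comult D d'"
      unfolding s unfolding d
      by (rule ext) (simp add: comult c vspace_add[OF C.vspace_C c] tensor_map_def
          linear_map_add[OF C.comult_linear c])
  next
    fix a d assume "d \<in> carrier D"
    then obtain c where c: "c \<in> carrier C" and d: "d = \<phi> c" using onto by blast
    have s: "scale D a d = \<phi> (scale C a c)" using linear_map_scale[OF \<phi> c] d by simp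
    show "comult D (scale D a d) = scale (tensor D D) a (comult D d)"
      unfolding s unfolding d
      by (rule ext) (simp add: comult c vspace_scale[OF C.vspace_C c] tensor_map_def
          linear_map_scale[OF C.comult_linear c] fscale_apply)
  qed
  show "coalgebra D"
    unfolding coalgebra_def
  proof (intro conjI ballI D D_linear)
    show "linear_map D ground (counit D)"
    proof -
      have "linear_map D ground (\<lambda>d. counit C (?\<psi> d))"
        by (rule linear_map_comp[OF \<psi> C.counit_linear])
      moreover have "counit D d = counit C (?\<psi> d)" if "d \<in> carrier D" for d
        using onto[OF that] counit \<psi>\<phi> by force
      ultimately show ?thesis
        using linear_map_cong[of D "counit D" "\<lambda>d. counit C (?\<psi> d)" ground] D by simp
    qed
    fix d assume "d \<in> carrier D"
    then obtain c where c: "c \<in> carrier C" and d: "d = \<phi> c" using onto by blast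
    show "expand_left D D D (comult D) (comult D d) = expand_right D D D (comult D) (comult D d)"
    proof
      fix \<tau>
      show "expand_left D D D (comult D) (comult D d) \<tau> =
          expand_right D D D (comult D) (comult D d) \<tau>"
      proof (cases "trilinear_form D D D \<tau>")
        case \<tau>: True
        let ?\<tau> = "\<lambda>u v w. \<tau> (\<phi> u) (\<phi> v) (\<phi> w)"
        have \<tau>': "trilinear_form C C C ?\<tau>" by (rule trilinear_form_pullback[OF \<tau> \<phi> \<phi> \<phi>])
        have bil: "bilinear_map D D ground (\<lambda>u v. \<tau> u v (\<phi> w))"
          "bilinear_map D D ground (\<lambda>u v. \<tau> (\<phi> w) u v)" if "w \<in> carrier C" for w
          using \<tau> mem[OF that] by (auto simp: trilinear_form_def)
        have "expand_left D D D (comult D) (comult D d) \<tau> =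
            comult C c (\<lambda>x w. comult D (\<phi> x) (\<lambda>u v. \<tau> u v (\<phi> w)))"
          using \<tau> eval[OF c trilinear_expand_left[OF \<tau> D_linear D]] by (simp add: expand_left_def d)
        also have "\<dots> = comult C c (\<lambda>x w. comult C x (\<lambda>u v. ?\<tau> u v w))"
          by (rule tensor_cong[OF C.comult_mem[OF c] C.vspace_C C.vspace_C]) (rule eval[OF _ bil(1)])
        also have "\<dots> = expand_left C C C (comult C) (comult C c) ?\<tau>"
          using \<tau>' by (simp add: expand_left_def)
        also have "\<dots> = expand_right C C C (comult C) (comult C c) ?\<tau>"
          using C c by (simp add: coalgebra_def)
        also have "\<dots> = comult C c (\<lambda>u x. comult C x (\<lambda>v w. ?\<tau> u v w))"
          using \<tau>' by (simp add: expand_right_def)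
        also have "\<dots> = comult C c (\<lambda>u x. comult D (\<phi> x) (\<lambda>v w. \<tau> (\<phi> u) v w))"
          by (rule tensor_cong[OF C.comult_mem[OF c] C.vspace_C C.vspace_C])
            (rule eval[OF _ bil(2), symmetric])
        also have "\<dots> = expand_right D D D (comult D) (comult D d) \<tau>"
          using \<tau> eval[OF c trilinear_expand_right[OF \<tau> D_linear D]] by (simp add: expand_right_def d)
        finally show ?thesis .
      qed (simp add: expand_left_def expand_right_def)
    qed
    have swC: "x \<in> carrier C" "y \<in> carrier C" if "(x, y) \<in> set (C.sweedler c)" for x y
      using that C.sweedler(1)[OF c] by auto
    have "(\<Sum>(x, y)\<leftarrow>C.sweedler c. scale D (counit D (\<phi> x)) (\<phi> y)) =
        (\<Sum>(x, y)\<leftarrow>C.sweedler c. \<phi> (scale C (counit C x) y))"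
      using swC counit linear_map_scale[OF \<phi>]
      by (intro arg_cong[where f = sum_list] map_cong) auto
    also have "\<dots> = \<phi> c"
      using swC linear_map_sum_list[OF \<phi> C.vspace_C, of "C.sweedler c" "\<lambda>x y. scale C (counit C x) y"]
        vspace_scale[OF C.vspace_C] C.sweedler(3)[OF c] by simp
    finally have left: "(\<Sum>(x, y)\<leftarrow>C.sweedler c. scale D (counit D (\<phi> x)) (\<phi> y)) = d" by (simp add: d)
    have "(\<Sum>(x, y)\<leftarrow>C.sweedler c. scale D (counit D (\<phi> y)) (\<phi> x)) =
        (\<Sum>(x, y)\<leftarrow>C.sweedler c. \<phi> (scale C (counit C y) x))"
      using swC counit linear_map_scale[OF \<phi>]
      by (intro arg_cong[where f = sum_list] map_cong) auto
    also have "\<dots> = \<phi> c"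
      using swC linear_map_sum_list[OF \<phi> C.vspace_C, of "C.sweedler c" "\<lambda>x y. scale C (counit C y) x"]
        vspace_scale[OF C.vspace_C] C.sweedler(4)[OF c] by simp
    finally have right: "(\<Sum>(x, y)\<leftarrow>C.sweedler c. scale D (counit D (\<phi> y)) (\<phi> x)) = d" by (simp add: d)
    show "\<exists>xs. set xs \<subseteq> carrier D \<times> carrier D \<and> comult D d = tensor_sum D D xs \<and>
      (\<Sum>(x, y)\<leftarrow>xs. scale D (counit D x) y) = d \<and> (\<Sum>(x, y)\<leftarrow>xs. scale D (counit D y) x) = d"
      using set[OF c] sum[OF c] left right unfolding d[symmetric]
      by (intro exI[of _ "map (\<lambda>(x, y). (\<phi> x, \<phi> y)) (C.sweedler c)"])
        (simp add: comp_def case_prod_unfold)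
  qed
  have "coalgebra_hom C D \<phi>"
    unfolding coalgebra_hom_def using \<phi> comult counit by blast
  moreover have "coalgebra_hom D C ?\<psi>"
    unfolding coalgebra_hom_def
  proof (intro conjI ballI \<psi>)
    fix d assume "d \<in> carrier D"
    then obtain c where c: "c \<in> carrier C" and d: "d = \<phi> c" using onto by blast
    show "counit C (?\<psi> d) = counit D d" using c d counit \<psi>\<phi> by simp
    have "map (\<lambda>(x, y). (?\<psi> (\<phi> x), ?\<psi> (\<phi> y))) (C.sweedler c) = C.sweedler c"
      using C.sweedler(1)[OF c] \<psi>\<phi> by (intro map_idI) auto
    then show "comult C (?\<psi> d) = tensor_map C C ?\<psi> ?\<psi> (comult D d)"
      using C.sweedler(2)[OF c] \<psi>\<phi>[OF c]
      by (simp add: d sum[OF c] tensor_map_tensor_sum[OF \<psi> \<psi>] comp_def case_prod_unfold)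
  qed
  ultimately show "coalgebra_iso C D \<phi>" unfolding coalgebra_iso_def using bij by blast
qed

section \<open>Local units and coreflexivity\<close>

lemma rat_dual_simps [simp]: "scale (rat_dual C) = fscale" "mult (rat_dual C) = convolution C"
  by (simp_all add: rat_dual_def dual_algebra_def dual_def)

lemma scale_finite_dual [simp]: "scale (finite_dual A) = fscale"
  by (simp add: finite_dual_def)

lemma finite_dual_iff:
  "F \<in> carrier (finite_dual A) \<longleftrightarrow> linear_map A ground F \<and> (\<forall>x. x \<notin> carrier A \<longrightarrow> F x = 0) \<and>
    (\<exists>I. two_sided_ideal A I \<and> finite_codim A I \<and> (\<forall>x\<in>I. F x = 0))"
  by (simp add: finite_dual_def dual_def)

text \<open>For spaces of functions, \<open>D \<otimes> D\<close> embeds into the functions of two variables, because evaluations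
  separate points of \<open>D\<close>. This makes the comultiplication of a finite dual unique.\<close>

lemma tensor_eq_of_evaluations:
  fixes D :: "('k::field, 'a \<Rightarrow> 'k) vspc"
  assumes D: "vspace D" and scale: "scale D = fscale"
    and support: "\<And>f x. f \<in> carrier D \<Longrightarrow> x \<notin> A \<Longrightarrow> f x = 0"
    and xs: "set xs \<subseteq> carrier D \<times> carrier D" and ys: "set ys \<subseteq> carrier D \<times> carrier D"
    and eq: "\<And>a b. a \<in> A \<Longrightarrow> b \<in> A \<Longrightarrow> (\<Sum>(g, h)\<leftarrow>xs. g a * h b) = (\<Sum>(g, h)\<leftarrow>ys. g a * h b)"
  shows "tensor_sum D D xs = tensor_sum D D ys"
proof
  fix \<beta>
  show "tensor_sum D D xs \<beta> = tensor_sum D D ys \<beta>"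
  proof (cases "bilinear_map D D ground \<beta>")
    case \<beta>: True
    let ?neg = "map (\<lambda>(x, y). (- x, y))"
    let ?P = "(\<lambda>a (f :: 'a \<Rightarrow> 'k). f a) ` A"
    have "(\<Sum>(x, y)\<leftarrow>xs @ ?neg ys. \<beta> x y) = 0"
    proof (rule separated_tensor_vanishes[where P = ?P, OF D D _ _ \<beta>])
      show "linear_map D ground p" if "p \<in> ?P" for p
        using that by (auto simp: linear_map_def scale fscale_apply)
      show "\<exists>p\<in>?P. p f \<noteq> 0" if f: "f \<in> carrier D" "f \<noteq> 0" for f
      proof -
        obtain a where "f a \<noteq> 0" using f(2) by (auto simp: fun_eq_iff)
        moreover from this have "a \<in> A" using support[OF f(1), of a] by metis
        ultimately show ?thesis by (intro bexI[of _ "\<lambda>f. f a"] imageI)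
      qed
      show "set (xs @ ?neg ys) \<subseteq> carrier D \<times> carrier D"
        using xs ys vspace_neg[OF D] by auto
      fix p assume "p \<in> ?P"
      then obtain a where a: "a \<in> A" "p = (\<lambda>f. f a)" by blast
      show "(\<Sum>(x, y)\<leftarrow>xs @ ?neg ys. scale D (p x) y) = 0"
      proof
        fix b
        have "(\<Sum>(x, y)\<leftarrow>xs. x a * y b) = (\<Sum>(x, y)\<leftarrow>ys. x a * y b)"
        proof (cases "b \<in> A")
          case True
          then show ?thesis by (rule eq[OF a(1)])
        next
          case False
          have "(\<Sum>(x, y)\<leftarrow>zs. x a * y b) = 0" if zs: "set zs \<subseteq> carrier D \<times> carrier D" for zs
          proof (rule sum_list_zeroI)
            fix x y assume "(x, y) \<in> set zs"
            then have "y b = 0" using zs support[OF _ False] by blast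
            then show "x a * y b = 0" by simp
          qed
          then show ?thesis using xs ys by simp
        qed
        moreover have "(\<Sum>p\<leftarrow>zs. - (fst p a * snd p b)) = - (\<Sum>p\<leftarrow>zs. fst p a * snd p b)"
          for zs :: "(('a \<Rightarrow> 'k) \<times> ('a \<Rightarrow> 'k)) list"
          by (induction zs) auto
        ultimately show "(\<Sum>(x, y)\<leftarrow>xs @ ?neg ys. scale D (p x) y) b = 0 b"
          by (simp add: sum_list_fun_apply case_prod_unfold fscale_apply scale a(2) comp_def)
      qed
    qed
    moreover have "(\<Sum>(x, y)\<leftarrow>?neg zs. \<beta> x y) = - (\<Sum>(x, y)\<leftarrow>zs. \<beta> x y)"
      if "set zs \<subseteq> carrier D \<times> carrier D" for zs
      using that
    proof (induction zs)
      case (Cons z zs)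
      obtain x y where z: "z = (x, y)" by force
      have "linear_map D ground (\<lambda>x. \<beta> x y)" "x \<in> carrier D"
        using Cons.prems z bilinear_map_leftD[OF \<beta>] by auto
      then have "\<beta> (- x) y = - \<beta> x y"
        using linear_map_diff[of D ground "\<lambda>x. \<beta> x y" 0 x] linear_map_zero[of D ground "\<lambda>x. \<beta> x y"]
          vspace_zero[OF D] D by simp
      then show ?case using Cons z by (simp del: uminus_apply)
    qed simp
    ultimately show ?thesis using ys by (simp add: tensor_sum_apply[OF \<beta>])
  qed (simp add: tensor_sum_not_bilinear)
qed

text \<open>All that the remaining arguments need from semiperfectness on the two sides.\<close>

locale separated_coalgebra = counital_coalgebra C
  for C :: "('k::field, 'c::ab_group_add) coalg" +
  assumes rat_separating: "c \<in> carrier C \<Longrightarrow> c \<noteq> 0 \<Longrightarrow> \<exists>f\<in>rat. f c \<noteq> 0"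
    and rrat_separating: "c \<in> carrier C \<Longrightarrow> c \<noteq> 0 \<Longrightarrow> \<exists>f\<in>carrier (rat_dual (cop C)). f c \<noteq> 0"
begin

sublocale cop: counital_coalgebra "cop C"
  by unfold_locales (rule coalgebra_cop[OF coalgebra])

abbreviation rrat :: "('c \<Rightarrow> 'k) set" where
  "rrat \<equiv> carrier (rat_dual (cop C))"

lemma rrat_star: "f \<in> rrat \<Longrightarrow> f \<in> star"
  using cop.rat_star by (simp add: dual_cop)

lemma rrat_left_ideal: "g \<in> star \<Longrightarrow> f \<in> rrat \<Longrightarrow> convolution C g f \<in> rrat"
  using cop.rat_right_ideal by (simp add: dual_cop convolution_cop)

lemma rat_interpolates:
  assumes "finite X" "X \<subseteq> carrier C"
  shows "\<exists>f\<in>rat. \<forall>x\<in>X. f x = eps x" and "\<exists>f\<in>rrat. \<forall>x\<in>X. f x = eps x"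
  using separating_interpolates[OF vspace_C subspace_rat star_linear[OF rat_star]
      rat_separating star_linear[OF eps_star] assms]
    separating_interpolates[OF vspace_C cop.subspace_rat star_linear[OF rrat_star]
      rrat_separating star_linear[OF eps_star] assms]
  by auto

text \<open>Choose \<open>a\<close> in the left rational part agreeing with the counit \<open>\<epsilon>\<close> on \<open>X\<close>, and \<open>b\<close> in the right one
  agreeing with \<open>\<epsilon>\<close> on the right factors of the \<open>\<Delta>(x)\<close>. Then \<open>(a * b)(x) = (a * \<epsilon>)(x) = a(x)\<close>, and
  \<open>a * b\<close> is in both ideals.\<close>

lemma local_counit:
  assumes X: "finite X" "X \<subseteq> carrier C"
  shows "\<exists>e\<in>rat \<inter> rrat. \<forall>x\<in>X. e x = eps x"
proof -
  let ?Y = "\<Union>x\<in>X. snd ` set (sweedler x)"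
  have Y: "finite ?Y" "?Y \<subseteq> carrier C" using X sweedler(1) by fastforce+
  obtain a where a: "a \<in> rat" "\<forall>x\<in>X. a x = eps x" using rat_interpolates(1)[OF X] by blast
  obtain b where b: "b \<in> rrat" "\<forall>y\<in>?Y. b y = eps y" using rat_interpolates(2)[OF Y] by blast
  have star: "a \<in> star" "b \<in> star" using a b rat_star rrat_star by auto
  have "convolution C a b x = eps x" if x: "x \<in> X" for x
  proof -
    have xC: "x \<in> carrier C" using x X by auto
    have "convolution C a b x = (\<Sum>(u, v)\<leftarrow>sweedler x. a u * b v)"
      using comult_apply[OF xC bilinear_star[OF star]] by (simp add: convolution_eq[OF xC])
    also have "\<dots> = (\<Sum>(u, v)\<leftarrow>sweedler x. a u * eps v)"
      using b(2) x by (intro arg_cong[where f = sum_list] map_cong) force+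
    also have "\<dots> = convolution C a eps x"
      using comult_apply[OF xC bilinear_star[OF star(1) eps_star]] by (simp add: convolution_eq[OF xC])
    finally show ?thesis using eps_convolution(2)[OF star(1)] a(2) x by simp
  qed
  moreover have "convolution C a b \<in> rat \<inter> rrat"
    using rat_right_ideal[OF a(1) star(2)] rrat_left_ideal[OF star(1) b(1)] by blast
  ultimately show ?thesis by blast
qed

text \<open>Write \<open>g * b\<close> as the sum of the \<open>g(c) n\<close>. A functional \<open>e\<close> that agrees with \<open>\<epsilon>\<close> at the finitely many \<open>c\<close>
  satisfies \<open>e * b = \<epsilon> * b = b\<close>.\<close>

lemma local_left_unit:
  assumes B: "finite B" "B \<subseteq> rat"
  shows "\<exists>e\<in>rat \<inter> rrat. \<forall>b\<in>B. convolution C e b = b"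
proof -
  have "\<forall>b\<in>B. \<exists>xs. set xs \<subseteq> carrier C \<times> star \<and>
      (\<forall>g\<in>star. convolution C g b = (\<Sum>(c, n)\<leftarrow>xs. fscale (g c) n))"
    using B(2) rat_iff by blast
  then obtain T where T: "\<And>b. b \<in> B \<Longrightarrow> set (T b) \<subseteq> carrier C \<times> star"
    "\<And>b g. b \<in> B \<Longrightarrow> g \<in> star \<Longrightarrow> convolution C g b = (\<Sum>(c, n)\<leftarrow>T b. fscale (g c) n)"
    by metis
  let ?X = "\<Union>b\<in>B. fst ` set (T b)"
  have X: "finite ?X" "?X \<subseteq> carrier C" using B T(1) by fastforce+
  obtain e where e: "e \<in> rat \<inter> rrat" "\<forall>x\<in>?X. e x = eps x" using local_counit[OF X] by blast
  have "convolution C e b = b" if b: "b \<in> B" for b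
  proof -
    have "convolution C e b = (\<Sum>(c, n)\<leftarrow>T b. fscale (e c) n)" using T(2)[OF b] e rat_star by blast
    also have "\<dots> = (\<Sum>(c, n)\<leftarrow>T b. fscale (eps c) n)"
    proof (intro arg_cong[where f = sum_list] map_cong refl, clarify)
      fix c n assume "(c, n) \<in> set (T b)"
      then have "c \<in> ?X" using b by force
      then have "e c = eps c" using e(2) by blast
      then show "fscale (e c) n = fscale (eps c) n" by simp
    qed
    also have "\<dots> = convolution C eps b" using T(2)[OF b eps_star] by simp
    also have "\<dots> = b" using eps_convolution(1) rat_star B(2) b by blast
    finally show ?thesis .
  qed
  then show ?thesis using e(1) by blast
qed

lemma vspace_rat: "vspace (rat_dual C)"
  by (simp add: vspace_def fscale.vector_space_axioms subspace_rat)

lemma phi_l_apply: "f \<in> rat \<Longrightarrow> phi_l C c f = f c"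
  by (simp add: phi_l_def)

lemma phi_l_linear_in_functional: "linear_map (rat_dual C) ground (phi_l C c)"
  using fscale.subspace_add[OF subspace_rat] fscale.subspace_scale[OF subspace_rat]
  by (auto simp: linear_map_def phi_l_def fscale_apply)

lemma phi_l_add: "c \<in> carrier C \<Longrightarrow> d \<in> carrier C \<Longrightarrow> phi_l C (c + d) = phi_l C c + phi_l C d"
  and phi_l_scale: "c \<in> carrier C \<Longrightarrow> phi_l C (scale C a c) = fscale a (phi_l C c)"
  using linear_map_add[OF star_linear[OF rat_star]] linear_map_scale[OF star_linear[OF rat_star]]
  by (auto simp: phi_l_def fun_eq_iff fscale_apply)

text \<open>The functionals \<open>f\<close> for which all \<open>(g * f * h)(c)\<close> vanish form an ideal, namely the annihilator of the
  subcoalgebra generated by \<open>c\<close>. It has finite codimension since it suffices that \<open>f\<close> vanishes at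
  the finitely many middle factors of \<open>c\<^sub>1 \<otimes> c\<^sub>2 \<otimes> c\<^sub>3\<close>; it lies in the kernel by taking \<open>g = h = \<epsilon>\<close>.\<close>

lemma phi_l_finite_dual:
  assumes c: "c \<in> carrier C"
  shows "phi_l C c \<in> carrier (finite_dual (rat_dual C))"
proof -
  define I where
    "I = {f \<in> rat. \<forall>g\<in>star. \<forall>h\<in>star. convolution C (convolution C g f) h c = 0}"
  have I_rat: "I \<subseteq> rat" by (auto simp: I_def)
  have sub: "fscale.subspace I"
  proof (rule fscale.subspaceI)
    have 0: "convolution C (convolution C g 0) h = 0" if "g \<in> star" "h \<in> star" for g h
      using that convolution_scale_right[of g 0 0] convolution_scale_left[of 0 h 0]
        fscale.subspace_0[OF subspace_star] by (simp del: zero_fun_apply)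
    then show "0 \<in> I" using fscale.subspace_0[OF subspace_rat] by (simp add: I_def)
  next
    fix f f' assume f: "f \<in> I" "f' \<in> I"
    then have star: "f \<in> star" "f' \<in> star" using I_rat rat_star by auto
    have "convolution C (convolution C g (f + f')) h c = 0" if "g \<in> star" "h \<in> star" for g h
    proof -
      have "convolution C (convolution C g (f + f')) h =
          convolution C (convolution C g f) h + convolution C (convolution C g f') h"
        using that star
        by (simp only: convolution_add_right convolution_add_left convolution_star)
      then show ?thesis using f that by (simp add: I_def)
    qed
    then show "f + f' \<in> I"
      using f fscale.subspace_add[OF subspace_rat] by (simp add: I_def del: plus_fun_apply)
  next
    fix a f assume f: "f \<in> I"
    then have star: "f \<in> star" using I_rat rat_star by auto
    have "convolution C (convolution C g (fscale a f)) h c = 0" if "g \<in> star" "h \<in> star" for g h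
    proof -
      have "convolution C (convolution C g (fscale a f)) h =
          fscale a (convolution C (convolution C g f) h)"
        using that star
        by (simp only: convolution_scale_right convolution_scale_left convolution_star)
      then show ?thesis using f that by (simp add: I_def fscale_apply)
    qed
    then show "fscale a f \<in> I"
      using f fscale.subspace_scale[OF subspace_rat] by (simp add: I_def)
  qed
  have ideal: "two_sided_ideal (rat_dual C) I"
    unfolding two_sided_ideal_def rat_dual_simps
  proof (intro conjI ballI I_rat sub)
    fix a f assume a: "a \<in> rat" and f: "f \<in> I"
    have star: "a \<in> star" "f \<in> star" "f \<in> rat" using a f rat_star I_rat by auto
    have "convolution C (convolution C g (convolution C a f)) h c = 0" if "g \<in> star" "h \<in> star" for g h
      using f that star convolution_star[OF that(1) star(1)]
      by (simp add: I_def convolution_assoc[symmetric])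
    then show "convolution C a f \<in> I" using rat_left_ideal star by (simp add: I_def)
    have "convolution C (convolution C g (convolution C f a)) h c = 0" if "g \<in> star" "h \<in> star" for g h
    proof -
      have "convolution C (convolution C g (convolution C f a)) h =
          convolution C (convolution C g f) (convolution C a h)"
        using that star by (simp add: convolution_assoc convolution_star)
      then show ?thesis using f convolution_star[OF star(1) that(2)] that(1) by (simp add: I_def)
    qed
    then show "convolution C f a \<in> I" using rat_right_ideal star by (simp add: I_def)
  qed
  define Y where "Y = (\<Union>(x, y)\<in>set (sweedler c). snd ` set (sweedler x))"
  have vanish: "f \<in> I" if f: "f \<in> rat" and zero: "\<forall>y\<in>Y. f y = 0" for f
  proof -
    have "convolution C (convolution C g f) h c = 0" if g: "g \<in> star" and h: "h \<in> star" for g h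
    proof -
      have "convolution C g f x = 0" if xy: "(x, y) \<in> set (sweedler c)" for x y
      proof -
        have x: "x \<in> carrier C" using sweedler(1)[OF c] xy by auto
        have "convolution C g f x = (\<Sum>(u, v)\<leftarrow>sweedler x. g u * f v)"
          using comult_apply[OF x bilinear_star[OF g rat_star[OF f]]] by (simp add: convolution_eq[OF x])
        also have "\<dots> = 0"
        proof (rule sum_list_zeroI)
          fix u v assume "(u, v) \<in> set (sweedler x)"
          then have "v \<in> Y" unfolding Y_def using xy by force
          then have "f v = 0" using zero by blast
          then show "g u * f v = 0" by simp
        qed
        finally show ?thesis .
      qed
      note zero = this
      have "(\<Sum>(x, y)\<leftarrow>sweedler c. convolution C g f x * h y) = 0"
      proof (rule sum_list_zeroI)
        fix x y assume "(x, y) \<in> set (sweedler c)"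
        then show "convolution C g f x * h y = 0" by (simp add: zero)
      qed
      then show ?thesis
        using comult_apply[OF c bilinear_star[OF convolution_star[OF g rat_star[OF f]] h]]
        by (simp add: convolution_eq[OF c])
    qed
    then show ?thesis using f by (simp add: I_def)
  qed
  have "finite Y" by (auto simp: Y_def)
  then obtain B where B: "finite B" "B \<subseteq> rat" "\<forall>f\<in>rat. \<exists>b\<in>fscale.span B. \<forall>y\<in>Y. f y = b y"
    using finite_conditions_finite_codim[OF subspace_rat] by meson
  have "rat \<subseteq> fscale.span (I \<union> B)"
  proof
    fix f assume f: "f \<in> rat"
    then obtain b where b: "b \<in> fscale.span B" "\<forall>y\<in>Y. f y = b y" using B(3) by blast
    have "b \<in> rat" using b(1) fscale.span_minimal[OF B(2) subspace_rat] by blast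
    then have "f - b \<in> I" using f b(2) fscale.subspace_diff[OF subspace_rat] by (intro vanish) auto
    then have "(f - b) + b \<in> fscale.span (I \<union> B)"
      using b(1) fscale.span_mono[of B "I \<union> B"] by (intro fscale.span_add) (auto intro: fscale.span_base)
    then show "f \<in> fscale.span (I \<union> B)" by simp
  qed
  moreover have "fscale.span (I \<union> B) \<subseteq> rat" using I_rat B(2) subspace_rat by (intro fscale.span_minimal) auto
  ultimately have "finite_codim (rat_dual C) I"
    using B(1,2) unfolding finite_codim_def rat_dual_simps by blast
  moreover have "phi_l C c f = 0" if "f \<in> I" for f
  proof -
    have "convolution C (convolution C eps f) eps c = 0" using that eps_star by (simp add: I_def)
    then show ?thesis using that I_rat rat_star eps_convolution by (auto simp: phi_l_def)
  qed
  ultimately show ?thesis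
    unfolding finite_dual_iff using ideal phi_l_linear_in_functional[of c]
    by (intro conjI allI impI exI[of _ I] ballI) (simp_all add: phi_l_def)
qed

lemma vspace_dual: "vspace (dual C)"
  using subspace_star fscale.vector_space_axioms by (simp add: vspace_def dual_def)

lemma convolution_linear_right: "f \<in> star \<Longrightarrow> linear_map (dual C) (dual C) (convolution C f)"
  using convolution_star convolution_add_right convolution_scale_right
  by (simp add: linear_map_def) (simp add: dual_def)

text \<open>The element \<open>e\<close> is used twice: once to replace \<open>r\<close> by a finite combination of the \<open>h\<^sub>k\<close> with
  coefficients \<open>r(d\<^sub>k)\<close>, and once more to bring the \<open>h\<^sub>k\<close>, which are arbitrary functionals, into
  the rational part, where \<open>F\<close> is linear.\<close>

lemma phi_l_onto:
  assumes F: "F \<in> carrier (finite_dual (rat_dual C))"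
  shows "\<exists>c\<in>carrier C. F = phi_l C c"
proof -
  have lin: "linear_map (rat_dual C) ground F" and outside: "\<And>f. f \<notin> rat \<Longrightarrow> F f = 0"
    using F by (auto simp: finite_dual_iff)
  obtain I where I: "two_sided_ideal (rat_dual C) I" "finite_codim (rat_dual C) I" "\<forall>f\<in>I. F f = 0"
    using F by (auto simp: finite_dual_iff)
  obtain B where B: "finite B" "B \<subseteq> rat" "rat = fscale.span (I \<union> B)"
    using I(2) by (auto simp: finite_codim_def)
  obtain e where e: "e \<in> rat" "e \<in> rrat" "\<forall>b\<in>B. convolution C e b = b"
    using local_left_unit[OF B(1,2)] by blast
  have e_star: "e \<in> star" using rat_star[OF e(1)] .
  have unit: "F (convolution C e r) = F r" if r: "r \<in> rat" for r
  proof -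
    \<comment> \<open>both sides vanish on \<open>I\<close>, an ideal, and agree on \<open>B\<close>\<close>
    let ?S = "{r \<in> rat. F (convolution C e r) = F r}"
    have "fscale.subspace ?S"
    proof (rule fscale.subspaceI)
      have "convolution C e 0 = 0"
        using linear_map_zero[OF convolution_linear_right[OF e_star] vspace_dual] .
      then show "0 \<in> ?S" using fscale.subspace_0[OF subspace_rat] by simp
    next
      fix r s assume "r \<in> ?S" "s \<in> ?S"
      then show "r + s \<in> ?S"
        using fscale.subspace_add[OF subspace_rat] rat_left_ideal[OF e_star] e_star
        by (simp add: convolution_add_right rat_star linear_map_add[OF lin] del: plus_fun_apply)
    next
      fix a r assume "r \<in> ?S"
      then show "fscale a r \<in> ?S"
        using fscale.subspace_scale[OF subspace_rat] rat_left_ideal[OF e_star] e_star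
          linear_map_scale[OF lin]
        by (simp add: convolution_scale_right rat_star)
    qed
    moreover have "I \<union> B \<subseteq> ?S"
      using I(1,3) B(2) e(1,3) by (auto simp: two_sided_ideal_def)
    ultimately have "fscale.span (I \<union> B) \<subseteq> ?S" by (intro fscale.span_minimal)
    then show ?thesis using r B(3) by blast
  qed
  obtain ys where ys: "set ys \<subseteq> carrier C \<times> star"
    "\<And>g. g \<in> star \<Longrightarrow> convolution C e g = (\<Sum>(d, h)\<leftarrow>ys. fscale (g d) h)"
    using e(2) unfolding cop.rat_iff by (auto simp: dual_cop convolution_cop)
  define c where "c = (\<Sum>(d, h)\<leftarrow>ys. scale C (F (convolution C e h)) d)"
  have c: "c \<in> carrier C"
    unfolding c_def using ys(1) vspace_scale[OF vspace_C] by (intro vspace_sum_list[OF vspace_C]) auto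
  have "F r = r c" if r: "r \<in> rat" for r
  proof -
    have r_star: "r \<in> star" using rat_star[OF r] .
    have h_rat: "convolution C e h \<in> rat" if "(d, h) \<in> set ys" for d h
      using that ys(1) rat_right_ideal[OF e(1)] by auto
    have "F r = F (convolution C e (convolution C e r))"
      using unit rat_left_ideal[OF e_star] r by simp
    also have "convolution C e (convolution C e r) =
        convolution C e (\<Sum>(d, h)\<leftarrow>ys. fscale (r d) h)"
      using ys(2)[OF r_star] by simp
    also have "\<dots> = (\<Sum>(d, h)\<leftarrow>ys. convolution C e (fscale (r d) h))"
      using ys(1) fscale.subspace_scale[OF subspace_star]
      by (intro linear_map_sum_list[OF convolution_linear_right[OF e_star] vspace_dual]) auto
    also have "\<dots> = (\<Sum>(d, h)\<leftarrow>ys. fscale (r d) (convolution C e h))"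
      using ys(1) convolution_scale_right[OF e_star]
      by (intro arg_cong[where f = sum_list] map_cong) auto
    also have "F \<dots> = (\<Sum>(d, h)\<leftarrow>ys. F (fscale (r d) (convolution C e h)))"
      using h_rat fscale.subspace_scale[OF subspace_rat]
      by (intro linear_map_sum_list[OF lin vspace_rat]) auto
    also have "\<dots> = (\<Sum>(d, h)\<leftarrow>ys. r (scale C (F (convolution C e h)) d))"
    proof (intro arg_cong[where f = sum_list] map_cong refl, clarify)
      fix d h assume dh: "(d, h) \<in> set ys"
      then have "d \<in> carrier C" using ys(1) by auto
      then show "F (fscale (r d) (convolution C e h)) = r (scale C (F (convolution C e h)) d)"
        using linear_map_scale[OF lin h_rat[OF dh]] linear_map_scale[OF star_linear[OF r_star]]
        by (simp add: mult.commute)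
    qed
    also have "\<dots> = r c"
      unfolding c_def using ys(1) vspace_scale[OF vspace_C]
      by (intro linear_map_sum_list[OF star_linear[OF r_star] vspace_C, symmetric]) auto
    finally show ?thesis .
  qed
  then have "F = phi_l C c" using outside by (auto simp: phi_l_def fun_eq_iff)
  then show ?thesis using c by blast
qed

lemma phi_l_bij: "bij_betw (phi_l C) (carrier C) (carrier (finite_dual (rat_dual C)))"
proof (rule bij_betw_imageI)
  show "inj_on (phi_l C) (carrier C)"
  proof (rule inj_onI, rule ccontr)
    fix c d assume c: "c \<in> carrier C" "d \<in> carrier C" and eq: "phi_l C c = phi_l C d" and "c \<noteq> d"
    then obtain f where f: "f \<in> rat" "f (c - d) \<noteq> 0"
      using rat_separating[of "c - d"] vspace_diff[OF vspace_C] by auto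
    then have "f c = f d" using phi_l_apply[OF f(1)] eq by metis
    then show False using f linear_map_diff[OF star_linear[OF rat_star[OF f(1)]] vspace_C c] by simp
  qed
  show "phi_l C ` carrier C = carrier (finite_dual (rat_dual C))"
    using phi_l_finite_dual phi_l_onto by blast
qed

lemma vspace_finite_dual: "vspace (finite_dual (rat_dual C))"
proof -
  have eq: "carrier (finite_dual (rat_dual C)) = phi_l C ` carrier C"
    using phi_l_bij by (simp add: bij_betw_def)
  have "fscale.subspace (carrier (finite_dual (rat_dual C)))"
    unfolding eq
  proof (rule fscale.subspaceI)
    have "phi_l C 0 = 0"
      using phi_l_scale[OF vspace_zero[OF vspace_C], of 0] by (simp del: zero_fun_apply)
    then show "0 \<in> phi_l C ` carrier C" using vspace_zero[OF vspace_C] by (metis imageI)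
  next
    fix F G assume "F \<in> phi_l C ` carrier C" "G \<in> phi_l C ` carrier C"
    then obtain c d where c: "c \<in> carrier C" "d \<in> carrier C" and FG: "F = phi_l C c" "G = phi_l C d"
      by (elim imageE)
    show "F + G \<in> phi_l C ` carrier C"
      unfolding FG phi_l_add[OF c, symmetric] using vspace_add[OF vspace_C c] by (rule imageI)
  next
    fix a F assume "F \<in> phi_l C ` carrier C"
    then obtain c where c: "c \<in> carrier C" and F: "F = phi_l C c" by blast
    show "fscale a F \<in> phi_l C ` carrier C"
      unfolding F phi_l_scale[OF c, symmetric] using vspace_scale[OF vspace_C c] by (rule imageI)
  qed
  then show ?thesis by (simp add: vspace_def fscale.vector_space_axioms)
qed

lemma finite_dual_comult_phi_l:
  assumes c: "c \<in> carrier C"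
  shows "finite_dual_comult (rat_dual C) (phi_l C c) =
    tensor_sum (finite_dual (rat_dual C)) (finite_dual (rat_dual C))
      (map (\<lambda>(x, y). (phi_l C x, phi_l C y)) (sweedler c))"
proof -
  let ?D = "finite_dual (rat_dual C)"
  let ?xs = "map (\<lambda>(x, y). (phi_l C x, phi_l C y)) (sweedler c)"
  have set: "set ?xs \<subseteq> carrier ?D \<times> carrier ?D"
    using sweedler(1)[OF c] phi_l_finite_dual by auto
  have rep: "phi_l C c (convolution C a b) = (\<Sum>(g, h)\<leftarrow>?xs. g a * h b)"
    if a: "a \<in> rat" and b: "b \<in> rat" for a b
  proof -
    have "phi_l C c (convolution C a b) = (\<Sum>(x, y)\<leftarrow>sweedler c. a x * b y)"
      using comult_apply[OF c bilinear_star[OF rat_star[OF a] rat_star[OF b]]]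
        rat_left_ideal[OF rat_star[OF a] b] by (simp add: phi_l_apply convolution_eq[OF c])
    then show ?thesis using a b by (simp add: phi_l_apply comp_def case_prod_unfold)
  qed
  show ?thesis
    unfolding finite_dual_comult_def rat_dual_simps
  proof (rule the_equality)
    show "\<exists>xs. set xs \<subseteq> carrier ?D \<times> carrier ?D \<and> tensor_sum ?D ?D ?xs = tensor_sum ?D ?D xs \<and>
      (\<forall>a\<in>rat. \<forall>b\<in>rat. phi_l C c (convolution C a b) = (\<Sum>(g, h)\<leftarrow>xs. g a * h b))"
      using set rep by blast
  next
    fix t
    assume "\<exists>xs. set xs \<subseteq> carrier ?D \<times> carrier ?D \<and> t = tensor_sum ?D ?D xs \<and>
      (\<forall>a\<in>rat. \<forall>b\<in>rat. phi_l C c (convolution C a b) = (\<Sum>(g, h)\<leftarrow>xs. g a * h b))"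
    then obtain xs where xs: "set xs \<subseteq> carrier ?D \<times> carrier ?D" "t = tensor_sum ?D ?D xs"
      "\<And>a b. a \<in> rat \<Longrightarrow> b \<in> rat \<Longrightarrow> phi_l C c (convolution C a b) = (\<Sum>(g, h)\<leftarrow>xs. g a * h b)"
      by blast
    show "t = tensor_sum ?D ?D ?xs"
      unfolding xs(2)
    proof (rule tensor_eq_of_evaluations[OF vspace_finite_dual scale_finite_dual _ xs(1) set])
      show "f x = 0" if "f \<in> carrier ?D" "x \<notin> rat" for f x
        using that by (simp add: finite_dual_iff)
      show "(\<Sum>(g, h)\<leftarrow>xs. g a * h b) = (\<Sum>(g, h)\<leftarrow>?xs. g a * h b)" if "a \<in> rat" "b \<in> rat" for a b
        using xs(3)[OF that] rep[OF that] by simp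
    qed
  qed
qed

lemma phi_l_coalgebra_iso:
  defines "D \<equiv> finite_dual_coalg (rat_dual C) (\<lambda>F. counit C (inv_into (carrier C) (phi_l C) F))"
  shows "coalgebra D \<and> coalgebra_iso C D (phi_l C)"
proof -
  let ?D = "finite_dual (rat_dual C)"
  have D: "carrier D = carrier ?D" "scale D = fscale" "comult D = finite_dual_comult (rat_dual C)"
    "counit D = (\<lambda>F. counit C (inv_into (carrier C) (phi_l C) F))"
    by (simp_all add: D_def finite_dual_coalg_def)
  have "vspace D" using vspace_finite_dual by (simp add: vspace_def D)
  moreover have lin: "linear_map C D (phi_l C)"
    using phi_l_finite_dual phi_l_add phi_l_scale by (simp add: linear_map_def D)
  moreover have "bij_betw (phi_l C) (carrier C) (carrier D)" using phi_l_bij by (simp add: D)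
  moreover have "comult D (phi_l C c) = tensor_map D D (phi_l C) (phi_l C) (comult C c)"
    if c: "c \<in> carrier C" for c
    using finite_dual_comult_phi_l[OF c] tensor_sum_eqI[of D ?D D ?D] sweedler(2)[OF c]
      tensor_map_tensor_sum[OF lin lin] by (simp add: D)
  moreover have "counit D (phi_l C c) = counit C c" if "c \<in> carrier C" for c
    using that phi_l_bij by (simp add: D bij_betw_def)
  ultimately show ?thesis using coalgebra_transport[OF coalgebra, of D "phi_l C"] by blast
qed

end

theorem theorem4p6:
  fixes C :: "('k::field, 'c::ab_group_add) coalg"
  assumes "coalgebra C"
    and "adequate_universe TYPE('m::ab_group_add) C"
    and "left_semiperfect TYPE('m) C"
    and "right_semiperfect TYPE('m) C"
  shows "left_coreflexive C \<and>
    (\<exists>e. coalgebra (finite_dual_coalg (rat_dual C) e) \<and>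
         coalgebra_iso C (finite_dual_coalg (rat_dual C) e) (phi_l C))"
proof -
  obtain V :: "('k, 'm) vspc" and j where j: "vspace V" "linear_map C V j" "inj_on j (carrier C)"
    using assms(2) by (auto simp: adequate_universe_def)
  interpret E: embedded_coalgebra C V j
    by unfold_locales (use assms(1) j in auto)
  have "linear_map (cop C) V j" using j(2) linear_map_eqI[of "cop C" C V V] by simp
  then interpret E': embedded_coalgebra "cop C" V j
    by unfold_locales (use coalgebra_cop[OF assms(1)] j in auto)
  interpret separated_coalgebra C
  proof unfold_locales
    show "\<exists>f\<in>carrier (rat_dual C). f c \<noteq> 0" if "c \<in> carrier C" "c \<noteq> 0" for c
      using E.rat_separates[OF assms(4) that] .
    show "\<exists>f\<in>carrier (rat_dual (cop C)). f c \<noteq> 0" if "c \<in> carrier C" "c \<noteq> 0" for c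
      using E'.rat_separates[OF right_semiperfect_cop[OF assms(3)]] that by simp
  qed
  show ?thesis using phi_l_bij phi_l_coalgebra_iso by (auto simp: left_coreflexive_def)
qed

end
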